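(* Let $\kappa\ge2$ be an integer, let $U_1,\dots,U_\kappa\in\mathcal W^u$ be distinct unstable leaves of $M=[0,1]^2$, let $T_0:M\to\bigcup_{i=1}^\kappa U_i$ be the associated singular Baker's transformation and $\mathcal L_0$ its transfer operator. Then $\mathcal L_0$ is bounded as an operator on $\mathcal B$ and on $\mathcal B_w$. It is quasi-compact as an operator on $\mathcal B$: its spectral radius is $1$, while its essential spectral radius is at most $\kappa^{-\beta}$. Moreover $\mathcal L_0$ has a spectral gap on $\mathcal B$ and its unique invariant probability measure in $\mathcal B$ is given by $\mu_0=\kappa^{-1}\sum_{i=1}^\kappa\delta_{U_i}$. As a consequence, there exist $C>0$ and $\sigma<1$ such that for any $f\in\mathcal B$ with $f(\mathbf 1)=1$, we have $$\|\mathcal L_0^nf-\mu_0\|_{\mathcal B}\le C\sigma^n\|f\|_{\mathcal B}\qquad\text{for all }n\ge0.$$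
   Context: Singular map. $M=[0,1]^2$, $m$ is Lebesgue measure. $M$ is divided into $\kappa$ vertical rectangles $R_1,\dots,R_\kappa$ of width $1/\kappa$ and height $1$. $T_0$ maps $R_i$ onto $U_i$: it collapses each vertical segment of $R_i$ to a point and expands affinely by the factor $\kappa$ in the horizontal direction (horizontal orientation on each $R_i$ fixed arbitrarily). It is the limit as $\lambda\to0$ of $(\kappa,\lambda)$ Baker's transformations $T_\lambda$ (affine on each $R_i$, horizontal expansion $\kappa$, vertical contraction $\lambda$, images pairwise disjoint mod $0$) with $T_\lambda(R_i)\supset U_i$. (Values on common sides of the $R_i$ are not specified; formulas are understood via the $\kappa$ affine branches.) $\delta_U$ denotes Lebesgue (arclength) measure on $U\in\mathcal W^u$. Spaces. $\mathcal W^s$ (resp. $\mathcal W^u$) is the set of full vertical (resp. horizontal) line segments of length $1$ in $M$, called stable (resp. unstable) leaves. For $W\in\mathcal W^s$ and $\alpha\in[0,1]$, $|\varphi|_{C^\alpha(W)}=\sup_W|\varphi|+H^\alpha_W(\varphi)$, with $H^\alpha_W(\varphi)=\sup_{x\ne y\in W}|\varphi(x)-\varphi(y)|/|x-y|^\alpha$; $|\varphi|_{C^\alpha(\mathcal W^s)}=\sup_{W\in\mathcal W^s}|\varphi|_{C^\alpha(W)}$. $C^1$ always means Lipschitz: $C^1(W)$ is the set of Lipschitz functions on $W$ and $C^1(\mathcal W^s)$ the set of measurable functions on $M$ with $|\varphi|_{C^1(\mathcal W^s)}<\infty$; for $\alpha<1$, $C^\alpha(W)$, $C^\alpha(\mathcal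 W^s)$ are the completions of $C^1(W)$, $C^1(\mathcal W^s)$ in the respective norms. $C^\alpha(\mathcal W^u)$ is defined in the same way with unstable leaves. $m_W$ is arclength on $W$. Write $W=\{(s_W,t):t\in[0,1]\}$ for $W\in\mathcal W^s$, $d(W_1,W_2)=|s_{W_1}-s_{W_2}|$, and for functions $\varphi_i$ on $W_i$, $d_0(\varphi_1,\varphi_2)=\sup_t|\varphi_1(s_{W_1},t)-\varphi_2(s_{W_2},t)|$. Fix $\alpha,\beta\in(0,1)$ with $\beta\le1-\alpha$. For $f\in C^1(\mathcal W^u)$ set $|f|_w=\sup_{W\in\mathcal W^s}\sup\{\int_Wf\varphi\,dm_W:|\varphi|_{C^1(W)}\le1\}$, $\|f\|_s=\sup_{W\in\mathcal W^s}\sup\{\int_Wf\varphi\,dm_W:\varphi\in C^\alpha(W),|\varphi|_{C^\alpha(W)}\le1\}$, $\|f\|_u=\sup_{W_1,W_2\in\mathcal W^s}\sup\{d(W_1,W_2)^{-\beta}|\int_{W_1}f\varphi_1\,dm_{W_1}-\int_{W_2}f\varphi_2\,dm_{W_2}|:|\varphi_i|_{C^1(W_i)}\le1,\ d_0(\varphi_1,\varphi_2)=0\}$, $\|f\|_{\mathcal B}=\|f\|_s+\|f\|_u$. $\mathcal B_w$ and $\mathcal B$ are the completions of $C^1(\mathcal W^u)$ in $|\cdot|_w$ and $\|\cdot\|_{\mathcal B}$. A function $f\in C^1(\mathcal W^u)$ is identified with the measure $f\,dm$, $f(\varphi)=\int_Mf\varphi\,dm$; via this identification $\mathcal B\subset\mathcal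 B_w\subset(C^1(\mathcal W^s))^*$. $\mathbf 1$ is the constant function $1$ on $M$. Transfer operator. $\mathcal L_0f(\varphi)=f(\varphi\circ T_0)$. For $f\in C^1(\mathcal W^u)$ (and by extension for $f\in\mathcal B$), $\mathcal L_0f=\sum_{i=1}^\kappa\kappa^{-1}\,(\bar f\circ T_0^{-1})\,\delta_{U_i}$, where $\bar f(x)=\int_{W_x}f\,dm_{W_x}$ and $W_x$ is the stable leaf containing $x$ ($\bar f$ is constant on stable leaves and $T_0^{-1}$ of a point of $U_i$ is a stable leaf in $R_i$). As usual, spectra refer to complexifications. "Spectral gap" means that $1$ is a simple eigenvalue and the rest of the spectrum lies in a disk of radius strictly less than $1$. *)

theory Defs
  imports "HOL-Probability.Probability"
begin

section \<open>The unit square, its leaves, and functions regular along leaves\<close>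

text \<open>A function on a subset of the plane is represented by a total function of which only the
  values on that subset are ever used.\<close>

definition unit_square :: "(real \<times> real) set" where
  "unit_square = {0..1} \<times> {0..1}"

definition stable_leaf :: "real \<Rightarrow> (real \<times> real) set" where
  "stable_leaf s = {s} \<times> {0..1}"

definition unstable_leaf :: "real \<Rightarrow> (real \<times> real) set" where
  "unstable_leaf t = {0..1} \<times> {t}"

definition holder_seminorm :: "real \<Rightarrow> (real \<times> real) set \<Rightarrow> (real \<times> real \<Rightarrow> real) \<Rightarrow> ennreal" where
  "holder_seminorm a W \<phi> =
     (SUP (x, y) \<in> {(x, y). x \<in> W \<and> y \<in> W \<and> x \<noteq> y}. ennreal (\<bar>\<phi> x - \<phi> y\<bar> / dist x y powr a))"

definition holder_norm :: "real \<Rightarrow> (real \<times> real) set \<Rightarrow> (real \<times> real \<Rightarrow> real) \<Rightarrow> ennreal" where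
  "holder_norm a W \<phi> = (SUP x \<in> W. ennreal \<bar>\<phi> x\<bar>) + holder_seminorm a W \<phi>"

definition C1_leaf :: "(real \<times> real) set \<Rightarrow> (real \<times> real \<Rightarrow> real) set" where
  "C1_leaf W = {\<phi>. \<exists>K. K-lipschitz_on W \<phi>}"

text \<open>For \<open>a < 1\<close>, the completion of the Lipschitz functions on \<open>W\<close> in the \<open>a\<close>-Hoelder norm. Since
  the functions of finite \<open>a\<close>-Hoelder norm already form a complete space, this completion is
  the closure of the Lipschitz functions among functions on \<open>W\<close>.\<close>

definition holder_leaf :: "real \<Rightarrow> (real \<times> real) set \<Rightarrow> (real \<times> real \<Rightarrow> real) set" where
  "holder_leaf a W =
     {\<phi>. \<forall>\<epsilon>>0. \<exists>\<psi> \<in> C1_leaf W. holder_norm a W (\<lambda>x. \<phi> x - \<psi> x) < ennreal \<epsilon>}"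

text \<open>\<open>C\<^sup>1(\<W>\<^sup>s)\<close> and \<open>C\<^sup>1(\<W>\<^sup>u)\<close>. Measurability is Borel measurability, so that test functions can be
  integrated against arbitrary Borel measures on the square.\<close>

definition C1_stable :: "(real \<times> real \<Rightarrow> real) set" where
  "C1_stable = {\<phi> \<in> borel_measurable (restrict_space borel unit_square).
     (SUP s \<in> {0..1}. holder_norm 1 (stable_leaf s) \<phi>) < \<infinity>}"

definition C1_unstable :: "(real \<times> real \<Rightarrow> real) set" where
  "C1_unstable = {f \<in> borel_measurable (restrict_space borel unit_square).
     (SUP t \<in> {0..1}. holder_norm 1 (unstable_leaf t) f) < \<infinity>}"

section \<open>The anisotropic norms\<close>

definition stable_integral :: "real \<Rightarrow> (real \<times> real \<Rightarrow> real) \<Rightarrow> real" where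
  "stable_integral s g = (LBINT t:{0..1}. g (s, t))"

definition unstable_integral :: "real \<Rightarrow> (real \<times> real \<Rightarrow> real) \<Rightarrow> real" where
  "unstable_integral t g = (LBINT s:{0..1}. g (s, t))"

text \<open>The following suprema are taken in the reals. They are used only for \<open>f \<in> C1_unstable\<close>; such
  an \<open>f\<close> is bounded and uniformly Lipschitz along horizontal leaves, so that the sets are bounded
  above (the exponent in the unstable norm being less than 1).\<close>

definition weak_norm :: "(real \<times> real \<Rightarrow> real) \<Rightarrow> real" where
  "weak_norm f = Sup {stable_integral s (\<lambda>p. f p * \<phi> p) | s \<phi>.
     s \<in> {0..1} \<and> holder_norm 1 (stable_leaf s) \<phi> \<le> 1}"

definition strong_stable_norm :: "real \<Rightarrow> (real \<times> real \<Rightarrow> real) \<Rightarrow> real" where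
  "strong_stable_norm \<alpha> f = Sup {stable_integral s (\<lambda>p. f p * \<phi> p) | s \<phi>.
     s \<in> {0..1} \<and> \<phi> \<in> holder_leaf \<alpha> (stable_leaf s) \<and> holder_norm \<alpha> (stable_leaf s) \<phi> \<le> 1}"

definition test_dist ::
  "real \<Rightarrow> real \<Rightarrow> (real \<times> real \<Rightarrow> real) \<Rightarrow> (real \<times> real \<Rightarrow> real) \<Rightarrow> ennreal" where
  "test_dist s1 s2 \<phi>1 \<phi>2 = (SUP t \<in> {0..1}. ennreal \<bar>\<phi>1 (s1, t) - \<phi>2 (s2, t)\<bar>)"

definition strong_unstable_norm :: "real \<Rightarrow> (real \<times> real \<Rightarrow> real) \<Rightarrow> real" where
  "strong_unstable_norm \<beta> f = Sup
     {\<bar>s1 - s2\<bar> powr (- \<beta>) *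
        \<bar>stable_integral s1 (\<lambda>p. f p * \<phi>1 p) - stable_integral s2 (\<lambda>p. f p * \<phi>2 p)\<bar> | s1 s2 \<phi>1 \<phi>2.
      s1 \<in> {0..1} \<and> s2 \<in> {0..1} \<and> s1 \<noteq> s2 \<and>
      holder_norm 1 (stable_leaf s1) \<phi>1 \<le> 1 \<and> holder_norm 1 (stable_leaf s2) \<phi>2 \<le> 1 \<and>
      test_dist s1 s2 \<phi>1 \<phi>2 = 0}"

definition strong_norm :: "real \<Rightarrow> real \<Rightarrow> (real \<times> real \<Rightarrow> real) \<Rightarrow> real" where
  "strong_norm \<alpha> \<beta> f = strong_stable_norm \<alpha> f + strong_unstable_norm \<beta> f"

section \<open>Completions, and their elements as functionals\<close>

text \<open>\<open>is_completion V p E\<close>: the Banach space \<open>'b\<close> together with the canonical map \<open>E\<close> is the completion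
  of the space \<open>V\<close> of functions with respect to the seminorm \<open>p\<close>. This determines \<open>('b, E)\<close> up to
  a unique isometric isomorphism. (\<open>p\<close> may vanish on functions that are zero almost everywhere;
  \<open>E\<close> identifies these with 0.) A type cannot depend on the parameters of \<open>p\<close>, hence the
  characterisation in place of a construction.\<close>

definition is_completion ::
  "('a \<Rightarrow> real) set \<Rightarrow> (('a \<Rightarrow> real) \<Rightarrow> real) \<Rightarrow> (('a \<Rightarrow> real) \<Rightarrow> 'b::banach) \<Rightarrow> bool" where
  "is_completion V p E \<longleftrightarrow>
     (\<forall>f\<in>V. \<forall>g\<in>V. E (\<lambda>x. f x + g x) = E f + E g) \<and>
     (\<forall>c. \<forall>f\<in>V. E (\<lambda>x. c * f x) = c *\<^sub>R E f) \<and>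
     (\<forall>f\<in>V. norm (E f) = p f) \<and>
     closure (E ` V) = UNIV"

text \<open>The value \<open>x(\<phi>)\<close> of an element \<open>x\<close> of a completion of \<open>C\<^sup>1(\<W>\<^sup>u)\<close> on a test function: the continuous
  extension of \<open>f(\<phi>) = \<integral> f \<phi> dm\<close>.\<close>

definition pairing ::
  "((real \<times> real \<Rightarrow> real) \<Rightarrow> 'b::banach) \<Rightarrow> 'b \<Rightarrow> (real \<times> real \<Rightarrow> real) \<Rightarrow> real" where
  "pairing E x \<phi> = (THE c. \<forall>f. (\<forall>n. f n \<in> C1_unstable) \<and> (\<lambda>n::nat. E (f n)) \<longlonglongrightarrow> x \<longrightarrow>
     (\<lambda>n. LINT p:unit_square|lborel. f n p * \<phi> p) \<longlonglongrightarrow> c)"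

definition is_probability_measure :: "((real \<times> real \<Rightarrow> real) \<Rightarrow> 'b::banach) \<Rightarrow> 'b \<Rightarrow> bool" where
  "is_probability_measure E x \<longleftrightarrow>
     (\<exists>P. prob_space P \<and> sets P = sets (restrict_space borel unit_square) \<and>
          (\<forall>\<phi> \<in> C1_stable. pairing E x \<phi> = (LINT p|P. \<phi> p)))"

section \<open>The singular Baker's transformation and its transfer operator\<close>

text \<open>The strip \<open>{i / \<kappa>..(i + 1) / \<kappa>} \<times> {0..1}\<close>, \<open>i < \<kappa>\<close>, is mapped onto the leaf at height \<open>h i\<close>;
  \<open>flip i\<close> tells whether the horizontal orientation is reversed there. A common side of two
  strips is assigned to the strip on its right; this is a convention without effect on the
  transfer operator, since elements of the completions do not charge single stable leaves.\<close>

definition singular_baker ::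
  "nat \<Rightarrow> (nat \<Rightarrow> real) \<Rightarrow> (nat \<Rightarrow> bool) \<Rightarrow> real \<times> real \<Rightarrow> real \<times> real" where
  "singular_baker \<kappa> h flip = (\<lambda>(x, y).
     let i = min (nat \<lfloor>real \<kappa> * x\<rfloor>) (\<kappa> - 1); s = real \<kappa> * x - real i
     in (if flip i then 1 - s else s, h i))"

text \<open>\<open>y = \<L> x\<close> in the sense of functionals: \<open>y(\<phi>) = x(\<phi> \<circ> T)\<close> for all test functions.\<close>

definition transfer_image ::
  "((real \<times> real \<Rightarrow> real) \<Rightarrow> 'b::banach) \<Rightarrow> (real \<times> real \<Rightarrow> real \<times> real) \<Rightarrow> 'b \<Rightarrow> 'b \<Rightarrow> bool" where
  "transfer_image E T x y \<longleftrightarrow> (\<forall>\<phi> \<in> C1_stable. pairing E y \<phi> = pairing E x (\<phi> \<circ> T))"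

definition transfer_operator ::
  "((real \<times> real \<Rightarrow> real) \<Rightarrow> 'b::banach) \<Rightarrow> (real \<times> real \<Rightarrow> real \<times> real) \<Rightarrow> 'b \<Rightarrow> 'b" where
  "transfer_operator E T x = (THE y. transfer_image E T x y)"

section \<open>Spectral theory of bounded operators on real Banach spaces\<close>

text \<open>The complexification of \<open>'b\<close> is \<open>'b \<times> 'b\<close>, with \<open>(x, y)\<close> standing for \<open>x + \<i> y\<close>. The product norm
  is equivalent to any complexification norm, and only the topology matters below.\<close>

definition cscale :: "complex \<Rightarrow> 'b::real_vector \<times> 'b \<Rightarrow> 'b \<times> 'b" where
  "cscale c = (\<lambda>(x, y). (Re c *\<^sub>R x - Im c *\<^sub>R y, Re c *\<^sub>R y + Im c *\<^sub>R x))"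

definition complexify :: "('b \<Rightarrow> 'b) \<Rightarrow> 'b \<times> 'b \<Rightarrow> 'b \<times> 'b" where
  "complexify T = map_prod T T"

definition shifted :: "('b::real_vector \<Rightarrow> 'b) \<Rightarrow> complex \<Rightarrow> 'b \<times> 'b \<Rightarrow> 'b \<times> 'b" where
  "shifted T c z = complexify T z - cscale c z"

definition spectrum :: "('b::real_normed_vector \<Rightarrow> 'b) \<Rightarrow> complex set" where
  "spectrum T = {c. \<not> (\<exists>S. bounded_linear S \<and>
     (\<forall>z. S (shifted T c z) = z) \<and> (\<forall>z. shifted T c (S z) = z))}"

definition spectral_radius :: "('b::real_normed_vector \<Rightarrow> 'b) \<Rightarrow> real" where
  "spectral_radius T = (SUP c \<in> spectrum T. cmod c)"

definition eigenvalue :: "('b::real_vector \<Rightarrow> 'b) \<Rightarrow> complex \<Rightarrow> bool" where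
  "eigenvalue T c \<longleftrightarrow> (\<exists>z. z \<noteq> 0 \<and> shifted T c z = 0)"

text \<open>\<open>P\<close> is the spectral projection of \<open>T\<close> at \<open>c\<close>: it splits the complexified space into closed
  invariant subspaces, with \<open>T - c\<close> nilpotent on the range of \<open>P\<close> and invertible on the kernel
  of \<open>P\<close>. (At a general isolated point of the spectrum \<open>T - c\<close> is only quasi-nilpotent on the
  range; in finite rank the two are the same.) The rank of \<open>P\<close> is the algebraic multiplicity
  of \<open>c\<close>.\<close>

definition spectral_projection ::
  "('b::real_normed_vector \<Rightarrow> 'b) \<Rightarrow> complex \<Rightarrow> ('b \<times> 'b \<Rightarrow> 'b \<times> 'b) \<Rightarrow> bool" where
  "spectral_projection T c P \<longleftrightarrow>
     bounded_linear P \<and> (\<forall>a z. P (cscale a z) = cscale a (P z)) \<and>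
     (\<forall>z. P (P z) = P z) \<and> (\<forall>z. P (complexify T z) = complexify T (P z)) \<and>
     (\<exists>n. \<forall>z. (shifted T c ^^ n) (P z) = 0) \<and>
     bij_betw (shifted T c) {z. P z = 0} {z. P z = 0}"

definition isolated_finite_eigenvalue :: "('b::real_normed_vector \<Rightarrow> 'b) \<Rightarrow> complex \<Rightarrow> bool" where
  "isolated_finite_eigenvalue T c \<longleftrightarrow>
     eigenvalue T c \<and> \<not> c islimpt spectrum T \<and>
     (\<exists>P. spectral_projection T c P \<and> (\<exists>A. finite A \<and> range P \<subseteq> span A))"

definition simple_eigenvalue :: "('b::real_normed_vector \<Rightarrow> 'b) \<Rightarrow> complex \<Rightarrow> bool" where
  "simple_eigenvalue T c \<longleftrightarrow>
     eigenvalue T c \<and>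
     (\<exists>P e. spectral_projection T c P \<and> e \<noteq> 0 \<and> range P = {cscale a e | a. True})"

text \<open>The smallest radius outside which the spectrum consists of isolated eigenvalues of finite
  (algebraic) multiplicity.\<close>

definition essential_spectral_radius :: "('b::real_normed_vector \<Rightarrow> 'b) \<Rightarrow> real" where
  "essential_spectral_radius T =
     Inf {r. 0 \<le> r \<and> (\<forall>c \<in> spectrum T. r < cmod c \<longrightarrow> isolated_finite_eigenvalue T c)}"

definition quasi_compact :: "('b::real_normed_vector \<Rightarrow> 'b) \<Rightarrow> bool" where
  "quasi_compact T \<longleftrightarrow> bounded_linear T \<and> essential_spectral_radius T < spectral_radius T"

definition spectral_gap :: "('b::real_normed_vector \<Rightarrow> 'b) \<Rightarrow> bool" where
  "spectral_gap T \<longleftrightarrow>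
     simple_eigenvalue T 1 \<and> (\<exists>r. 0 \<le> r \<and> r < 1 \<and> (\<forall>c \<in> spectrum T - {1}. cmod c \<le> r))"

end

(* The transfer operator only sees f through its averages over stable leaves, a function g on [0,1] that is
   beta-Hoelder with constant the unstable norm of f, and on g it acts as the Perron-Frobenius
   operator of the full-branch affine map of the interval. That operator preserves the integral and multiplies
   the beta-Hoelder constant by kappa^(-beta); as a mean zero function is bounded by its oscillation,
   L^n contracts the hyperplane f(1) = 0 at the rate kappa^(-n beta). Together with the fixed vector
   mu_0 this is the whole spectral picture: off {1} and the disk of radius kappa^(-beta), the resolvent
   is a Neumann series, and no compactness is needed. *)
theory Submission
  imports Defs
begin

section \<open>Rank-one spectral gap\<close>

text \<open>On the completion the operator is a \<open>THE\<close> over elements that are known only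
  through their pairings, and this causes two difficulties. Uniqueness: an element with vanishing
  pairings must be 0, yet a sequence of functions could be Cauchy, tend weakly to 0 and still keep
  its norm. Excluding this is \<open>closable\<close>; for the strong norm it depends on Hoelder
  tests being limits of Lipschitz ones. Existence: the image of a function is a measure on segments,
  so it has to be reached as a limit of functions. \<open>approx m g\<close> thickens each segment
  vertically, a direction in which \<open>C1_unstable\<close> asks for no regularity, and Hoelder
  tests barely vary across the thickening, so the sequence is Cauchy in norm. Bounds uniform in m
  then extend the operator by density. One application only turns f into its leaf mean; the
  contraction shows from the second one on, and the constant
  \<open>2 * \<kappa> powr \<beta>\<close> pays for this shift.\<close>

lemma cscale_add: "cscale c (z + w) = cscale c z + cscale c w"
  by (cases z; cases w) (simp add: cscale_def algebra_simps)

lemma cscale_scaleR: "cscale c (r *\<^sub>R z) = r *\<^sub>R cscale c z"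
  by (cases z) (simp add: cscale_def algebra_simps)

lemma cscale_cscale: "cscale a (cscale b z) = cscale (a * b) z"
  by (cases z) (simp add: cscale_def algebra_simps)

lemma cscale_one [simp]: "cscale 1 z = z"
  by (cases z) (simp add: cscale_def)

lemma cscale_diff_left: "cscale (a - b) z = cscale a z - cscale b z"
  by (cases z) (simp add: cscale_def algebra_simps)

text \<open>The factor 4 counts the four real products in \<open>cscale\<close>, each at most
  \<open>cmod c * norm z\<close>. Only its finiteness matters.\<close>

lemma norm_cscale_le:
  fixes z :: "'b::real_normed_vector \<times> 'b"
  shows "norm (cscale c z) \<le> 4 * cmod c * norm z"
proof -
  obtain x y where z: "z = (x, y)" by fastforce
  have x: "norm x \<le> norm z" and y: "norm y \<le> norm z"
    using norm_fst_le[of x y] norm_snd_le[of y x] by (simp_all add: z)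
  have *: "norm (Re c *\<^sub>R u) \<le> cmod c * norm z" "norm (Im c *\<^sub>R u) \<le> cmod c * norm z"
    if "norm u \<le> norm z" for u :: 'b
    using that by (auto intro!: mult_mono abs_Re_le_cmod abs_Im_le_cmod)
  have "norm (cscale c z) \<le> norm (Re c *\<^sub>R x - Im c *\<^sub>R y) + norm (Re c *\<^sub>R y + Im c *\<^sub>R x)"
    by (simp add: z cscale_def norm_Pair_le)
  also have "\<dots> \<le> (norm (Re c *\<^sub>R x) + norm (Im c *\<^sub>R y)) + (norm (Re c *\<^sub>R y) + norm (Im c *\<^sub>R x))"
    by (intro add_mono norm_triangle_ineq norm_triangle_ineq4)
  finally show ?thesis using *[OF x] *[OF y] by linarith
qed

lemma bounded_linear_cscale: "bounded_linear (cscale c :: 'b::real_normed_vector \<times> 'b \<Rightarrow> _)"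
  by (rule bounded_linear_intro[where K = "4 * cmod c"])
    (use norm_cscale_le in \<open>auto simp: cscale_add cscale_scaleR mult.commute mult.left_commute\<close>)

lemma bounded_linear_map_prod:
  assumes "bounded_linear f" "bounded_linear g"
  shows "bounded_linear (map_prod f g)"
proof -
  have "bounded_linear (\<lambda>z. (f (fst z), g (snd z)))"
    by (intro bounded_linear_Pair bounded_linear_compose[OF assms(1)]
        bounded_linear_compose[OF assms(2)] bounded_linear_fst bounded_linear_snd)
  then show ?thesis by (simp add: map_prod_def case_prod_beta')
qed

lemma complexify_cscale:
  assumes "bounded_linear T"
  shows "complexify T (cscale c z) = cscale c (complexify T z)"
proof -
  interpret bounded_linear T by fact
  show ?thesis
    by (cases z) (simp add: complexify_def cscale_def add diff scaleR)
qed

lemma complexify_funpow: "(complexify T ^^ n) (x, y) = ((T ^^ n) x, (T ^^ n) y)"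
  by (induction n) (auto simp: complexify_def)

text \<open>All that spectral theory needs from the dynamics: the space splits into the line of
  \<open>\<mu>\<close> and the kernel of \<open>l\<close>, both invariant, with geometric decay on
  the kernel. The decay concerns all powers and carries a constant \<open>C\<close>, because a
  single application of \<open>L\<close> need not contract the given norm.\<close>

locale rank_one_plus_contraction =
  fixes L :: "'b::banach \<Rightarrow> 'b" and l :: "'b \<Rightarrow> real" and \<mu> :: 'b and C \<sigma> :: real
  assumes L: "bounded_linear L" and l: "bounded_linear l"
    and L_mu: "L \<mu> = \<mu>" and l_mu: "l \<mu> = 1" and l_L: "\<And>x. l (L x) = l x"
    and C: "0 \<le> C" and sigma: "0 \<le> \<sigma>" "\<sigma> < 1"
    and decay: "\<And>x n. l x = 0 \<Longrightarrow> norm ((L ^^ n) x) \<le> C * \<sigma> ^ n * norm x"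
begin

abbreviation "Lc \<equiv> complexify L"

text \<open>The complexified projection onto the line of \<open>\<mu>\<close> along the kernel of
  \<open>l\<close>; it turns out to be the spectral projection at 1.\<close>

definition proj :: "'b \<times> 'b \<Rightarrow> 'b \<times> 'b" where
  "proj = map_prod (\<lambda>x. l x *\<^sub>R \<mu>) (\<lambda>x. l x *\<^sub>R \<mu>)"

lemma mu_nonzero: "\<mu> \<noteq> 0"
  using l_mu linear_0[OF bounded_linear.linear[OF l]] by auto

lemma bounded_linear_proj: "bounded_linear proj"
  unfolding proj_def
  by (intro bounded_linear_map_prod bounded_linear_compose[OF bounded_linear_scaleR_left l])

lemma bounded_linear_Lc: "bounded_linear Lc"
  unfolding complexify_def by (intro bounded_linear_map_prod L)

lemma bounded_linear_shifted: "bounded_linear (shifted L c)"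
  unfolding shifted_def by (intro bounded_linear_sub bounded_linear_Lc bounded_linear_cscale)

lemma proj_cscale: "proj (cscale a z) = cscale a (proj z)"
  using bounded_linear.linear[OF l]
  by (cases z) (simp add: proj_def cscale_def linear_add linear_diff linear_scale algebra_simps)

lemma proj_proj [simp]: "proj (proj z) = proj z"
  using bounded_linear.linear[OF l]
  by (cases z) (simp add: proj_def linear_scale l_mu)

lemma proj_Lc: "proj (Lc z) = proj z"
  by (cases z) (simp add: proj_def complexify_def l_L)

lemma Lc_proj: "Lc (proj z) = proj z"
  using bounded_linear.linear[OF L]
  by (cases z) (simp add: proj_def complexify_def linear_scale L_mu)

lemma proj_shifted: "proj (shifted L c z) = shifted L c (proj z)"
  by (simp add: shifted_def linear_diff[OF bounded_linear.linear[OF bounded_linear_proj]]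
      proj_Lc Lc_proj proj_cscale)

lemma shifted_proj: "shifted L c (proj z) = cscale (1 - c) (proj z)"
  by (simp add: shifted_def Lc_proj cscale_diff_left)

lemma range_proj: "range proj = {cscale a (\<mu>, 0) | a. True}"
proof (intro equalityI subsetI)
  fix w assume "w \<in> range proj"
  then obtain x y where "w = proj (x, y)" by auto
  then have "w = cscale (Complex (l x) (l y)) (\<mu>, 0)" by (simp add: proj_def cscale_def)
  then show "w \<in> {cscale a (\<mu>, 0) | a. True}" by blast
next
  fix w assume "w \<in> {cscale a (\<mu>, 0) | a. True}"
  then obtain a where w: "w = cscale a (\<mu>, 0)" by blast
  have "cscale a (\<mu>, 0) = proj (Re a *\<^sub>R \<mu>, Im a *\<^sub>R \<mu>)"
    using bounded_linear.linear[OF l] by (simp add: proj_def cscale_def linear_scale l_mu)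
  then show "w \<in> range proj" by (simp add: w)
qed

lemma Lc_pow_decay:
  assumes "proj w = 0"
  shows "norm ((Lc ^^ n) w) \<le> 2 * C * \<sigma> ^ n * norm w"
proof -
  obtain x y where w: "w = (x, y)" by fastforce
  have "l x = 0" "l y = 0" using assms mu_nonzero by (auto simp: proj_def w zero_prod_def)
  have "norm ((Lc ^^ n) w) \<le> norm ((L ^^ n) x) + norm ((L ^^ n) y)"
    by (simp add: w complexify_funpow norm_Pair_le)
  also have "\<dots> \<le> C * \<sigma> ^ n * norm x + C * \<sigma> ^ n * norm y"
    by (intro add_mono decay) fact+
  also have "\<dots> \<le> C * \<sigma> ^ n * norm w + C * \<sigma> ^ n * norm w"
    using norm_fst_le[of x y] norm_snd_le[of y x] C sigma
    by (intro add_mono mult_left_mono) (auto simp: w)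
  finally show ?thesis by (simp add: algebra_simps)
qed

text \<open>The Neumann series for the inverse of \<open>L - c\<close> on the kernel of \<open>proj\<close>.\<close>

definition neumann :: "complex \<Rightarrow> 'b \<times> 'b \<Rightarrow> 'b \<times> 'b" where
  "neumann c z = - (\<Sum>n. cscale (inverse c ^ Suc n) ((Lc ^^ n) (z - proj z)))"

lemma proj_compl: "proj (z - proj z) = 0"
  by (simp add: linear_diff[OF bounded_linear.linear[OF bounded_linear_proj]])

text \<open>Subtracting \<open>proj z\<close> lands in the kernel of \<open>proj\<close>, where the
  powers decay like \<open>\<sigma> ^ n\<close>. Since \<open>M\<close> depends on neither
  \<open>z\<close> nor \<open>n\<close>, the one estimate yields both convergence of the series and
  boundedness of its sum.\<close>

lemma neumann_term_bound:
  assumes "\<sigma> < cmod c"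
  shows "\<exists>M\<ge>0. \<forall>z n. norm (cscale (inverse c ^ Suc n) ((Lc ^^ n) (z - proj z)))
           \<le> M * norm z * (\<sigma> / cmod c) ^ n"
proof -
  have "bounded_linear (\<lambda>z. z - proj z)"
    by (intro bounded_linear_sub bounded_linear_ident bounded_linear_proj)
  from bounded_linear.pos_bounded[OF this] obtain K
    where K: "K > 0" "\<And>z. norm (z - proj z) \<le> norm z * K" by blast
  have c: "cmod c > 0" using assms sigma by linarith
  show ?thesis
  proof (intro exI[of _ "8 * C * K / cmod c"] conjI allI)
    show "0 \<le> 8 * C * K / cmod c" using C K c by simp
    fix z n
    have "norm (cscale (inverse c ^ Suc n) ((Lc ^^ n) (z - proj z)))
      \<le> 4 * cmod (inverse c ^ Suc n) * norm ((Lc ^^ n) (z - proj z))" by (rule norm_cscale_le)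
    also have "\<dots> \<le> 4 * cmod (inverse c ^ Suc n) * (2 * C * \<sigma> ^ n * norm (z - proj z))"
      by (intro mult_left_mono Lc_pow_decay proj_compl) auto
    also have "\<dots> \<le> 4 * cmod (inverse c ^ Suc n) * (2 * C * \<sigma> ^ n * (norm z * K))"
      using C sigma by (intro mult_left_mono K) auto
    also have "\<dots> = 8 * C * K / cmod c * norm z * (\<sigma> / cmod c) ^ n"
      using c by (simp add: norm_mult norm_power norm_inverse norm_divide field_simps)
    finally show "norm (cscale (inverse c ^ Suc n) ((Lc ^^ n) (z - proj z)))
      \<le> 8 * C * K / cmod c * norm z * (\<sigma> / cmod c) ^ n" .
  qed
qed

section \<open>Inverting L - c on the kernel of the projection, for c outside the disk of radius
  \<sigma>\<close>

context
  fixes c :: complex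
  assumes c: "\<sigma> < cmod c"
begin

lemma ratio: "norm (\<sigma> / cmod c) < 1"
  using c sigma by (auto simp: divide_simps)

lemma c_nonzero: "c \<noteq> 0"
  using c sigma by auto

lemma neumann_summable:
  "summable (\<lambda>n. norm (cscale (inverse c ^ Suc n) ((Lc ^^ n) (z - proj z))))"
proof -
  obtain M where M: "M \<ge> 0" "\<And>z n. norm (cscale (inverse c ^ Suc n) ((Lc ^^ n) (z - proj z)))
           \<le> M * norm z * (\<sigma> / cmod c) ^ n" using neumann_term_bound[OF c] by blast
  show ?thesis
  proof (rule summable_comparison_test'[of "\<lambda>n. M * norm z * (\<sigma> / cmod c) ^ n" 0])
    show "summable (\<lambda>n. M * norm z * (\<sigma> / cmod c) ^ n)"
      by (rule summable_mult[OF summable_geometric[OF ratio]])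
  qed (simp add: M(2) del: power_Suc)
qed

lemma Lc_pow_linear: "bounded_linear (Lc ^^ n)"
proof (induction n)
  case 0 show ?case by (simp add: id_def bounded_linear_ident)
next
  case (Suc n) show ?case
    using bounded_linear_compose[OF bounded_linear_Lc Suc] by (simp add: o_def)
qed

lemma term_linear: "bounded_linear (\<lambda>z. cscale (inverse c ^ Suc n) ((Lc ^^ n) (z - proj z)))"
  by (intro bounded_linear_compose[OF bounded_linear_cscale] bounded_linear_compose[OF Lc_pow_linear]
      bounded_linear_sub bounded_linear_ident bounded_linear_proj)

lemma bounded_linear_neumann: "bounded_linear (neumann c)"
proof -
  obtain M where M: "M \<ge> 0" "\<And>z n. norm (cscale (inverse c ^ Suc n) ((Lc ^^ n) (z - proj z)))
           \<le> M * norm z * (\<sigma> / cmod c) ^ n" using neumann_term_bound[OF c] by blast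
  note s = summable_norm_cancel[OF neumann_summable]
  note lin = bounded_linear.linear[OF term_linear]
  show ?thesis
  proof (rule bounded_linear_intro[where K = "M * (1 / (1 - \<sigma> / cmod c))"])
    fix z w :: "'b \<times> 'b" and r :: real
    show "neumann c (z + w) = neumann c z + neumann c w"
      using suminf_add[OF s[of z] s[of w]] unfolding neumann_def linear_add[OF lin] minus_add_distrib[symmetric] by simp
    show "neumann c (r *\<^sub>R z) = r *\<^sub>R neumann c z"
      using suminf_scaleR_right[OF s[of z], of r] 
      unfolding neumann_def linear_scale[OF lin] scaleR_minus_right by simp
    have "norm (neumann c z) \<le> (\<Sum>n. norm (cscale (inverse c ^ Suc n) ((Lc ^^ n) (z - proj z))))"
      unfolding neumann_def norm_minus_cancel by (rule summable_norm[OF neumann_summable])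
    also have "\<dots> \<le> (\<Sum>n. M * norm z * (\<sigma> / cmod c) ^ n)"
      by (intro suminf_le M neumann_summable summable_mult summable_geometric ratio)
    also have "\<dots> = norm z * (M * (1 / (1 - \<sigma> / cmod c)))"
      using suminf_geometric[OF ratio] suminf_mult[OF summable_geometric[OF ratio]] by simp
    finally show "norm (neumann c z) \<le> norm z * (M * (1 / (1 - \<sigma> / cmod c)))" .
  qed
qed

text \<open>Applied termwise, L - c makes the series telescope: the n-th term becomes
  \<open>a (Suc n) - a n\<close> with \<open>a\<close> tending to 0, so the sum is
  \<open>- a 0\<close>. The minus sign in \<open>neumann\<close> cancels this one.\<close>

lemma shifted_neumann: "shifted L c (neumann c z) = z - proj z"
proof -
  define w where "w = z - proj z"
  define a where "a n = cscale (inverse c ^ n) ((Lc ^^ n) w)" for n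
  have "(\<lambda>n. cscale c (cscale (inverse c ^ Suc n) ((Lc ^^ n) w))) \<longlonglongrightarrow> cscale c 0"
    using neumann_summable[THEN summable_norm_cancel, THEN summable_LIMSEQ_zero, of z]
    unfolding w_def by (rule bounded_linear.tendsto[OF bounded_linear_cscale])
  moreover have "cscale c (cscale (inverse c ^ Suc n) ((Lc ^^ n) w)) = a n" for n
    using c_nonzero by (simp add: a_def cscale_cscale mult.assoc[symmetric])
  ultimately have "a \<longlonglongrightarrow> 0"
    using linear_0[OF bounded_linear.linear[OF bounded_linear_cscale[where 'b = 'b], of c]]
    by (simp del: power_Suc)
  then have "(\<lambda>n. a (Suc n) - a n) sums (0 - a 0)"
    by (rule telescope_sums)
  moreover have "shifted L c (cscale (inverse c ^ Suc n) ((Lc ^^ n) w)) = a (Suc n) - a n" for n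
    using c_nonzero
    by (simp add: shifted_def a_def complexify_cscale[OF L] cscale_cscale mult.assoc[symmetric])
  ultimately have "(\<lambda>n. shifted L c (cscale (inverse c ^ Suc n) ((Lc ^^ n) w))) sums - w"
    by (simp add: a_def)
  moreover have "(\<lambda>n. shifted L c (cscale (inverse c ^ Suc n) ((Lc ^^ n) w)))
      sums shifted L c (- neumann c z)"
    unfolding neumann_def minus_minus w_def
    by (intro bounded_linear.sums[OF bounded_linear_shifted] summable_sums
        summable_norm_cancel[OF neumann_summable])
  ultimately have "shifted L c (- neumann c z) = - w" by (rule sums_unique2[symmetric])
  then show ?thesis
    by (simp add: w_def linear_neg[OF bounded_linear.linear[OF bounded_linear_shifted]]
        del: minus_diff_eq)
qed

lemma shifted_Lc: "shifted L c (Lc z) = Lc (shifted L c z)"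
  by (simp add: shifted_def complexify_cscale[OF L]
      linear_diff[OF bounded_linear.linear[OF bounded_linear_Lc]])

lemma shifted_cscale: "shifted L c (cscale a z) = cscale a (shifted L c z)"
  by (simp add: shifted_def complexify_cscale[OF L] cscale_cscale mult.commute
      linear_diff[OF bounded_linear.linear[OF bounded_linear_cscale]])

text \<open>L - c commutes with \<open>proj\<close>, with scalars and with the powers of L, hence
  with every term of the series; this reduces the left inverse to the right inverse.\<close>

lemma neumann_shifted: "neumann c (shifted L c z) = z - proj z"
proof -
  note lin = bounded_linear.linear[OF bounded_linear_shifted]
  have *: "shifted L c ((Lc ^^ n) w) = (Lc ^^ n) (shifted L c w)" for n w
    by (induction n) (auto simp: shifted_Lc)
  have "neumann c (shifted L c z)
      = - (\<Sum>n. shifted L c (cscale (inverse c ^ Suc n) ((Lc ^^ n) (z - proj z))))"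
    unfolding neumann_def by (simp only: proj_shifted linear_diff[OF lin, symmetric] * shifted_cscale)
  also have "(\<Sum>n. shifted L c (cscale (inverse c ^ Suc n) ((Lc ^^ n) (z - proj z))))
      = shifted L c (\<Sum>n. cscale (inverse c ^ Suc n) ((Lc ^^ n) (z - proj z)))"
    by (rule bounded_linear.suminf[OF bounded_linear_shifted, symmetric])
      (rule summable_norm_cancel[OF neumann_summable])
  also have "- \<dots> = shifted L c (neumann c z)"
    by (simp add: neumann_def linear_neg[OF lin] del: power_Suc)
  finally show ?thesis by (simp add: shifted_neumann)
qed

text \<open>Every term of the series lies in the closed kernel of \<open>proj\<close>. This makes
  \<open>neumann\<close> an inverse within that kernel, as \<open>spectral_projection\<close>
  requires.\<close>

lemma proj_neumann: "proj (neumann c z) = 0"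
proof -
  have *: "proj ((Lc ^^ n) w) = proj w" for n w
    by (induction n) (auto simp: proj_Lc)
  have "proj (- neumann c z) = (\<Sum>n. proj (cscale (inverse c ^ Suc n) ((Lc ^^ n) (z - proj z))))"
    unfolding neumann_def minus_minus
    by (rule bounded_linear.suminf[OF bounded_linear_proj])
      (rule summable_norm_cancel[OF neumann_summable])
  also have "\<dots> = 0"
    by (simp add: proj_cscale * proj_compl linear_0[OF bounded_linear.linear[OF bounded_linear_cscale]]
        del: power_Suc)
  finally show ?thesis by (simp add: linear_neg[OF bounded_linear.linear[OF bounded_linear_proj]])
qed

lemma not_in_spectrum:
  assumes "c \<noteq> 1"
  shows "c \<notin> spectrum L"
proof -
  \<comment> \<open>A block-diagonal inverse: the Neumann series on the kernel of
    \<open>proj\<close>, and division by the scalar 1 - c, by which L - c acts on the range.\<close>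
  define S where "S z = neumann c z + cscale (inverse (1 - c)) (proj z)" for z
  have "bounded_linear S"
    unfolding S_def by (intro bounded_linear_add bounded_linear_neumann
        bounded_linear_compose[OF bounded_linear_cscale bounded_linear_proj])
  moreover have "S (shifted L c z) = z" for z
    using assms
    by (simp add: S_def neumann_shifted proj_shifted shifted_proj cscale_cscale)
  moreover have "shifted L c (S z) = z" for z
    using assms
    by (simp add: S_def shifted_neumann linear_add[OF bounded_linear.linear[OF bounded_linear_shifted]]
        shifted_cscale shifted_proj cscale_cscale)
  ultimately show ?thesis unfolding spectrum_def by blast
qed

end

section \<open>Spectrum, eigenvalue 1 and asymptotics\<close>

lemma spectrum_subset: "spectrum L \<subseteq> insert 1 (cball 0 \<sigma>)"
  using not_in_spectrum by force

lemma eigenvalue_one: "eigenvalue L 1"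
  unfolding eigenvalue_def shifted_def complexify_def
  using mu_nonzero linear_0[OF bounded_linear.linear[OF L]]
  by (intro exI[of _ "(\<mu>, 0)"]) (auto simp: L_mu zero_prod_def)

lemma one_in_spectrum: "1 \<in> spectrum L"
proof -
  obtain z where z: "z \<noteq> 0" "shifted L 1 z = 0" using eigenvalue_one unfolding eigenvalue_def by blast
  have False if "bounded_linear S" "\<forall>z. S (shifted L 1 z) = z" for S
    using that(2)[rule_format, of z] z linear_0[OF bounded_linear.linear[OF that(1)]] by simp
  then show ?thesis unfolding spectrum_def by blast
qed

text \<open>L is the identity on the range of \<open>proj\<close>, so exponent 1 already kills L - 1
  there; on the kernel the Neumann inverse is available at c = 1 because \<sigma> < 1.\<close>

lemma spectral_projection_proj: "spectral_projection L 1 proj"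
  unfolding spectral_projection_def
proof (intro conjI allI exI[of _ 1])
  have 1: "\<sigma> < cmod 1" using sigma by simp
  show "bij_betw (shifted L 1) {z. proj z = 0} {z. proj z = 0}"
  proof (rule bij_betwI[where g = "neumann 1"])
    show "shifted L 1 \<in> {z. proj z = 0} \<rightarrow> {z. proj z = 0}"
      by (auto simp: proj_shifted linear_0[OF bounded_linear.linear[OF bounded_linear_shifted]])
    show "neumann 1 \<in> {z. proj z = 0} \<rightarrow> {z. proj z = 0}" by (auto simp: proj_neumann[OF 1])
  qed (auto simp: neumann_shifted[OF 1] shifted_neumann[OF 1])
  show "(shifted L 1 ^^ 1) (proj z) = 0" for z
    by (simp add: shifted_proj) (cases "proj z", simp add: cscale_def zero_prod_def)
qed (auto simp: bounded_linear_proj proj_cscale proj_Lc Lc_proj)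

lemma spectral_radius_eq: "spectral_radius L = 1"
  unfolding spectral_radius_def
proof (rule cSup_eq_maximum)
  show "1 \<in> cmod ` spectrum L" using one_in_spectrum by (intro image_eqI[of _ _ 1]) auto
  show "x \<le> 1" if "x \<in> cmod ` spectrum L" for x
    using that spectrum_subset sigma by (force simp: dist_norm)
qed

lemma simple_eigenvalue_one: "simple_eigenvalue L 1"
  unfolding simple_eigenvalue_def
  using eigenvalue_one spectral_projection_proj range_proj mu_nonzero
  by (intro conjI exI[of _ proj] exI[of _ "(\<mu>, 0)"]) (auto simp: zero_prod_def)

text \<open>Adding one point to a set creates no limit point, and the closed disk of radius \<sigma>
  misses 1. As \<open>span\<close> is the real span, the complex line of \<open>\<mu>\<close> needs
  the two generators \<open>(\<mu>, 0)\<close> and \<open>(0, \<mu>)\<close>.\<close>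

lemma isolated_one: "isolated_finite_eigenvalue L 1"
  unfolding isolated_finite_eigenvalue_def
proof (intro conjI eigenvalue_one exI[of _ proj] exI[of _ "{(\<mu>, 0), (0, \<mu>)}"] spectral_projection_proj)
  show "\<not> 1 islimpt spectrum L"
  proof
    assume "1 islimpt spectrum L"
    then have "(1::complex) islimpt insert 1 (cball 0 \<sigma>)"
      by (rule islimpt_subset[OF _ spectrum_subset])
    then have "(1::complex) islimpt cball 0 \<sigma>" by (simp only: islimpt_insert)
    then have "(1::complex) \<in> cball 0 \<sigma>" by (meson closed_cball closed_limpt)
    then show False using sigma by simp
  qed
  show "range proj \<subseteq> span {(\<mu>, 0), (0, \<mu>)}"
  proof (intro image_subsetI)
    fix z :: "'b \<times> 'b"
    obtain x y where z: "z = (x, y)" by fastforce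
    have "proj z = l x *\<^sub>R (\<mu>, 0) + l y *\<^sub>R (0, \<mu>)" by (simp add: z proj_def)
    also have "\<dots> \<in> span {(\<mu>, 0), (0, \<mu>)}"
      by (intro span_add span_scale span_base) auto
    finally show "proj z \<in> span {(\<mu>, 0), (0, \<mu>)}" .
  qed
qed simp

text \<open>The only point of the spectrum that can lie outside the disk of radius \<sigma> is 1,
  and it is isolated of finite multiplicity.\<close>

lemma essential_spectral_radius_le: "essential_spectral_radius L \<le> \<sigma>"
  unfolding essential_spectral_radius_def
proof (rule cInf_lower)
  have "isolated_finite_eigenvalue L c" if "c \<in> spectrum L" "\<sigma> < cmod c" for c
    using that spectrum_subset isolated_one by fastforce
  then show "\<sigma> \<in> {r. 0 \<le> r \<and> (\<forall>c\<in>spectrum L. r < cmod c \<longrightarrow> isolated_finite_eigenvalue L c)}"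
    using sigma by blast
  show "bdd_below {r. 0 \<le> r \<and> (\<forall>c\<in>spectrum L. r < cmod c \<longrightarrow> isolated_finite_eigenvalue L c)}"
    by (rule bdd_belowI[of _ 0]) blast
qed

lemma quasi_compact: "quasi_compact L"
  unfolding quasi_compact_def spectral_radius_eq
  using L essential_spectral_radius_le sigma by simp

lemma spectral_gap: "spectral_gap L"
  unfolding spectral_gap_def
  using simple_eigenvalue_one sigma spectrum_subset by (force intro!: exI[of _ \<sigma>])

lemma L_pow_mu: "(L ^^ n) \<mu> = \<mu>"
  by (induction n) (auto simp: L_mu)

lemma L_pow_diff: "(L ^^ n) (x - y) = (L ^^ n) x - (L ^^ n) y"
  by (induction n) (auto simp: linear_diff[OF bounded_linear.linear[OF L]])

lemma convergence_to_mu: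
  "\<exists>K>0. \<forall>x. l x = 1 \<longrightarrow> (\<forall>n. norm ((L ^^ n) x - \<mu>) \<le> K * \<sigma> ^ n * norm x)"
proof -
  obtain B where B: "B > 0" "\<And>x. norm (l x) \<le> norm x * B"
    using bounded_linear.pos_bounded[OF l] by blast
  \<comment> \<open>The summand 1 keeps the constant positive when \<open>C\<close> is 0.\<close>
  show ?thesis
  proof (intro exI[of _ "C * (1 + norm \<mu> * B) + 1"] conjI allI impI)
    show "0 < C * (1 + norm \<mu> * B) + 1" using B C by (intro add_nonneg_pos mult_nonneg_nonneg) auto
    fix x n assume x: "l x = 1"
    \<comment> \<open>From \<open>l x = 1\<close> follows \<open>1 \<le> norm x * B\<close>, which
      lets the fixed quantity \<open>norm \<mu>\<close> be absorbed into a multiple of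
      \<open>norm x\<close>.\<close>
    have "norm \<mu> * 1 \<le> norm \<mu> * (norm x * B)"
      using B(2)[of x] x by (intro mult_left_mono) auto
    then have *: "norm (x - \<mu>) \<le> (1 + norm \<mu> * B) * norm x"
      using norm_triangle_ineq4[of x \<mu>] by (simp add: algebra_simps)
    have "norm ((L ^^ n) x - \<mu>) = norm ((L ^^ n) (x - \<mu>))"
      by (simp add: L_pow_diff L_pow_mu)
    also have "\<dots> \<le> C * \<sigma> ^ n * norm (x - \<mu>)"
      by (rule decay) (simp add: linear_diff[OF bounded_linear.linear[OF l]] x l_mu)
    also have "\<dots> \<le> C * \<sigma> ^ n * ((1 + norm \<mu> * B) * norm x)"
      using C sigma by (intro mult_left_mono *) auto
    also have "\<dots> \<le> (C * (1 + norm \<mu> * B) + 1) * \<sigma> ^ n * norm x"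
      using sigma by (simp add: algebra_simps)
    finally show "norm ((L ^^ n) x - \<mu>) \<le> (C * (1 + norm \<mu> * B) + 1) * \<sigma> ^ n * norm x" .
  qed
qed

text \<open>The difference of two fixed points of equal mass lies in the kernel of \<open>l\<close>,
  where iteration must shrink it although it is fixed.\<close>

lemma fixed_point_unique:
  assumes "L x = x" "l x = 1"
  shows "x = \<mu>"
proof -
  have "norm (x - \<mu>) \<le> C * \<sigma> ^ n * norm (x - \<mu>)" for n
  proof -
    have "(L ^^ n) (x - \<mu>) = x - \<mu>"
      by (induction n) (auto simp: linear_diff[OF bounded_linear.linear[OF L]] assms L_mu)
    then show ?thesis
      using decay[of "x - \<mu>" n] by (simp add: linear_diff[OF bounded_linear.linear[OF l]] assms l_mu)
  qed
  moreover have "(\<lambda>n. C * \<sigma> ^ n * norm (x - \<mu>)) \<longlonglongrightarrow> C * 0 * norm (x - \<mu>)"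
    using sigma by (intro tendsto_intros LIMSEQ_power_zero) auto
  ultimately have "norm (x - \<mu>) \<le> 0"
    using LIMSEQ_le_const[of _ _ "norm (x - \<mu>)"] by fastforce
  then show ?thesis by simp
qed

end

section \<open>Integrals and Hoelder functions on the unit interval\<close>

text \<open>No integrability is required: a non-integrable function has integral 0 by convention,
  and \<open>B\<close> is nonnegative. Later estimates thus need only pointwise bounds.\<close>

lemma unit_set_integral_bound:
  fixes g :: "real \<Rightarrow> real"
  assumes "\<And>t. t \<in> {0..1} \<Longrightarrow> \<bar>g t\<bar> \<le> B"
  shows "\<bar>LBINT t:{0..1}. g t\<bar> \<le> B"
proof -
  have B: "0 \<le> B" using assms[of 0] by force
  have "\<bar>LBINT t:{0..1}. g t\<bar> \<le> B * measure lborel {0..1::real}"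
  proof (cases "set_integrable lborel {0..1} g")
    case True
    have "\<bar>LBINT t:{0..1}. g t\<bar> \<le> (LBINT t:{0..1}. \<bar>g t\<bar>)"
      using set_integral_norm_bound[OF True] by simp
    also have "\<dots> \<le> (LBINT t:{0..1::real}. B)"
      using True assms by (intro set_integral_mono set_integrable_abs) (auto simp: set_integrable_def)
    finally show ?thesis by (simp add: set_lebesgue_integral_def)
  next
    case False
    then show ?thesis
      using B by (simp add: set_lebesgue_integral_def set_integrable_def not_integrable_integral_eq)
  qed
  then show ?thesis by simp
qed

text \<open>Unlike integrability, this property is stable under products, and integrands here are
  products of a function and a test. Values outside the unit interval do not count.\<close>

definition bounded_measurable :: "(real \<Rightarrow> real) \<Rightarrow> bool" where
  "bounded_measurable g \<longleftrightarrow>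
     set_borel_measurable lborel {0..1} g \<and> (\<exists>K. \<forall>t\<in>{0..1}. \<bar>g t\<bar> \<le> K)"

lemma bounded_measurable_integrable:
  assumes "bounded_measurable g"
  shows "set_integrable lborel {0..1} g"
proof -
  obtain K where K: "\<forall>t\<in>{0..1}. \<bar>g t\<bar> \<le> K" using assms by (auto simp: bounded_measurable_def)
  have "set_integrable lborel {0..1::real} (\<lambda>_. K)" by (auto simp: set_integrable_def)
  then show ?thesis
  proof (rule set_integrable_bound)
    show "set_borel_measurable lborel {0..1} g" using assms by (simp add: bounded_measurable_def)
    show "AE x in lborel. x \<in> {0..1} \<longrightarrow> norm (g x) \<le> norm K" using K by fastforce
  qed
qed

lemma bounded_measurable_mult:
  assumes "bounded_measurable f" "bounded_measurable g"
  shows "bounded_measurable (\<lambda>t. f t * g t)"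
proof -
  obtain K L where KL: "\<forall>t\<in>{0..1}. \<bar>f t\<bar> \<le> K" "\<forall>t\<in>{0..1}. \<bar>g t\<bar> \<le> L"
    using assms by (auto simp: bounded_measurable_def)
  have "set_borel_measurable lborel {0..1} (\<lambda>t. f t * g t)"
  proof -
    have "(\<lambda>t. (indicat_real {0..1} t *\<^sub>R f t) * (indicat_real {0..1} t *\<^sub>R g t)) \<in> borel_measurable lborel"
      using assms unfolding bounded_measurable_def set_borel_measurable_def
      by (intro borel_measurable_times) auto
    also have "(\<lambda>t. (indicat_real {0..1} t *\<^sub>R f t) * (indicat_real {0..1} t *\<^sub>R g t))
        = (\<lambda>t. indicat_real {0..1} t *\<^sub>R (f t * g t))" by (auto simp: indicator_def)
    finally show ?thesis unfolding set_borel_measurable_def .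
  qed
  moreover have "\<bar>f t * g t\<bar> \<le> K * L" if "t \<in> {0..1}" for t
  proof -
    have "0 \<le> K" using KL(1) that by (meson abs_ge_zero order_trans)
    then show ?thesis using KL that by (auto simp: abs_mult intro!: mult_mono)
  qed
  ultimately show ?thesis unfolding bounded_measurable_def by blast
qed

lemma bounded_measurable_continuous:
  assumes "continuous_on {0..1} g"
  shows "bounded_measurable g"
proof -
  have "bounded (g ` {0..1})" by (intro compact_imp_bounded compact_continuous_image assms) simp
  then obtain K where "\<forall>t\<in>{0..1}. \<bar>g t\<bar> \<le> K" by (auto simp: bounded_iff)
  moreover have "set_borel_measurable lborel {0..1} g"
    using borel_measurable_continuous_on_indicator[OF _ assms] by (simp add: set_borel_measurable_def)
  ultimately show ?thesis unfolding bounded_measurable_def by blast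
qed

lemma bounded_measurable_const [simp]: "bounded_measurable (\<lambda>_. c)"
  by (rule bounded_measurable_continuous) (rule continuous_on_const)

lemma bounded_measurable_sum:
  assumes "\<And>i. i \<in> A \<Longrightarrow> bounded_measurable (f i)" "finite A"
  shows "bounded_measurable (\<lambda>t. \<Sum>i\<in>A. f i t)"
proof -
  have "\<exists>K. \<forall>t\<in>{0..1}. \<bar>f i t\<bar> \<le> K" if "i \<in> A" for i
    using assms(1)[OF that] by (simp add: bounded_measurable_def)
  then obtain K where K: "\<And>i t. i \<in> A \<Longrightarrow> t \<in> {0..1} \<Longrightarrow> \<bar>f i t\<bar> \<le> K i" by metis
  have "\<bar>\<Sum>i\<in>A. f i t\<bar> \<le> (\<Sum>i\<in>A. K i)" if "t \<in> {0..1}" for t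
    using K that by (intro order_trans[OF sum_abs] sum_mono) auto
  moreover have "set_borel_measurable lborel {0..1} (\<lambda>t. \<Sum>i\<in>A. f i t)"
    using assms unfolding bounded_measurable_def set_borel_measurable_def scaleR_sum_right
    by (intro borel_measurable_sum) blast
  ultimately show ?thesis unfolding bounded_measurable_def by blast
qed

lemma holder_continuous_on:
  fixes g :: "real \<Rightarrow> real"
  assumes a: "0 < a" and B: "\<And>t t'. t \<in> S \<Longrightarrow> t' \<in> S \<Longrightarrow> \<bar>g t - g t'\<bar> \<le> B * \<bar>t - t'\<bar> powr a"
  shows "continuous_on S g"
proof (unfold continuous_on_def, intro ballI)
  fix t assume t: "t \<in> S"
  have "((\<lambda>x. B * \<bar>x - t\<bar> powr a) \<longlongrightarrow> B * \<bar>t - t\<bar> powr a) (at t within S)"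
    using a by (intro tendsto_intros) auto
  then have *: "((\<lambda>x. B * \<bar>x - t\<bar> powr a) \<longlongrightarrow> 0) (at t within S)" by simp
  have "((\<lambda>x. g x - g t) \<longlongrightarrow> 0) (at t within S)"
    by (rule Lim_null_comparison[OF _ *]) (use B t in \<open>auto simp: eventually_at_filter\<close>)
  then show "(g \<longlongrightarrow> g t) (at t within S)" using Lim_null by blast
qed

section \<open>Functions of the vertical coordinate\<close>

text \<open>Leaves of both families are isometric copies of the unit interval, so one norm for
  functions of one variable serves both.\<close>

definition unit_holder_norm :: "real \<Rightarrow> (real \<Rightarrow> real) \<Rightarrow> ennreal" where
  "unit_holder_norm a b = (SUP t \<in> {0..1}. ennreal \<bar>b t\<bar>) +
     (SUP (t, t') \<in> {(t, t'). t \<in> {0..1} \<and> t' \<in> {0..1} \<and> t \<noteq> t'}. ennreal (\<bar>b t - b t'\<bar> / \<bar>t - t'\<bar> powr a))"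

lemma holder_norm_stable_leaf:
  "holder_norm a (stable_leaf s) \<phi> = unit_holder_norm a (\<lambda>t. \<phi> (s, t))"
proof -
  have 1: "stable_leaf s = Pair s ` {0..1}" by (auto simp: stable_leaf_def)
  have 2: "{(x, y). x \<in> Pair s ` {0..1} \<and> y \<in> Pair s ` {0..1} \<and> x \<noteq> y}
    = (\<lambda>(t, t'). ((s, t), (s, t'))) ` {(t, t'). t \<in> {0..1} \<and> t' \<in> {0..1} \<and> t \<noteq> (t'::real)}"
    by force
  show ?thesis
    unfolding holder_norm_def holder_seminorm_def unit_holder_norm_def 1 2
    by (simp add: image_image case_prod_beta dist_Pair_Pair dist_real_def)
qed

lemma holder_norm_unstable_leaf:
  "holder_norm a (unstable_leaf t) \<phi> = unit_holder_norm a (\<lambda>s. \<phi> (s, t))"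
proof -
  have 1: "unstable_leaf t = (\<lambda>s. (s, t)) ` {0..1}" by (auto simp: unstable_leaf_def)
  have 2: "{(x, y). x \<in> (\<lambda>s. (s, t)) ` {0..1} \<and> y \<in> (\<lambda>s. (s, t)) ` {0..1} \<and> x \<noteq> y}
    = (\<lambda>(s, s'). ((s, t), (s', t))) ` {(s, s'). s \<in> {0..1} \<and> s' \<in> {0..1} \<and> s \<noteq> (s'::real)}"
    by force
  show ?thesis
    unfolding holder_norm_def holder_seminorm_def unit_holder_norm_def 1 2
    by (simp add: image_image case_prod_beta dist_Pair_Pair dist_real_def)
qed

lemma unit_holder_norm_le:
  assumes "\<And>t. t \<in> {0..1} \<Longrightarrow> \<bar>b t\<bar> \<le> A"
    and "\<And>t t'. t \<in> {0..1} \<Longrightarrow> t' \<in> {0..1} \<Longrightarrow> \<bar>b t - b t'\<bar> \<le> B * \<bar>t - t'\<bar> powr a"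
  shows "unit_holder_norm a b \<le> ennreal (A + B)"
proof -
  have A: "0 \<le> A" using assms(1)[of 0] by force
  have "\<bar>b 0 - b 1\<bar> \<le> B * 1" using assms(2)[of 0 1] by simp
  then have B: "0 \<le> B" by linarith
  have "unit_holder_norm a b \<le> ennreal A + ennreal B"
    unfolding unit_holder_norm_def
    using assms by (intro add_mono SUP_least) (auto intro!: ennreal_leI simp: divide_le_eq)
  then show ?thesis using A B by (simp add: ennreal_plus)
qed

lemma unit_holder_normD:
  assumes "unit_holder_norm a b \<le> ennreal K" "0 \<le> K"
  shows "t \<in> {0..1} \<Longrightarrow> \<bar>b t\<bar> \<le> K"
    and "t \<in> {0..1} \<Longrightarrow> t' \<in> {0..1} \<Longrightarrow> \<bar>b t - b t'\<bar> \<le> K * \<bar>t - t'\<bar> powr a"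
proof -
  show "\<bar>b t\<bar> \<le> K" if t: "t \<in> {0..1}"
  proof -
    have "ennreal \<bar>b t\<bar> \<le> (SUP t \<in> {0..1}. ennreal \<bar>b t\<bar>)" using t by (rule SUP_upper)
    also have "\<dots> \<le> unit_holder_norm a b" by (simp add: unit_holder_norm_def)
    finally have "ennreal \<bar>b t\<bar> \<le> ennreal K" using assms(1) by (rule order_trans)
    then show ?thesis using assms(2) by simp
  qed
  show "\<bar>b t - b t'\<bar> \<le> K * \<bar>t - t'\<bar> powr a" if t: "t \<in> {0..1}" "t' \<in> {0..1}"
  proof (cases "t = t'")
    case False
    have "ennreal (\<bar>b t - b t'\<bar> / \<bar>t - t'\<bar> powr a)
      \<le> (SUP (t, t') \<in> {(t, t'). t \<in> {0..1} \<and> t' \<in> {0..1} \<and> t \<noteq> t'}. ennreal (\<bar>b t - b t'\<bar> / \<bar>t - t'\<bar> powr a))"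
      using t False by (intro SUP_upper2[of "(t, t')"]) auto
    also have "\<dots> \<le> unit_holder_norm a b" by (simp add: unit_holder_norm_def)
    finally have "ennreal (\<bar>b t - b t'\<bar> / \<bar>t - t'\<bar> powr a) \<le> ennreal K"
      using assms(1) by (rule order_trans)
    then show ?thesis using assms(2) False by (simp add: divide_le_eq)
  qed simp
qed

lemma unit_holder_norm_minus [simp]: "unit_holder_norm a (\<lambda>t. - b t) = unit_holder_norm a b"
  by (simp add: unit_holder_norm_def abs_minus_commute)

lemma sup_unit_holder_norm_finite_iff:
  "(SUP s \<in> {0..1::real}. unit_holder_norm 1 (b s)) < \<infinity> \<longleftrightarrow>
   (\<exists>K\<ge>0. \<forall>s\<in>{0..1}. \<forall>t\<in>{0..1}. \<bar>b s t\<bar> \<le> K \<and> (\<forall>t'\<in>{0..1}. \<bar>b s t - b s t'\<bar> \<le> K * \<bar>t - t'\<bar>))"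
  (is "?L < _ \<longleftrightarrow> ?R")
proof
  assume fin: "?L < \<infinity>"
  define K where "K = enn2real ?L"
  have K: "ennreal K = ?L" "0 \<le> K" using fin by (simp_all add: K_def)
  have "unit_holder_norm 1 (b s) \<le> ennreal K" if "s \<in> {0..1}" for s
    unfolding K using that by (rule SUP_upper)
  note unit_holder_normD[OF this K(2)]
  then show ?R using K(2) by (auto intro!: exI[of _ K])
next
  assume ?R
  then obtain K where K: "0 \<le> K" "\<And>s t. s \<in> {0..1} \<Longrightarrow> t \<in> {0..1} \<Longrightarrow> \<bar>b s t\<bar> \<le> K"
    "\<And>s t t'. s \<in> {0..1} \<Longrightarrow> t \<in> {0..1} \<Longrightarrow> t' \<in> {0..1} \<Longrightarrow> \<bar>b s t - b s t'\<bar> \<le> K * \<bar>t - t'\<bar>"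
    by blast
  have "?L \<le> ennreal (K + K)"
    using K by (intro SUP_least unit_holder_norm_le) auto
  then show "?L < \<infinity>" by (simp add: le_less_trans)
qed

lemma C1_stable_iff:
  "\<phi> \<in> C1_stable \<longleftrightarrow> \<phi> \<in> borel_measurable (restrict_space borel unit_square) \<and>
   (\<exists>K\<ge>0. \<forall>s\<in>{0..1}. \<forall>t\<in>{0..1}. \<bar>\<phi> (s, t)\<bar> \<le> K \<and> (\<forall>t'\<in>{0..1}. \<bar>\<phi> (s, t) - \<phi> (s, t')\<bar> \<le> K * \<bar>t - t'\<bar>))"
  unfolding C1_stable_def mem_Collect_eq holder_norm_stable_leaf sup_unit_holder_norm_finite_iff ..

lemma C1_unstable_iff:
  "f \<in> C1_unstable \<longleftrightarrow> f \<in> borel_measurable (restrict_space borel unit_square) \<and>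
   (\<exists>K\<ge>0. \<forall>t\<in>{0..1}. \<forall>s\<in>{0..1}. \<bar>f (s, t)\<bar> \<le> K \<and> (\<forall>s'\<in>{0..1}. \<bar>f (s, t) - f (s', t)\<bar> \<le> K * \<bar>s - s'\<bar>))"
  unfolding C1_unstable_def mem_Collect_eq holder_norm_unstable_leaf
  by (subst sup_unit_holder_norm_finite_iff[of "\<lambda>t s. f (s, t)"]) (rule refl)

lemma C1_unstableE:
  assumes "f \<in> C1_unstable"
  obtains K where "0 \<le> K" "\<And>s t. s \<in> {0..1} \<Longrightarrow> t \<in> {0..1} \<Longrightarrow> \<bar>f (s, t)\<bar> \<le> K"
    "\<And>s s' t. s \<in> {0..1} \<Longrightarrow> s' \<in> {0..1} \<Longrightarrow> t \<in> {0..1} \<Longrightarrow> \<bar>f (s, t) - f (s', t)\<bar> \<le> K * \<bar>s - s'\<bar>"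
  using assms unfolding C1_unstable_iff by blast

lemma C1_stableE:
  assumes "\<phi> \<in> C1_stable"
  obtains K where "0 \<le> K" "\<And>s t. s \<in> {0..1} \<Longrightarrow> t \<in> {0..1} \<Longrightarrow> \<bar>\<phi> (s, t)\<bar> \<le> K"
    "\<And>s t t'. s \<in> {0..1} \<Longrightarrow> t \<in> {0..1} \<Longrightarrow> t' \<in> {0..1} \<Longrightarrow> \<bar>\<phi> (s, t) - \<phi> (s, t')\<bar> \<le> K * \<bar>t - t'\<bar>"
  using assms unfolding C1_stable_iff by blast

lemma C1_unstable_add:
  assumes "f \<in> C1_unstable" "g \<in> C1_unstable"
  shows "(\<lambda>p. f p + g p) \<in> C1_unstable"
proof -
  obtain K where K: "0 \<le> K" "\<And>s t. s \<in> {0..1} \<Longrightarrow> t \<in> {0..1} \<Longrightarrow> \<bar>f (s, t)\<bar> \<le> K"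
    "\<And>s s' t. s \<in> {0..1} \<Longrightarrow> s' \<in> {0..1} \<Longrightarrow> t \<in> {0..1} \<Longrightarrow> \<bar>f (s, t) - f (s', t)\<bar> \<le> K * \<bar>s - s'\<bar>"
    using C1_unstableE[OF assms(1)] by blast
  obtain L where L: "0 \<le> L" "\<And>s t. s \<in> {0..1} \<Longrightarrow> t \<in> {0..1} \<Longrightarrow> \<bar>g (s, t)\<bar> \<le> L"
    "\<And>s s' t. s \<in> {0..1} \<Longrightarrow> s' \<in> {0..1} \<Longrightarrow> t \<in> {0..1} \<Longrightarrow> \<bar>g (s, t) - g (s', t)\<bar> \<le> L * \<bar>s - s'\<bar>"
    using C1_unstableE[OF assms(2)] by blast
  show ?thesis
    unfolding C1_unstable_iff
  proof (intro conjI exI[of _ "K + L"] ballI)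
    show "(\<lambda>p. f p + g p) \<in> borel_measurable (restrict_space borel unit_square)"
      using assms by (auto simp: C1_unstable_iff)
    show "\<bar>f (s, t) + g (s, t)\<bar> \<le> K + L"
      if "t \<in> {0..1}" "s \<in> {0..1}" for s t using K(2)[of s t] L(2)[of s t] that by linarith
    show "\<bar>f (s, t) + g (s, t) - (f (s', t) + g (s', t))\<bar> \<le> (K + L) * \<bar>s - s'\<bar>"
      if "t \<in> {0..1}" "s \<in> {0..1}" "s' \<in> {0..1}" for s s' t
      using K(3)[of s s' t] L(3)[of s s' t] that by (simp add: distrib_right)
  qed (use K L in auto)
qed

lemma C1_unstable_scale:
  assumes "f \<in> C1_unstable"
  shows "(\<lambda>p. c * f p) \<in> C1_unstable"
proof -
  obtain K where K: "0 \<le> K" "\<And>s t. s \<in> {0..1} \<Longrightarrow> t \<in> {0..1} \<Longrightarrow> \<bar>f (s, t)\<bar> \<le> K"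
    "\<And>s s' t. s \<in> {0..1} \<Longrightarrow> s' \<in> {0..1} \<Longrightarrow> t \<in> {0..1} \<Longrightarrow> \<bar>f (s, t) - f (s', t)\<bar> \<le> K * \<bar>s - s'\<bar>"
    using C1_unstableE[OF assms(1)] by blast
  have "\<bar>c * f (s, t)\<bar> \<le> \<bar>c\<bar> * K" if "t \<in> {0..1}" "s \<in> {0..1}" for s t
    using K(2) that by (simp add: abs_mult mult_left_mono)
  moreover have "\<bar>c * f (s, t) - c * f (s', t)\<bar> \<le> \<bar>c\<bar> * K * \<bar>s - s'\<bar>"
    if "t \<in> {0..1}" "s \<in> {0..1}" "s' \<in> {0..1}" for s s' t
    using K(3)[of s s' t] that
    by (simp add: right_diff_distrib[symmetric] abs_mult mult_left_mono mult.assoc)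
  moreover have "(\<lambda>p. c * f p) \<in> borel_measurable (restrict_space borel unit_square)"
    using assms by (auto simp: C1_unstable_iff)
  ultimately show ?thesis
    unfolding C1_unstable_iff using K(1) by (intro conjI exI[of _ "\<bar>c\<bar> * K"]) auto
qed

lemma C1_unstable_diff:
  assumes "f \<in> C1_unstable" "g \<in> C1_unstable"
  shows "(\<lambda>p. f p - g p) \<in> C1_unstable"
  using C1_unstable_add[OF assms(1) C1_unstable_scale[OF assms(2), of "-1"]] by simp

lemma C1_unstable_const [simp]: "(\<lambda>_. c) \<in> C1_unstable"
  unfolding C1_unstable_iff by (auto intro!: exI[of _ "\<bar>c\<bar>"])

lemma C1_stable_const [simp]: "(\<lambda>_. c) \<in> C1_stable"
  unfolding C1_stable_iff by (auto intro!: exI[of _ "\<bar>c\<bar>"])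

lemma unit_square_sets [measurable]: "unit_square \<in> sets borel"
  unfolding unit_square_def by (intro borel_closed closed_Times) auto

lemma measurable_indicator_unit_square:
  fixes f :: "real \<times> real \<Rightarrow> real"
  assumes "f \<in> borel_measurable (restrict_space borel unit_square)"
  shows "(\<lambda>p. indicat_real unit_square p *\<^sub>R f p) \<in> borel_measurable borel"
  using assms by (subst (asm) borel_measurable_restrict_space_iff) auto

lemma bounded_measurable_vertical:
  assumes "f \<in> borel_measurable (restrict_space borel unit_square)" "s \<in> {0..1}"
    and "\<And>t. t \<in> {0..1} \<Longrightarrow> \<bar>f (s, t)\<bar> \<le> K"
  shows "bounded_measurable (\<lambda>t. f (s, t))"
proof -
  have "(\<lambda>t. indicat_real unit_square (s, t) *\<^sub>R f (s, t)) \<in> borel_measurable borel"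
    by (rule measurable_compose[OF _ measurable_indicator_unit_square[OF assms(1)]]) simp
  also have "(\<lambda>t. indicat_real unit_square (s, t) *\<^sub>R f (s, t)) = (\<lambda>t. indicat_real {0..1} t *\<^sub>R f (s, t))"
    using assms(2) by (auto simp: indicator_def unit_square_def)
  finally show ?thesis
    using assms(3) unfolding bounded_measurable_def set_borel_measurable_def by (auto intro!: exI[of _ K])
qed

lemma bounded_measurable_horizontal:
  assumes "f \<in> borel_measurable (restrict_space borel unit_square)" "t \<in> {0..1}"
    and "\<And>s. s \<in> {0..1} \<Longrightarrow> \<bar>f (s, t)\<bar> \<le> K"
  shows "bounded_measurable (\<lambda>s. f (s, t))"
proof -
  have "(\<lambda>s. indicat_real unit_square (s, t) *\<^sub>R f (s, t)) \<in> borel_measurable borel"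
    by (rule measurable_compose[OF _ measurable_indicator_unit_square[OF assms(1)]]) simp
  also have "(\<lambda>s. indicat_real unit_square (s, t) *\<^sub>R f (s, t)) = (\<lambda>s. indicat_real {0..1} s *\<^sub>R f (s, t))"
    using assms(2) by (auto simp: indicator_def unit_square_def)
  finally show ?thesis
    using assms(3) unfolding bounded_measurable_def set_borel_measurable_def by (auto intro!: exI[of _ K])
qed

lemma C1_unstable_vertical: "f \<in> C1_unstable \<Longrightarrow> s \<in> {0..1} \<Longrightarrow> bounded_measurable (\<lambda>t. f (s, t))"
  by (metis C1_unstable_iff bounded_measurable_vertical)

lemma C1_stable_vertical: "\<phi> \<in> C1_stable \<Longrightarrow> s \<in> {0..1} \<Longrightarrow> bounded_measurable (\<lambda>t. \<phi> (s, t))"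
  by (metis C1_stable_iff bounded_measurable_vertical)

lemma C1_stable_horizontal: "\<phi> \<in> C1_stable \<Longrightarrow> t \<in> {0..1} \<Longrightarrow> bounded_measurable (\<lambda>s. \<phi> (s, t))"
  by (metis C1_stable_iff bounded_measurable_horizontal)

definition leaf_integral :: "(real \<times> real \<Rightarrow> real) \<Rightarrow> real \<Rightarrow> (real \<Rightarrow> real) \<Rightarrow> real" where
  "leaf_integral f s b = (LBINT t:{0..1}. f (s, t) * b t)"

lemma leaf_integral_scale_right: "leaf_integral f s (\<lambda>t. c * b t) = c * leaf_integral f s b"
  unfolding leaf_integral_def by (simp add: mult.left_commute)

lemma leaf_integral_minus_right: "leaf_integral f s (\<lambda>t. - b t) = - leaf_integral f s b"
  using leaf_integral_scale_right[of f s "-1" b] by simp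

lemma leaf_integrable:
  assumes "f \<in> C1_unstable" "s \<in> {0..1}" "bounded_measurable b"
  shows "set_integrable lborel {0..1} (\<lambda>t. f (s, t) * b t)"
  using assms by (intro bounded_measurable_integrable bounded_measurable_mult C1_unstable_vertical)

lemma leaf_integral_diff_left:
  assumes "f \<in> C1_unstable" "g \<in> C1_unstable" "s \<in> {0..1}" "bounded_measurable b"
  shows "leaf_integral (\<lambda>p. f p - g p) s b = leaf_integral f s b - leaf_integral g s b"
  unfolding leaf_integral_def left_diff_distrib
  using assms by (intro set_integral_diff leaf_integrable)

lemma leaf_integral_diff_right:
  assumes "f \<in> C1_unstable" "s \<in> {0..1}" "bounded_measurable b" "bounded_measurable c"
  shows "leaf_integral f s (\<lambda>t. b t - c t) = leaf_integral f s b - leaf_integral f s c"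
  unfolding leaf_integral_def right_diff_distrib
  using assms by (intro set_integral_diff leaf_integrable)

lemma leaf_integral_bound:
  assumes "\<And>t. t \<in> {0..1} \<Longrightarrow> \<bar>f (s, t)\<bar> \<le> K" "\<And>t. t \<in> {0..1} \<Longrightarrow> \<bar>b t\<bar> \<le> B"
  shows "\<bar>leaf_integral f s b\<bar> \<le> K * B"
proof -
  have "0 \<le> K" using assms(1)[of 0] by force
  then show ?thesis
    unfolding leaf_integral_def using assms
    by (intro unit_set_integral_bound) (auto simp: abs_mult intro!: mult_mono)
qed

lemma leaf_integral_lipschitz:
  assumes "f \<in> C1_unstable"
    and "\<And>s s' t. s \<in> {0..1} \<Longrightarrow> s' \<in> {0..1} \<Longrightarrow> t \<in> {0..1} \<Longrightarrow> \<bar>f (s, t) - f (s', t)\<bar> \<le> K * \<bar>s - s'\<bar>"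
    and b: "bounded_measurable b" "\<And>t. t \<in> {0..1} \<Longrightarrow> \<bar>b t\<bar> \<le> 1"
    and s: "s \<in> {0..1}" "s' \<in> {0..1}"
  shows "\<bar>leaf_integral f s b - leaf_integral f s' b\<bar> \<le> K * \<bar>s - s'\<bar>"
proof -
  have "leaf_integral f s b - leaf_integral f s' b = (LBINT t:{0..1}. f (s, t) * b t - f (s', t) * b t)"
    unfolding leaf_integral_def using assms by (intro set_integral_diff(2)[symmetric] leaf_integrable)
  also have "\<bar>\<dots>\<bar> \<le> K * \<bar>s - s'\<bar>"
  proof (rule unit_set_integral_bound)
    fix t :: real assume t: "t \<in> {0..1}"
    have "\<bar>f (s, t) * b t - f (s', t) * b t\<bar> \<le> K * \<bar>s - s'\<bar> * 1"
      unfolding left_diff_distrib[symmetric] abs_mult using assms(2)[OF s t] b(2)[OF t]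
      by (intro mult_mono) auto
    then show "\<bar>f (s, t) * b t - f (s', t) * b t\<bar> \<le> K * \<bar>s - s'\<bar>" by simp
  qed
  finally show ?thesis .
qed

text \<open>For 0 < a < 1 this is the little Hoelder space, smaller than the space of all a-Hoelder
  functions. Approximability by Lipschitz functions is what allows the weak norm to control these
  tests in \<open>closable_strong_norm\<close>.\<close>

definition holder_closure :: "real \<Rightarrow> (real \<Rightarrow> real) set" where
  "holder_closure a = {b. \<forall>\<epsilon>>0. \<exists>g. (\<exists>K. K-lipschitz_on {0..1} g) \<and>
     unit_holder_norm a (\<lambda>t. b t - g t) < ennreal \<epsilon>}"

lemma holder_leaf_iff: "\<phi> \<in> holder_leaf a (stable_leaf s) \<longleftrightarrow> (\<lambda>t. \<phi> (s, t)) \<in> holder_closure a"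
proof -
  have "(\<exists>\<psi>\<in>C1_leaf (stable_leaf s). holder_norm a (stable_leaf s) (\<lambda>x. \<phi> x - \<psi> x) < ennreal \<epsilon>) \<longleftrightarrow>
    (\<exists>g. (\<exists>K. K-lipschitz_on {0..1} g) \<and> unit_holder_norm a (\<lambda>t. \<phi> (s, t) - g t) < ennreal \<epsilon>)" for \<epsilon>
  proof safe
    fix \<psi> assume "\<psi> \<in> C1_leaf (stable_leaf s)"
      and *: "holder_norm a (stable_leaf s) (\<lambda>x. \<phi> x - \<psi> x) < ennreal \<epsilon>"
    then obtain K where K: "K-lipschitz_on (stable_leaf s) \<psi>" by (auto simp: C1_leaf_def)
    have "K-lipschitz_on {0..1} (\<lambda>t. \<psi> (s, t))"
    proof (rule lipschitz_onI)
      fix x y :: real assume "x \<in> {0..1}" "y \<in> {0..1}"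
      then show "dist (\<psi> (s, x)) (\<psi> (s, y)) \<le> K * dist x y"
        using lipschitz_onD[OF K, of "(s, x)" "(s, y)"] by (simp add: stable_leaf_def dist_Pair_Pair)
    qed (rule lipschitz_on_nonneg[OF K])
    with * show "\<exists>g. (\<exists>K. K-lipschitz_on {0..1} g) \<and> unit_holder_norm a (\<lambda>t. \<phi> (s, t) - g t) < ennreal \<epsilon>"
      unfolding holder_norm_stable_leaf by blast
  next
    fix g K assume K: "K-lipschitz_on {0..1} g" and *: "unit_holder_norm a (\<lambda>t. \<phi> (s, t) - g t) < ennreal \<epsilon>"
    have "K-lipschitz_on (stable_leaf s) (\<lambda>p. g (snd p))"
    proof (rule lipschitz_onI)
      fix x y assume "x \<in> stable_leaf s" "y \<in> stable_leaf s"
      then show "dist (g (snd x)) (g (snd y)) \<le> K * dist x y"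
        using lipschitz_onD[OF K, of "snd x" "snd y"] by (auto simp: stable_leaf_def dist_Pair_Pair)
    qed (rule lipschitz_on_nonneg[OF K])
    then show "\<exists>\<psi>\<in>C1_leaf (stable_leaf s). holder_norm a (stable_leaf s) (\<lambda>x. \<phi> x - \<psi> x) < ennreal \<epsilon>"
      using * unfolding C1_leaf_def
      by (intro bexI[of _ "\<lambda>p. g (snd p)"]) (auto simp: holder_norm_stable_leaf)
  qed
  then show ?thesis unfolding holder_leaf_def holder_closure_def by simp
qed

section \<open>The norms as suprema over test functions of one variable\<close>

definition lip_tests :: "(real \<Rightarrow> real) set" where
  "lip_tests = {b. unit_holder_norm 1 b \<le> 1}"

definition holder_tests :: "real \<Rightarrow> (real \<Rightarrow> real) set" where
  "holder_tests a = {b. b \<in> holder_closure a \<and> unit_holder_norm a b \<le> 1}"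

text \<open>The weak and the stable norm both have this shape and differ only in the class
  \<open>B\<close>, so their common estimates are proved once in \<open>test_class\<close>.\<close>

definition test_norm :: "(real \<Rightarrow> real) set \<Rightarrow> (real \<times> real \<Rightarrow> real) \<Rightarrow> real" where
  "test_norm B f = Sup {leaf_integral f s b | s b. s \<in> {0..1} \<and> b \<in> B}"

lemma weak_norm_eq: "weak_norm f = test_norm lip_tests f"
proof -
  have "{stable_integral s (\<lambda>p. f p * \<phi> p) | s \<phi>. s \<in> {0..1} \<and> holder_norm 1 (stable_leaf s) \<phi> \<le> 1}
    = {leaf_integral f s b | s b. s \<in> {0..1} \<and> b \<in> lip_tests}" (is "?L = ?R")
  proof (intro equalityI subsetI)
    fix x assume "x \<in> ?L"
    then show "x \<in> ?R"
      by (auto simp: holder_norm_stable_leaf lip_tests_def stable_integral_def leaf_integral_def)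
  next
    fix x assume "x \<in> ?R"
    then obtain s b where "x = leaf_integral f s b" "s \<in> {0..1}" "b \<in> lip_tests" by blast
    then show "x \<in> ?L"
      by (auto simp: holder_norm_stable_leaf lip_tests_def stable_integral_def leaf_integral_def
          intro!: exI[of _ s] exI[of _ "\<lambda>p. b (snd p)"])
  qed
  then show ?thesis by (simp add: weak_norm_def test_norm_def)
qed

lemma strong_stable_norm_eq: "strong_stable_norm a f = test_norm (holder_tests a) f"
proof -
  have "{stable_integral s (\<lambda>p. f p * \<phi> p) | s \<phi>. s \<in> {0..1} \<and>
      \<phi> \<in> holder_leaf a (stable_leaf s) \<and> holder_norm a (stable_leaf s) \<phi> \<le> 1}
    = {leaf_integral f s b | s b. s \<in> {0..1} \<and> b \<in> holder_tests a}" (is "?L = ?R")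
  proof (intro equalityI subsetI)
    fix x assume "x \<in> ?L"
    then show "x \<in> ?R"
      by (auto simp: holder_norm_stable_leaf holder_leaf_iff holder_tests_def stable_integral_def leaf_integral_def)
  next
    fix x assume "x \<in> ?R"
    then obtain s b where "x = leaf_integral f s b" "s \<in> {0..1}" "b \<in> holder_tests a" by blast
    then show "x \<in> ?L"
      by (auto simp: holder_norm_stable_leaf holder_leaf_iff holder_tests_def stable_integral_def leaf_integral_def
          intro!: exI[of _ s] exI[of _ "\<lambda>p. b (snd p)"])
  qed
  then show ?thesis by (simp add: strong_stable_norm_def test_norm_def)
qed

text \<open>Vanishing \<open>test_dist\<close> forces the two tests to coincide as functions of the
  height, so a single function of one variable replaces the pair.\<close>

lemma strong_unstable_norm_eq:
  "strong_unstable_norm \<beta> f = Sup {\<bar>s1 - s2\<bar> powr (- \<beta>) * \<bar>leaf_integral f s1 b - leaf_integral f s2 b\<bar> | s1 s2 b.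
      s1 \<in> {0..1} \<and> s2 \<in> {0..1} \<and> s1 \<noteq> s2 \<and> b \<in> lip_tests}"
proof -
  have "{\<bar>s1 - s2\<bar> powr (- \<beta>) *
        \<bar>stable_integral s1 (\<lambda>p. f p * \<phi>1 p) - stable_integral s2 (\<lambda>p. f p * \<phi>2 p)\<bar> | s1 s2 \<phi>1 \<phi>2.
      s1 \<in> {0..1} \<and> s2 \<in> {0..1} \<and> s1 \<noteq> s2 \<and>
      holder_norm 1 (stable_leaf s1) \<phi>1 \<le> 1 \<and> holder_norm 1 (stable_leaf s2) \<phi>2 \<le> 1 \<and>
      test_dist s1 s2 \<phi>1 \<phi>2 = 0}
    = {\<bar>s1 - s2\<bar> powr (- \<beta>) * \<bar>leaf_integral f s1 b - leaf_integral f s2 b\<bar> | s1 s2 b.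
      s1 \<in> {0..1} \<and> s2 \<in> {0..1} \<and> s1 \<noteq> s2 \<and> b \<in> lip_tests}" (is "?L = ?R")
  proof (intro equalityI subsetI)
    fix x assume "x \<in> ?L"
    then obtain s1 s2 \<phi>1 \<phi>2 where s: "s1 \<in> {0..1}" "s2 \<in> {0..1}" "s1 \<noteq> s2"
      and x: "x = \<bar>s1 - s2\<bar> powr (- \<beta>) *
        \<bar>stable_integral s1 (\<lambda>p. f p * \<phi>1 p) - stable_integral s2 (\<lambda>p. f p * \<phi>2 p)\<bar>"
      and 1: "holder_norm 1 (stable_leaf s1) \<phi>1 \<le> 1" and 2: "test_dist s1 s2 \<phi>1 \<phi>2 = 0" by blast
    have "\<phi>1 (s1, t) = \<phi>2 (s2, t)" if "t \<in> {0..1}" for t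
    proof -
      have "ennreal \<bar>\<phi>1 (s1, t) - \<phi>2 (s2, t)\<bar> \<le> 0"
        unfolding 2[symmetric] test_dist_def using that by (rule SUP_upper)
      then show ?thesis by simp
    qed
    then have "stable_integral s2 (\<lambda>p. f p * \<phi>2 p) = leaf_integral f s2 (\<lambda>t. \<phi>1 (s1, t))"
      unfolding stable_integral_def leaf_integral_def by (intro set_lebesgue_integral_cong) auto
    then show "x \<in> ?R"
      using s 1 unfolding x holder_norm_stable_leaf
      by (intro CollectI exI[of _ s1] exI[of _ s2] exI[of _ "\<lambda>t. \<phi>1 (s1, t)"] conjI)
        (simp_all add: stable_integral_def leaf_integral_def lip_tests_def)
  next
    fix x assume "x \<in> ?R"
    then obtain s1 s2 b where s: "s1 \<in> {0..1}" "s2 \<in> {0..1}" "s1 \<noteq> s2" "b \<in> lip_tests"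
      and x: "x = \<bar>s1 - s2\<bar> powr (- \<beta>) * \<bar>leaf_integral f s1 b - leaf_integral f s2 b\<bar>" by blast
    then show "x \<in> ?L"
      by (intro CollectI exI[of _ s1] exI[of _ s2] exI[of _ "\<lambda>p. b (snd p)"] conjI)
        (simp_all add: stable_integral_def leaf_integral_def lip_tests_def holder_norm_stable_leaf test_dist_def)
  qed
  then show ?thesis by (simp add: strong_unstable_norm_def)
qed

lemma holder_tests_bound:
  assumes "unit_holder_norm a b \<le> 1"
  shows "t \<in> {0..1} \<Longrightarrow> \<bar>b t\<bar> \<le> 1"
    and "t \<in> {0..1} \<Longrightarrow> t' \<in> {0..1} \<Longrightarrow> \<bar>b t - b t'\<bar> \<le> \<bar>t - t'\<bar> powr a"
    and "0 < a \<Longrightarrow> bounded_measurable b"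
proof -
  have *: "unit_holder_norm a b \<le> ennreal 1" using assms by simp
  show "t \<in> {0..1} \<Longrightarrow> \<bar>b t\<bar> \<le> 1"
    and "t \<in> {0..1} \<Longrightarrow> t' \<in> {0..1} \<Longrightarrow> \<bar>b t - b t'\<bar> \<le> \<bar>t - t'\<bar> powr a"
    using unit_holder_normD[OF *] by auto
  then show "0 < a \<Longrightarrow> bounded_measurable b"
    using unit_holder_normD[OF *] by (intro bounded_measurable_continuous holder_continuous_on[of a _ _ 1]) auto
qed

text \<open>Closure under negation turns a one-sided supremum into a bound on absolute values. The
  test 1 makes the supremum nonempty and dominates the leaf means.\<close>

locale test_class =
  fixes B :: "(real \<Rightarrow> real) set"
  assumes symmetric: "b \<in> B \<Longrightarrow> (\<lambda>t. - b t) \<in> B"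
    and bounded: "b \<in> B \<Longrightarrow> t \<in> {0..1} \<Longrightarrow> \<bar>b t\<bar> \<le> 1"
    and measurable: "b \<in> B \<Longrightarrow> bounded_measurable b"
    and one: "(\<lambda>_. 1) \<in> B"
begin

text \<open>The uniform bound on \<open>f\<close> makes the real \<open>Sup\<close> meaningful;
  comparing it with both b and -b gives the absolute value.\<close>

lemma test_norm_upper:
  assumes "f \<in> C1_unstable" "s \<in> {0..1}" "b \<in> B"
  shows "\<bar>leaf_integral f s b\<bar> \<le> test_norm B f"
proof -
  obtain K where K: "\<forall>t\<in>{0..1}. \<forall>s\<in>{0..1}. \<bar>f (s, t)\<bar> \<le> K"
    using assms(1) unfolding C1_unstable_iff by blast
  have "bdd_above {leaf_integral f s b | s b. s \<in> {0..1} \<and> b \<in> B}"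
  proof (rule bdd_aboveI)
    fix x assume "x \<in> {leaf_integral f s b | s b. s \<in> {0..1} \<and> b \<in> B}"
    then obtain s b where "x = leaf_integral f s b" "s \<in> {0..1}" "b \<in> B" by blast
    then show "x \<le> K * 1" using leaf_integral_bound[of f s K b 1] K bounded by auto
  qed
  then have "leaf_integral f s b \<le> test_norm B f" if "b \<in> B" for b
    unfolding test_norm_def using assms(2) that by (intro cSup_upper) auto
  from this[OF assms(3)] this[OF symmetric[OF assms(3)]] show ?thesis
    by (simp add: leaf_integral_minus_right)
qed

lemma test_norm_least:
  assumes "\<And>s b. s \<in> {0..1} \<Longrightarrow> b \<in> B \<Longrightarrow> \<bar>leaf_integral f s b\<bar> \<le> C"
  shows "test_norm B f \<le> C"
  unfolding test_norm_def
proof (rule cSup_least)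
  have "leaf_integral f 0 (\<lambda>_. 1) \<in> {leaf_integral f s b | s b. s \<in> {0..1} \<and> b \<in> B}"
    using one by fastforce
  then show "{leaf_integral f s b | s b. s \<in> {0..1} \<and> b \<in> B} \<noteq> {}" by blast
qed (use assms abs_le_D1 in blast)

lemma test_norm_nonneg: "f \<in> C1_unstable \<Longrightarrow> 0 \<le> test_norm B f"
  using test_norm_upper[of f 0 "\<lambda>_. 1"] one by force

end

lemma lip_tests_one: "(\<lambda>_. 1) \<in> lip_tests"
  using unit_holder_norm_le[of "\<lambda>_. 1" 1 0 1] by (simp add: lip_tests_def)

interpretation lip: test_class lip_tests
proof
  show "(\<lambda>_. 1) \<in> lip_tests" by (rule lip_tests_one)
qed (auto simp: lip_tests_def holder_tests_bound holder_tests_bound(3)[of 1])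

lemma lipschitz_in_holder_closure:
  assumes "K-lipschitz_on {0..1} b"
  shows "b \<in> holder_closure a"
proof -
  have "unit_holder_norm a (\<lambda>t. b t - b t) \<le> ennreal (0 + 0)" by (rule unit_holder_norm_le) auto
  then show ?thesis using assms unfolding holder_closure_def by fastforce
qed

lemma test_class_holder_tests:
  assumes "0 < a"
  shows "test_class (holder_tests a)"
proof
  fix b assume b: "b \<in> holder_tests a"
  then show "bounded_measurable b" "\<And>t. t \<in> {0..1} \<Longrightarrow> \<bar>b t\<bar> \<le> 1"
    using assms by (auto simp: holder_tests_def holder_tests_bound)
  have "(\<lambda>t. - b t) \<in> holder_closure a"
    unfolding holder_closure_def
  proof (safe)
    fix \<epsilon> :: real assume "\<epsilon> > 0"
    then obtain g K where g: "K-lipschitz_on {0..1} g" "unit_holder_norm a (\<lambda>t. b t - g t) < ennreal \<epsilon>"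
      using b unfolding holder_tests_def holder_closure_def by blast
    moreover have "unit_holder_norm a (\<lambda>t. - b t - - g t) = unit_holder_norm a (\<lambda>t. b t - g t)"
      using unit_holder_norm_minus[of a "\<lambda>t. b t - g t"] by (simp add: add.commute)
    ultimately show "\<exists>g. (\<exists>K. K-lipschitz_on {0..1} g) \<and> unit_holder_norm a (\<lambda>t. - b t - g t) < ennreal \<epsilon>"
      by (intro exI[of _ "\<lambda>t. - g t"]) auto
  qed
  then show "(\<lambda>t. - b t) \<in> holder_tests a" using b by (simp add: holder_tests_def)
next
  show "(\<lambda>_. 1) \<in> holder_tests a"
    using unit_holder_norm_le[of "\<lambda>_. 1" 1 0 a]
    by (auto simp: holder_tests_def intro!: lipschitz_in_holder_closure[of 0] lipschitz_onI)
qed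

text \<open>Distances in the unit interval are at most 1, so lowering the exponent only lowers the
  difference quotients.\<close>

lemma lip_tests_subset:
  assumes "a \<le> 1"
  shows "lip_tests \<subseteq> holder_tests a"
proof
  fix b assume b: "b \<in> lip_tests"
  then have "1-lipschitz_on {0..1} b"
    by (auto simp: lip_tests_def dist_real_def intro!: lipschitz_onI dest: holder_tests_bound(2))
  then have "b \<in> holder_closure a" by (rule lipschitz_in_holder_closure)
  moreover have "unit_holder_norm a b \<le> unit_holder_norm 1 b"
    unfolding unit_holder_norm_def
  proof (intro add_left_mono SUP_mono)
    fix p :: "real \<times> real" assume p: "p \<in> {(t, t'). t \<in> {0..1} \<and> t' \<in> {0..1} \<and> t \<noteq> t'}"
    obtain t t' where [simp]: "p = (t, t')" by fastforce
    have "\<bar>t - t'\<bar> powr 1 \<le> \<bar>t - t'\<bar> powr a" using p assms by (intro powr_mono') auto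
    then have "\<bar>b t - b t'\<bar> / \<bar>t - t'\<bar> powr a \<le> \<bar>b t - b t'\<bar> / \<bar>t - t'\<bar> powr 1"
      using p by (intro divide_left_mono) auto
    then show "\<exists>q\<in>{(t, t'). t \<in> {0..1} \<and> t' \<in> {0..1} \<and> t \<noteq> t'}.
        (case p of (t, t') \<Rightarrow> ennreal (\<bar>b t - b t'\<bar> / \<bar>t - t'\<bar> powr a))
        \<le> (case q of (t, t') \<Rightarrow> ennreal (\<bar>b t - b t'\<bar> / \<bar>t - t'\<bar> powr 1))"
      using p by (intro bexI[of _ p]) (auto intro: ennreal_leI)
  qed
  ultimately show "b \<in> holder_tests a" using b unfolding holder_tests_def lip_tests_def by force
qed

text \<open>Dividing b by 2K leaves 1/2 for the supremum and 1/2 for the Lipschitz constant, whose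
  sum is the norm. For K = 0 the test vanishes on the interval, and the division is avoided.\<close>

lemma weak_norm_upper_lipschitz:
  assumes "f \<in> C1_unstable" "s \<in> {0..1}"
    and A: "\<And>t. t \<in> {0..1} \<Longrightarrow> \<bar>b t\<bar> \<le> K"
    and B: "\<And>t t'. t \<in> {0..1} \<Longrightarrow> t' \<in> {0..1} \<Longrightarrow> \<bar>b t - b t'\<bar> \<le> K * \<bar>t - t'\<bar>"
  shows "\<bar>leaf_integral f s b\<bar> \<le> 2 * K * weak_norm f"
proof (cases "K = 0")
  case True
  have "\<bar>leaf_integral f s b\<bar> \<le> 0"
    unfolding leaf_integral_def using A by (intro unit_set_integral_bound) (simp add: True)
  then show ?thesis using True by simp
next
  case False
  then have K: "K > 0" using A[of 0] by force
  have "unit_holder_norm 1 (\<lambda>t. 1 / (2 * K) * b t) \<le> ennreal (1 / 2 + 1 / 2)"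
  proof (rule unit_holder_norm_le)
    fix t t' :: real assume t: "t \<in> {0..1}" and t': "t' \<in> {0..1}"
    show "\<bar>1 / (2 * K) * b t - 1 / (2 * K) * b t'\<bar> \<le> 1 / 2 * \<bar>t - t'\<bar> powr 1"
      using B[OF t t'] K by (simp add: right_diff_distrib[symmetric] diff_divide_distrib[symmetric]
          abs_mult field_simps)
  qed (use A K in \<open>auto simp: abs_mult field_simps\<close>)
  then have "(\<lambda>t. 1 / (2 * K) * b t) \<in> lip_tests" by (simp add: lip_tests_def)
  from lip.test_norm_upper[OF assms(1,2) this] show ?thesis
    unfolding leaf_integral_scale_right weak_norm_eq using K by (simp add: abs_mult field_simps)
qed

text \<open>The real \<open>Sup\<close> needs a bounded set: \<open>f\<close> is uniformly Lipschitz
  across leaves, so the quotients are at most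
  \<open>K * \<bar>s1 - s2\<bar> powr (1 - \<beta>)\<close>, which stays below K because \<beta> <
  1.\<close>

lemma strong_unstable_norm_upper:
  assumes "f \<in> C1_unstable" "s1 \<in> {0..1}" "s2 \<in> {0..1}" "b \<in> lip_tests" "\<beta> < 1" "0 < \<beta>"
  shows "\<bar>leaf_integral f s1 b - leaf_integral f s2 b\<bar> \<le> strong_unstable_norm \<beta> f * \<bar>s1 - s2\<bar> powr \<beta>"
proof (cases "s1 = s2")
  case False
  obtain K where K: "0 \<le> K" "\<And>s t. s \<in> {0..1} \<Longrightarrow> t \<in> {0..1} \<Longrightarrow> \<bar>f (s, t)\<bar> \<le> K"
    "\<And>s s' t. s \<in> {0..1} \<Longrightarrow> s' \<in> {0..1} \<Longrightarrow> t \<in> {0..1} \<Longrightarrow> \<bar>f (s, t) - f (s', t)\<bar> \<le> K * \<bar>s - s'\<bar>"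
    using C1_unstableE[OF assms(1)] by blast
  have "bdd_above {\<bar>s1 - s2\<bar> powr (- \<beta>) * \<bar>leaf_integral f s1 b - leaf_integral f s2 b\<bar> | s1 s2 b.
      s1 \<in> {0..1} \<and> s2 \<in> {0..1} \<and> s1 \<noteq> s2 \<and> b \<in> lip_tests}" (is "bdd_above ?S")
  proof (rule bdd_aboveI)
    fix x assume "x \<in> ?S"
    then obtain s1 s2 b where x: "x = \<bar>s1 - s2\<bar> powr (- \<beta>) * \<bar>leaf_integral f s1 b - leaf_integral f s2 b\<bar>"
      and s: "s1 \<in> {0..1}" "s2 \<in> {0..1}" "s1 \<noteq> s2" "b \<in> lip_tests" by blast
    have "x \<le> \<bar>s1 - s2\<bar> powr (- \<beta>) * (K * \<bar>s1 - s2\<bar>)"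
      unfolding x using s lip.bounded lip.measurable
      by (intro mult_left_mono leaf_integral_lipschitz[OF assms(1) K(3)]) auto
    also have "\<dots> = K * (\<bar>s1 - s2\<bar> powr (- \<beta>) * \<bar>s1 - s2\<bar> powr 1)" by simp
    also have "\<dots> = K * \<bar>s1 - s2\<bar> powr (1 - \<beta>)" by (simp only: powr_add[symmetric]) simp
    also have "\<dots> \<le> K * 1 powr (1 - \<beta>)"
      using K(1) s assms(5) by (intro mult_left_mono powr_mono2) auto
    finally show "x \<le> K" by simp
  qed
  then have "\<bar>s1 - s2\<bar> powr (- \<beta>) * \<bar>leaf_integral f s1 b - leaf_integral f s2 b\<bar> \<le> strong_unstable_norm \<beta> f"
    unfolding strong_unstable_norm_eq using assms False by (intro cSup_upper) blast+
  then show ?thesis using False by (simp add: powr_minus field_simps)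
qed (use assms in simp)

lemma strong_unstable_norm_least:
  assumes "\<And>s1 s2 b. s1 \<in> {0..1} \<Longrightarrow> s2 \<in> {0..1} \<Longrightarrow> b \<in> lip_tests \<Longrightarrow>
      \<bar>leaf_integral f s1 b - leaf_integral f s2 b\<bar> \<le> C * \<bar>s1 - s2\<bar> powr \<beta>"
  shows "strong_unstable_norm \<beta> f \<le> C"
  unfolding strong_unstable_norm_eq
proof (rule cSup_least)
  have "\<bar>0 - 1\<bar> powr (- \<beta>) * \<bar>leaf_integral f 0 (\<lambda>_. 1) - leaf_integral f 1 (\<lambda>_. 1)\<bar>
    \<in> {\<bar>s1 - s2\<bar> powr (- \<beta>) * \<bar>leaf_integral f s1 b - leaf_integral f s2 b\<bar> | s1 s2 b.
      s1 \<in> {0..1} \<and> s2 \<in> {0..1} \<and> s1 \<noteq> s2 \<and> b \<in> lip_tests}"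
    using lip_tests_one by (intro CollectI exI[of _ 0] exI[of _ 1] exI[of _ "\<lambda>_. 1"]) auto
  then show "{\<bar>s1 - s2\<bar> powr (- \<beta>) * \<bar>leaf_integral f s1 b - leaf_integral f s2 b\<bar> | s1 s2 b.
      s1 \<in> {0..1} \<and> s2 \<in> {0..1} \<and> s1 \<noteq> s2 \<and> b \<in> lip_tests} \<noteq> {}" by blast
next
  fix x assume "x \<in> {\<bar>s1 - s2\<bar> powr (- \<beta>) * \<bar>leaf_integral f s1 b - leaf_integral f s2 b\<bar> | s1 s2 b.
      s1 \<in> {0..1} \<and> s2 \<in> {0..1} \<and> s1 \<noteq> s2 \<and> b \<in> lip_tests}"
  then obtain s1 s2 b where x: "x = \<bar>s1 - s2\<bar> powr (- \<beta>) * \<bar>leaf_integral f s1 b - leaf_integral f s2 b\<bar>"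
    and s: "s1 \<in> {0..1}" "s2 \<in> {0..1}" "s1 \<noteq> s2" "b \<in> lip_tests" by blast
  have "x = \<bar>leaf_integral f s1 b - leaf_integral f s2 b\<bar> / \<bar>s1 - s2\<bar> powr \<beta>"
    by (simp add: x powr_minus divide_inverse mult.commute)
  then show "x \<le> C" using assms[OF s(1,2,4)] s(3) by (simp add: pos_divide_le_eq)
qed

lemma strong_unstable_norm_nonneg:
  assumes "f \<in> C1_unstable" "\<beta> < 1" "0 < \<beta>"
  shows "0 \<le> strong_unstable_norm \<beta> f"
  using strong_unstable_norm_upper[OF assms(1), of 0 1 "\<lambda>_. 1" \<beta>] lip_tests_one assms
  by (auto intro: order_trans[OF abs_ge_zero])

lemma weak_norm_nonneg: "f \<in> C1_unstable \<Longrightarrow> 0 \<le> weak_norm f"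
  by (simp add: weak_norm_eq lip.test_norm_nonneg)

lemma weak_le_strong_norm:
  assumes "f \<in> C1_unstable" "0 < \<alpha>" "\<alpha> \<le> 1" "0 < \<beta>" "\<beta> < 1"
  shows "weak_norm f \<le> strong_norm \<alpha> \<beta> f"
proof -
  interpret holder: test_class "holder_tests \<alpha>" using assms(2) by (rule test_class_holder_tests)
  have "weak_norm f \<le> strong_stable_norm \<alpha> f"
    unfolding weak_norm_eq strong_stable_norm_eq
    using lip_tests_subset[OF assms(3)] assms(1) by (blast intro: lip.test_norm_least holder.test_norm_upper)
  then show ?thesis
    using strong_unstable_norm_nonneg[OF assms(1,5,4)] by (simp add: strong_norm_def)
qed

section \<open>Fubini on the square and mollifiers\<close>

lemma square_integrable:
  fixes F :: "real \<times> real \<Rightarrow> real"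
  assumes F: "F \<in> borel_measurable (restrict_space borel unit_square)"
    and K: "\<And>p. p \<in> unit_square \<Longrightarrow> \<bar>F p\<bar> \<le> K"
  shows "set_integrable lborel unit_square F"
proof (rule set_integrable_bound)
  have "emeasure lborel unit_square < \<infinity>"
    unfolding unit_square_def using bounded_Times[of "{0..1::real}" "{0..1::real}"]
    by (intro emeasure_bounded_finite) simp
  then show "set_integrable lborel unit_square (\<lambda>_. K)"
    unfolding set_integrable_def real_scaleR_def mult.commute[of _ K]
    by (intro integrable_mult_right integrable_real_indicator) auto
  show "set_borel_measurable lborel unit_square F"
    using measurable_indicator_unit_square[OF F] by (simp add: set_borel_measurable_def)
  show "AE p in lborel. p \<in> unit_square \<longrightarrow> norm (F p) \<le> norm K"
    using order_trans[OF K abs_ge_self] by (intro AE_I2) simp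
qed

lemma square_integral:
  fixes F :: "real \<times> real \<Rightarrow> real"
  assumes F: "F \<in> borel_measurable (restrict_space borel unit_square)"
    and K: "\<And>p. p \<in> unit_square \<Longrightarrow> \<bar>F p\<bar> \<le> K"
  shows "(LINT p:unit_square|lborel. F p) = (LBINT s:{0..1}. LBINT t:{0..1}. F (s, t))"
    and "set_integrable lborel {0..1} (\<lambda>s. LBINT t:{0..1}. F (s, t))"
proof -
  define G where "G p = indicat_real unit_square p *\<^sub>R F p" for p
  have "integrable lborel G"
    using square_integrable[OF F K] unfolding set_integrable_def G_def .
  then have int2: "integrable (lborel \<Otimes>\<^sub>M lborel) G" by (simp add: lborel_prod)
  have split: "(\<integral>t. G (s, t) \<partial>lborel) = indicat_real {0..1} s *\<^sub>R (LBINT t:{0..1}. F (s, t))" for s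
  proof -
    have "(\<integral>t. G (s, t) \<partial>lborel) = (\<integral>t. indicat_real {0..1} s *\<^sub>R (indicat_real {0..1} t *\<^sub>R F (s, t)) \<partial>lborel)"
      by (intro Bochner_Integration.integral_cong) (auto simp: G_def unit_square_def indicator_def)
    then show ?thesis by (simp only: set_lebesgue_integral_def integral_scaleR_right)
  qed
  show "(LINT p:unit_square|lborel. F p) = (LBINT s:{0..1}. LBINT t:{0..1}. F (s, t))"
    using lborel_pair.integral_fst'[OF int2]
    by (simp only: split lborel_prod) (simp add: set_lebesgue_integral_def G_def[abs_def])
  show "set_integrable lborel {0..1} (\<lambda>s. LBINT t:{0..1}. F (s, t))"
    using lborel_pair.integrable_fst'[OF int2] unfolding split set_integrable_def .
qed

lemma C1_integral:
  assumes "f \<in> C1_unstable" "\<phi> \<in> C1_stable"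
  shows "(LINT p:unit_square|lborel. f p * \<phi> p) = (LBINT s:{0..1}. leaf_integral f s (\<lambda>t. \<phi> (s, t)))"
    and "set_integrable lborel {0..1} (\<lambda>s. leaf_integral f s (\<lambda>t. \<phi> (s, t)))"
    and "set_integrable lborel unit_square (\<lambda>p. f p * \<phi> p)"
proof -
  obtain K where K: "\<forall>t\<in>{0..1}. \<forall>s\<in>{0..1}. \<bar>f (s, t)\<bar> \<le> K"
    using assms(1) unfolding C1_unstable_iff by blast
  obtain L where L: "\<forall>s\<in>{0..1}. \<forall>t\<in>{0..1}. \<bar>\<phi> (s, t)\<bar> \<le> L"
    using assms(2) unfolding C1_stable_iff by blast
  have m: "(\<lambda>p. f p * \<phi> p) \<in> borel_measurable (restrict_space borel unit_square)"
    using assms unfolding C1_unstable_iff C1_stable_iff by (intro borel_measurable_times) blast+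
  have b: "\<bar>f p * \<phi> p\<bar> \<le> K * L" if "p \<in> unit_square" for p
  proof -
    have "\<bar>f p\<bar> \<le> K" "\<bar>\<phi> p\<bar> \<le> L" using K L that by (auto simp: unit_square_def)
    moreover from this have "0 \<le> K" by linarith
    ultimately show ?thesis by (auto simp: abs_mult intro!: mult_mono)
  qed
  show "(LINT p:unit_square|lborel. f p * \<phi> p) = (LBINT s:{0..1}. leaf_integral f s (\<lambda>t. \<phi> (s, t)))"
    and "set_integrable lborel {0..1} (\<lambda>s. leaf_integral f s (\<lambda>t. \<phi> (s, t)))"
    using square_integral[OF m b] unfolding leaf_integral_def by auto
  show "set_integrable lborel unit_square (\<lambda>p. f p * \<phi> p)" by (rule square_integrable[OF m b])
qed

lemma C1_integral_diff:
  assumes "f \<in> C1_unstable" "g \<in> C1_unstable" "\<phi> \<in> C1_stable"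
  shows "(LINT p:unit_square|lborel. (f p - g p) * \<phi> p)
    = (LINT p:unit_square|lborel. f p * \<phi> p) - (LINT p:unit_square|lborel. g p * \<phi> p)"
  unfolding left_diff_distrib using assms by (intro set_integral_diff C1_integral)

lemma C1_integral_add:
  assumes "f \<in> C1_unstable" "g \<in> C1_unstable" "\<phi> \<in> C1_stable"
  shows "(LINT p:unit_square|lborel. (f p + g p) * \<phi> p)
    = (LINT p:unit_square|lborel. f p * \<phi> p) + (LINT p:unit_square|lborel. g p * \<phi> p)"
  unfolding distrib_right using assms by (intro set_integral_add C1_integral)

text \<open>Fubini reduces the integral to leaf integrals against Lipschitz tests of uniformly
  bounded norm. Hence the pairing extends continuously to any completion whose norm dominates the
  weak one.\<close>

lemma C1_integral_le_weak_norm: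
  assumes "\<phi> \<in> C1_stable"
  shows "\<exists>K\<ge>0. \<forall>f\<in>C1_unstable. \<bar>LINT p:unit_square|lborel. f p * \<phi> p\<bar> \<le> K * weak_norm f"
proof -
  obtain K where K: "0 \<le> K" "\<And>s t. s \<in> {0..1} \<Longrightarrow> t \<in> {0..1} \<Longrightarrow> \<bar>\<phi> (s, t)\<bar> \<le> K"
    "\<And>s t t'. s \<in> {0..1} \<Longrightarrow> t \<in> {0..1} \<Longrightarrow> t' \<in> {0..1} \<Longrightarrow> \<bar>\<phi> (s, t) - \<phi> (s, t')\<bar> \<le> K * \<bar>t - t'\<bar>"
    using C1_stableE[OF assms] by blast
  have "\<bar>LINT p:unit_square|lborel. f p * \<phi> p\<bar> \<le> 2 * K * weak_norm f" if f: "f \<in> C1_unstable" for f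
    unfolding C1_integral(1)[OF f assms]
    using K f by (intro unit_set_integral_bound weak_norm_upper_lipschitz) auto
  then show ?thesis using K(1) by (intro exI[of _ "2 * K"]) auto
qed

text \<open>A probability density on \<open>{0..1}\<close> concentrated within distance \<open>\<delta>\<close> of \<open>h\<close>: the interval is the
  image of \<open>{0..1}\<close> under the contraction by \<open>\<delta>\<close> towards \<open>h\<close>, hence does not leave \<open>{0..1}\<close>.\<close>

definition mollifier :: "real \<Rightarrow> real \<Rightarrow> real \<Rightarrow> real" where
  "mollifier h \<delta> u = indicat_real {h - \<delta> * h..h - \<delta> * h + \<delta>} u / \<delta>"

context
  fixes h \<delta> :: real
  assumes h: "h \<in> {0..1}" and \<delta>: "0 < \<delta>" "\<delta> \<le> 1"
begin

lemma mollifier_measurable: "mollifier h \<delta> \<in> borel_measurable borel"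
  unfolding mollifier_def[abs_def] by measurable

lemma mollifier_bound: "\<bar>mollifier h \<delta> u\<bar> \<le> 1 / \<delta>"
  using \<delta> by (simp add: mollifier_def indicator_def)

lemma bounded_measurable_mollifier: "bounded_measurable (mollifier h \<delta>)"
proof -
  have "(\<lambda>u. indicat_real {0..1} u *\<^sub>R mollifier h \<delta> u) \<in> borel_measurable lborel"
    using mollifier_measurable by (intro borel_measurable_scaleR) auto
  then show ?thesis
    using mollifier_bound unfolding bounded_measurable_def set_borel_measurable_def by blast
qed

lemma contraction_in_unit:
  assumes "x \<in> {0..1}"
  shows "h + \<delta> * (x - h) \<in> {0..1}"
proof -
  have "h + \<delta> * (x - h) = (1 - \<delta>) * h + \<delta> * x" by (simp add: algebra_simps)
  moreover have "(1 - \<delta>) * h \<le> (1 - \<delta>) * 1" using h \<delta> by (intro mult_left_mono) auto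
  moreover have "\<delta> * x \<le> \<delta> * 1" using \<delta> assms by (intro mult_left_mono) auto
  moreover have "0 \<le> (1 - \<delta>) * h + \<delta> * x" using h \<delta> assms by simp
  ultimately show ?thesis by simp
qed

text \<open>Substitution t = h + \<delta> (x - h), which carries the unit interval onto the support;
  the Jacobian cancels the height 1/\<delta>.\<close>

lemma mollifier_integral:
  "(LBINT t:{0..1}. mollifier h \<delta> t * b t) = (LBINT x:{0..1}. b (h + \<delta> * (x - h)))"
proof -
  have *: "indicat_real {0..1} (h - \<delta> * h + \<delta> * x) *\<^sub>R (mollifier h \<delta> (h - \<delta> * h + \<delta> * x) * b (h - \<delta> * h + \<delta> * x))
     = (1 / \<delta>) *\<^sub>R (indicat_real {0..1} x *\<^sub>R b (h + \<delta> * (x - h)))" for x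
  proof (cases "x \<in> {0..1}")
    case True
    then have "\<delta> * x \<le> \<delta> * 1" using \<delta> by (intro mult_left_mono) auto
    then have "mollifier h \<delta> (h - \<delta> * h + \<delta> * x) = 1 / \<delta>"
      using True \<delta> by (auto simp: mollifier_def)
    moreover have "h - \<delta> * h + \<delta> * x = h + \<delta> * (x - h)" by (simp add: algebra_simps)
    ultimately show ?thesis using True contraction_in_unit[OF True] by (simp only:) simp
  next
    case False
    then have "x < 0 \<or> 1 < x" by auto
    then have "\<delta> * x < 0 \<or> \<delta> < \<delta> * x" using \<delta> by (auto simp: mult_less_0_iff)
    then have "mollifier h \<delta> (h - \<delta> * h + \<delta> * x) = 0" by (auto simp: mollifier_def)
    then show ?thesis using False by simp
  qed
  have "(LBINT t:{0..1}. mollifier h \<delta> t * b t)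
    = \<bar>\<delta>\<bar> *\<^sub>R (\<integral>x. (1 / \<delta>) *\<^sub>R (indicat_real {0..1} x *\<^sub>R b (h + \<delta> * (x - h))) \<partial>lborel)"
    unfolding set_lebesgue_integral_def *[symmetric] using \<delta> by (intro lborel_integral_real_affine) auto
  also have "\<dots> = (LBINT x:{0..1}. b (h + \<delta> * (x - h)))"
    using \<delta> by (simp add: set_lebesgue_integral_def del: real_scaleR_def) simp
  finally show ?thesis .
qed

text \<open>The mollifier has mass 1, so the error is an average of b - c over its support.\<close>

lemma mollifier_integral_close:
  assumes b: "bounded_measurable b"
    and close: "\<And>t. t \<in> {0..1} \<Longrightarrow> \<bar>t - h\<bar> \<le> \<delta> \<Longrightarrow> \<bar>b t - c\<bar> \<le> \<epsilon>"
  shows "\<bar>(LBINT t:{0..1}. mollifier h \<delta> t * b t) - c\<bar> \<le> \<epsilon>"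
proof -
  have one: "(LBINT t:{0..1}. mollifier h \<delta> t * c) = c"
    using mollifier_integral[of "\<lambda>_. c"] by (simp add: set_lebesgue_integral_def)
  have "(LBINT t:{0..1}. mollifier h \<delta> t * b t) - c
    = (LBINT t:{0..1}. mollifier h \<delta> t * b t) - (LBINT t:{0..1}. mollifier h \<delta> t * c)"
    by (simp only: one)
  also have "\<dots> = (LBINT t:{0..1}. mollifier h \<delta> t * (b t - c))"
    unfolding right_diff_distrib using b bounded_measurable_mollifier
    by (intro set_integral_diff(2)[symmetric] bounded_measurable_integrable bounded_measurable_mult) auto
  also have "\<dots> = (LBINT x:{0..1}. b (h + \<delta> * (x - h)) - c)" by (rule mollifier_integral)
  also have "\<bar>\<dots>\<bar> \<le> \<epsilon>"
  proof (intro unit_set_integral_bound close contraction_in_unit)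
    fix x :: real assume "x \<in> {0..1}"
    then have "\<delta> * \<bar>x - h\<bar> \<le> \<delta> * 1" using h \<delta> by (intro mult_left_mono) auto
    then show "\<bar>h + \<delta> * (x - h) - h\<bar> \<le> \<delta>" using \<delta> by (simp add: abs_mult)
  qed
  finally show ?thesis .
qed

end

section \<open>The norms are closable with respect to weak convergence\<close>

text \<open>This is what makes the completion a space of functionals.\<close>

definition closable :: "((real \<times> real \<Rightarrow> real) \<Rightarrow> real) \<Rightarrow> bool" where
  "closable p \<longleftrightarrow> (\<forall>f. (\<forall>n::nat. f n \<in> C1_unstable) \<longrightarrow>
     (\<forall>\<epsilon>>0. \<exists>N. \<forall>m\<ge>N. \<forall>n\<ge>N. p (\<lambda>x. f m x - f n x) < \<epsilon>) \<longrightarrow>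
     (\<forall>\<phi>\<in>C1_stable. (\<lambda>n. LINT q:unit_square|lborel. f n q * \<phi> q) \<longlonglongrightarrow> 0) \<longrightarrow>
     (\<lambda>n. p (f n)) \<longlonglongrightarrow> 0)"

lemma closableD:
  assumes "closable p" "\<And>n. f n \<in> C1_unstable"
    and "\<forall>\<epsilon>>0. \<exists>N. \<forall>m\<ge>N. \<forall>n\<ge>N. p (\<lambda>x. f m x - f n x) < \<epsilon>"
    and "\<And>\<phi>. \<phi> \<in> C1_stable \<Longrightarrow> (\<lambda>n. LINT q:unit_square|lborel. f n q * \<phi> q) \<longlonglongrightarrow> 0"
  shows "(\<lambda>n. p (f n)) \<longlonglongrightarrow> 0"
  using assms unfolding closable_def by simp

text \<open>\<open>C1_stable\<close> asks for no regularity across stable leaves, so a test may be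
  concentrated on a thin vertical strip with jumps at its sides. Such tests nearly isolate one
  leaf.\<close>

lemma mollified_test_C1_stable:
  assumes h: "h \<in> {0..1}" "0 < \<delta>" "\<delta> \<le> 1" and b: "b \<in> lip_tests"
  shows "(\<lambda>p. mollifier h \<delta> (fst p) * b (snd p)) \<in> C1_stable"
  unfolding C1_stable_iff
proof (intro conjI exI[of _ "1 / \<delta>"] ballI)
  have b': "unit_holder_norm 1 b \<le> 1" using b by (simp add: lip_tests_def)
  have "continuous_on {0..1} b"
    by (rule holder_continuous_on[of 1 _ _ 1]) (use holder_tests_bound[OF b'] in auto)
  then have "continuous_on unit_square (\<lambda>p. b (snd p))"
    by (rule continuous_on_compose2) (auto simp: unit_square_def intro!: continuous_intros)
  then have "(\<lambda>p. b (snd p)) \<in> borel_measurable (restrict_space borel unit_square)"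
    by (rule borel_measurable_continuous_on_restrict)
  moreover have "(\<lambda>p. mollifier h \<delta> (fst p)) \<in> borel_measurable (restrict_space borel unit_square)"
    by (intro measurable_restrict_space1 measurable_compose[OF _ mollifier_measurable[OF h]]
        borel_measurable_continuous_onI continuous_intros)
  ultimately show "(\<lambda>p. mollifier h \<delta> (fst p) * b (snd p)) \<in> borel_measurable (restrict_space borel unit_square)"
    by (intro borel_measurable_times)
  fix s t t' :: real assume "s \<in> {0..1}" and t: "t \<in> {0..1}"
  have "\<bar>mollifier h \<delta> s\<bar> * \<bar>b t\<bar> \<le> 1 / \<delta> * 1"
    using holder_tests_bound(1)[OF b' t] mollifier_bound[OF h] h by (intro mult_mono) auto
  then show "\<bar>mollifier h \<delta> (fst (s, t)) * b (snd (s, t))\<bar> \<le> 1 / \<delta>" by (simp add: abs_mult)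
  assume t': "t' \<in> {0..1}"
  have "\<bar>mollifier h \<delta> s\<bar> * \<bar>b t - b t'\<bar> \<le> 1 / \<delta> * \<bar>t - t'\<bar>"
    using holder_tests_bound(2)[OF b' t t'] mollifier_bound[OF h] h by (intro mult_mono) auto
  then show "\<bar>mollifier h \<delta> (fst (s, t)) * b (snd (s, t)) - mollifier h \<delta> (fst (s, t')) * b (snd (s, t'))\<bar>
      \<le> 1 / \<delta> * \<bar>t - t'\<bar>"
    by (simp add: abs_mult right_diff_distrib[symmetric])
qed (use h in auto)

text \<open>Weak convergence only sees averages over strips, whereas the norm sees single leaves.
  One fixed member \<open>f N\<close>, Lipschitz across leaves, bridges this: its leaf integral is
  close to its strip average, and the Cauchy property carries the comparison to all later members,
  uniformly in the leaf and the test.\<close>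

lemma closable_weak_norm: "closable weak_norm"
  unfolding closable_def
proof (intro allI impI)
  fix f :: "nat \<Rightarrow> real \<times> real \<Rightarrow> real"
  assume f: "\<forall>n. f n \<in> C1_unstable"
    and cauchy: "\<forall>\<epsilon>>0. \<exists>N. \<forall>m\<ge>N. \<forall>n\<ge>N. weak_norm (\<lambda>x. f m x - f n x) < \<epsilon>"
    and null: "\<forall>\<phi>\<in>C1_stable. (\<lambda>n. LINT q:unit_square|lborel. f n q * \<phi> q) \<longlonglongrightarrow> 0"
  show "(\<lambda>n. weak_norm (f n)) \<longlonglongrightarrow> 0"
  proof (rule LIMSEQ_I)
    fix \<epsilon> :: real assume "0 < \<epsilon>"
    define e where "e = \<epsilon> / 5"
    have e: "e > 0" using \<open>0 < \<epsilon>\<close> by (simp add: e_def)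
    obtain N where N: "\<And>m n. m \<ge> N \<Longrightarrow> n \<ge> N \<Longrightarrow> weak_norm (\<lambda>x. f m x - f n x) < e"
      using cauchy e by blast
    have close: "\<bar>leaf_integral (f m) s b - leaf_integral (f n) s b\<bar> \<le> e"
      if "m \<ge> N" "n \<ge> N" "s \<in> {0..1}" "b \<in> lip_tests" for m n s b
      using lip.test_norm_upper[OF C1_unstable_diff[of "f m" "f n"] that(3,4)] N[OF that(1,2)] f that
      by (auto simp: leaf_integral_diff_left weak_norm_eq lip.measurable)
    obtain K where K: "0 \<le> K" "\<And>s t. s \<in> {0..1} \<Longrightarrow> t \<in> {0..1} \<Longrightarrow> \<bar>f N (s, t)\<bar> \<le> K"
      "\<And>s s' t. s \<in> {0..1} \<Longrightarrow> s' \<in> {0..1} \<Longrightarrow> t \<in> {0..1} \<Longrightarrow> \<bar>f N (s, t) - f N (s', t)\<bar> \<le> K * \<bar>s - s'\<bar>"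
      using C1_unstableE[OF f[rule_format, of N]] by blast
    \<comment> \<open>The strip width depends on the Lipschitz constant of \<open>f N\<close> alone;
      the constant of \<open>f m\<close>, chosen later, is uncontrolled and serves only for
      measurability.\<close>
    define \<delta> where "\<delta> = min 1 (e / (K + 1))"
    have \<delta>: "0 < \<delta>" "\<delta> \<le> 1" using e K by (auto simp: \<delta>_def)
    have "K * \<delta> \<le> K * (e / (K + 1))" using K by (intro mult_left_mono) (auto simp: \<delta>_def)
    also have "\<dots> \<le> e" using K e by (simp add: field_simps)
    finally have K\<delta>: "K * \<delta> \<le> e" .
    \<comment> \<open>Budget: e from n to N, 2e from the leaf integral of \<open>f N\<close> to the
      strip average of \<open>f m\<close> (e for the width, e from N to m), and e for that average
      itself.\<close>
    have small: "\<bar>leaf_integral (f n) s b\<bar> \<le> 4 * e"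
      if n: "n \<ge> N" and s: "s \<in> {0..1}" and b: "b \<in> lip_tests" for n s b
    proof -
      note test = mollified_test_C1_stable[OF s \<delta> b]
      \<comment> \<open>M depends on the leaf and the test, harmlessly: the final estimate does not
        mention m.\<close>
      obtain M where M: "\<And>m. m \<ge> M \<Longrightarrow>
          \<bar>LINT q:unit_square|lborel. f m q * (mollifier s \<delta> (fst q) * b (snd q))\<bar> < e"
        using LIMSEQ_D[OF null[rule_format, OF test] e] by auto
      define m where "m = max M N"
      have m: "m \<ge> M" "m \<ge> N" by (auto simp: m_def)
      define u where "u x = leaf_integral (f m) x b" for x
      have "\<bar>(LBINT x:{0..1}. mollifier s \<delta> x * u x) - leaf_integral (f N) s b\<bar> \<le> 2 * e"
      proof (rule mollifier_integral_close[OF s \<delta>])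
        obtain L where L: "0 \<le> L" "\<And>s t. s \<in> {0..1} \<Longrightarrow> t \<in> {0..1} \<Longrightarrow> \<bar>f m (s, t)\<bar> \<le> L"
          "\<And>s s' t. s \<in> {0..1} \<Longrightarrow> s' \<in> {0..1} \<Longrightarrow> t \<in> {0..1} \<Longrightarrow> \<bar>f m (s, t) - f m (s', t)\<bar> \<le> L * \<bar>s - s'\<bar>"
          using C1_unstableE[OF f[rule_format, of m]] by blast
        have "\<bar>u x - u y\<bar> \<le> L * \<bar>x - y\<bar>" if "x \<in> {0..1}" "y \<in> {0..1}" for x y
          unfolding u_def using f b lip.measurable lip.bounded that
          by (intro leaf_integral_lipschitz L(3)) auto
        then show "bounded_measurable u"
          by (intro bounded_measurable_continuous holder_continuous_on[of 1 _ _ L]) auto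
        fix x :: real assume x: "x \<in> {0..1}" "\<bar>x - s\<bar> \<le> \<delta>"
        have "\<bar>leaf_integral (f N) x b - leaf_integral (f N) s b\<bar> \<le> K * \<bar>x - s\<bar>"
          using f b lip.measurable lip.bounded x s by (intro leaf_integral_lipschitz K(3)) auto
        also have "\<dots> \<le> K * \<delta>" using x K by (intro mult_left_mono) auto
        finally show "\<bar>u x - leaf_integral (f N) s b\<bar> \<le> 2 * e"
          using close[OF m(2) order_refl x(1) b] K\<delta> unfolding u_def by linarith
      qed
      moreover have "(LINT q:unit_square|lborel. f m q * (mollifier s \<delta> (fst q) * b (snd q)))
        = (LBINT x:{0..1}. mollifier s \<delta> x * u x)"
        unfolding C1_integral(1)[OF f[rule_format] test] u_def
        by (simp add: leaf_integral_scale_right)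
      ultimately show ?thesis
        using M[OF m(1)] close[OF n order_refl s b] by linarith
    qed
    show "\<exists>no. \<forall>n\<ge>no. norm (weak_norm (f n) - 0) < \<epsilon>"
    proof (intro exI[of _ N] allI impI)
      fix n assume "N \<le> n"
      then have "weak_norm (f n) \<le> 4 * e"
        unfolding weak_norm_eq by (intro lip.test_norm_least small)
      then show "norm (weak_norm (f n) - 0) < \<epsilon>"
        using weak_norm_nonneg[OF f[rule_format, of n]] \<open>0 < \<epsilon>\<close> by (simp add: e_def)
    qed
  qed
qed

lemma holder_closure_diff_lipschitz:
  assumes "b \<in> holder_closure a" "K-lipschitz_on {0..1} g"
  shows "(\<lambda>t. b t - g t) \<in> holder_closure a"
  unfolding holder_closure_def
proof safe
  fix \<epsilon> :: real assume "0 < \<epsilon>"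
  then obtain g' K' where g': "K'-lipschitz_on {0..1} g'" "unit_holder_norm a (\<lambda>t. b t - g' t) < ennreal \<epsilon>"
    using assms(1) unfolding holder_closure_def by blast
  show "\<exists>c. (\<exists>K. K-lipschitz_on {0..1} c) \<and> unit_holder_norm a (\<lambda>t. b t - g t - c t) < ennreal \<epsilon>"
    using lipschitz_on_diff[OF g'(1) assms(2)] g'(2) by (intro exI[of _ "\<lambda>t. g' t - g t"]) auto
qed

text \<open>The weak norms tend to 0 already, and each single stable or unstable quantity of
  \<open>f m\<close> is governed by its weak norm up to a small error. The index m may depend on the
  test and the leaves, since the Cauchy property brings the bound back to n uniformly.\<close>

lemma closable_strong_norm:
  assumes \<alpha>: "0 < \<alpha>" "\<alpha> \<le> 1" and \<beta>: "0 < \<beta>" "\<beta> < 1"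
  shows "closable (strong_norm \<alpha> \<beta>)"
  unfolding closable_def
proof (intro allI impI)
  interpret holder: test_class "holder_tests \<alpha>" using \<alpha>(1) by (rule test_class_holder_tests)
  fix f :: "nat \<Rightarrow> real \<times> real \<Rightarrow> real"
  assume f: "\<forall>n. f n \<in> C1_unstable"
    and cauchy: "\<forall>\<epsilon>>0. \<exists>N. \<forall>m\<ge>N. \<forall>n\<ge>N. strong_norm \<alpha> \<beta> (\<lambda>x. f m x - f n x) < \<epsilon>"
    and null: "\<forall>\<phi>\<in>C1_stable. (\<lambda>n. LINT q:unit_square|lborel. f n q * \<phi> q) \<longlonglongrightarrow> 0"
  have fd: "(\<lambda>x. f m x - f n x) \<in> C1_unstable" for m n using f by (intro C1_unstable_diff) auto
  have "\<forall>\<epsilon>>0. \<exists>N. \<forall>m\<ge>N. \<forall>n\<ge>N. weak_norm (\<lambda>x. f m x - f n x) < \<epsilon>"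
  proof (intro allI impI)
    fix \<epsilon> :: real assume "0 < \<epsilon>"
    from cauchy[rule_format, OF this] obtain N
      where "\<forall>m\<ge>N. \<forall>n\<ge>N. strong_norm \<alpha> \<beta> (\<lambda>x. f m x - f n x) < \<epsilon>" ..
    then have "\<forall>m\<ge>N. \<forall>n\<ge>N. weak_norm (\<lambda>x. f m x - f n x) < \<epsilon>"
      using weak_le_strong_norm[OF fd \<alpha> \<beta>] le_less_trans by metis
    then show "\<exists>N. \<forall>m\<ge>N. \<forall>n\<ge>N. weak_norm (\<lambda>x. f m x - f n x) < \<epsilon>" ..
  qed
  then have weak: "(\<lambda>n. weak_norm (f n)) \<longlonglongrightarrow> 0"
    using closable_weak_norm f null by (intro closableD[of weak_norm]) auto
  show "(\<lambda>n. strong_norm \<alpha> \<beta> (f n)) \<longlonglongrightarrow> 0"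
  proof (rule LIMSEQ_I)
    fix \<epsilon> :: real assume "0 < \<epsilon>"
    \<comment> \<open>The stable part will cost 4e and the unstable part 2e.\<close>
    define e where "e = \<epsilon> / 8"
    have e: "e > 0" using \<open>0 < \<epsilon>\<close> by (simp add: e_def)
    from cauchy[rule_format, OF e] obtain N
      where N: "\<And>m n. m \<ge> N \<Longrightarrow> n \<ge> N \<Longrightarrow> strong_norm \<alpha> \<beta> (\<lambda>x. f m x - f n x) < e"
      by blast
    have weak_small: "\<exists>m\<ge>N. c * weak_norm (f m) \<le> r" if r: "0 < r" for c r
    proof -
      have "(\<lambda>m. c * weak_norm (f m)) \<longlonglongrightarrow> c * 0" by (intro tendsto_intros weak)
      then have "(\<lambda>m. c * weak_norm (f m)) \<longlonglongrightarrow> 0" by simp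
      then obtain M where "\<forall>m\<ge>M. norm (c * weak_norm (f m)) < r" using LIMSEQ_D[OF _ r] by fastforce
      then show ?thesis by (intro exI[of _ "max M N"]) (auto dest: spec[of _ "max M N"])
    qed
    have stable: "strong_stable_norm \<alpha> (f n) \<le> 4 * e" if n: "n \<ge> N" for n
      unfolding strong_stable_norm_eq
    proof (rule holder.test_norm_least)
      fix s :: real and b assume s: "s \<in> {0..1}" and b: "b \<in> holder_tests \<alpha>"
      have close: "\<bar>leaf_integral (f m) s c - leaf_integral (f n) s c\<bar> \<le> e"
        if "m \<ge> N" "c \<in> holder_tests \<alpha>" for m c
        using holder.test_norm_upper[OF fd s that(2), of m n] N[OF that(1) n]
          strong_unstable_norm_nonneg[OF fd \<beta>(2,1), of m n] f s holder.measurable[OF that(2)]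
        by (auto simp: leaf_integral_diff_left strong_stable_norm_eq strong_norm_def)
      obtain L where L: "\<forall>t\<in>{0..1}. \<forall>s\<in>{0..1}. \<bar>f n (s, t)\<bar> \<le> L"
        using f unfolding C1_unstable_iff by blast
      \<comment> \<open>Being at most 1, r keeps b - g among the tests, so the Cauchy bound applies
        to it; being at most e / (|L| + 1), it makes the integral of \<open>f n\<close> against b -
        g at most e.\<close>
      define r where "r = min 1 (e / (\<bar>L\<bar> + 1))"
      have r: "0 < r" "r \<le> 1" using e by (auto simp: r_def)
      obtain g K where g: "K-lipschitz_on {0..1} g" "unit_holder_norm \<alpha> (\<lambda>t. b t - g t) < ennreal r"
        using b r(1) unfolding holder_tests_def holder_closure_def by blast
      have gb: "unit_holder_norm \<alpha> (\<lambda>t. b t - g t) \<le> ennreal r" using g(2) by (rule less_imp_le)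
      also have "\<dots> \<le> 1" using r by simp
      finally have d: "(\<lambda>t. b t - g t) \<in> holder_tests \<alpha>"
        using b holder_closure_diff_lipschitz[OF _ g(1)] by (simp add: holder_tests_def)
      have gm: "bounded_measurable g"
        by (rule bounded_measurable_continuous) (rule lipschitz_on_continuous_on[OF g(1)])
      obtain G where G: "\<And>t. t \<in> {0..1} \<Longrightarrow> \<bar>g t\<bar> \<le> G"
        using gm unfolding bounded_measurable_def by blast
      \<comment> \<open>A single constant for the supremum and the Lipschitz constant of g, as the
        weak estimate expects.\<close>
      define A where "A = max K G"
      have A: "\<bar>leaf_integral (f m) s g\<bar> \<le> 2 * A * weak_norm (f m)" for m
      proof (intro weak_norm_upper_lipschitz s)
        fix t t' :: real assume "t \<in> {0..1}" "t' \<in> {0..1}"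
        then have "\<bar>g t - g t'\<bar> \<le> K * \<bar>t - t'\<bar>" using lipschitz_onD[OF g(1)] by (simp add: dist_real_def)
        also have "\<dots> \<le> A * \<bar>t - t'\<bar>" by (intro mult_right_mono) (auto simp: A_def)
        finally show "\<bar>g t - g t'\<bar> \<le> A * \<bar>t - t'\<bar>" .
      next
        show "\<bar>g t\<bar> \<le> A" if "t \<in> {0..1}" for t using G[OF that] by (simp add: A_def)
      qed (use f in auto)
      \<comment> \<open>With m so chosen, \<open>f m\<close> against g costs e and against b - g
        costs 2e (e from m to n, e at n); returning from m to n for b adds the fourth e.\<close>
      obtain m where m: "m \<ge> N" "2 * A * weak_norm (f m) \<le> e" using weak_small[OF e] by blast
      have "\<bar>leaf_integral (f n) s (\<lambda>t. b t - g t)\<bar> \<le> \<bar>L\<bar> * r"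
      proof (rule leaf_integral_bound)
        fix t :: real assume t: "t \<in> {0..1}"
        show "\<bar>f n (s, t)\<bar> \<le> \<bar>L\<bar>" using L[rule_format, OF t s] by linarith
        show "\<bar>b t - g t\<bar> \<le> r" using unit_holder_normD(1)[OF gb _ t] r by simp
      qed
      also have "\<dots> \<le> \<bar>L\<bar> * (e / (\<bar>L\<bar> + 1))" by (intro mult_left_mono) (auto simp: r_def)
      also have "\<dots> \<le> e" using e by (simp add: field_simps)
      finally have "\<bar>leaf_integral (f n) s (\<lambda>t. b t - g t)\<bar> \<le> e" .
      moreover have "leaf_integral (f k) s (\<lambda>t. b t - g t) = leaf_integral (f k) s b - leaf_integral (f k) s g" for k
        using f s b gm holder.measurable by (intro leaf_integral_diff_right) auto
      ultimately show "\<bar>leaf_integral (f n) s b\<bar> \<le> 4 * e"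
        using close[OF m(1) b] close[OF m(1) d] A[of m] m(2) by simp
    qed
    have unstable: "strong_unstable_norm \<beta> (f n) \<le> 2 * e" if n: "n \<ge> N" for n
    proof (rule strong_unstable_norm_least)
      fix s1 s2 :: real and b
      assume s: "s1 \<in> {0..1}" "s2 \<in> {0..1}" and b: "b \<in> lip_tests"
      show "\<bar>leaf_integral (f n) s1 b - leaf_integral (f n) s2 b\<bar> \<le> 2 * e * \<bar>s1 - s2\<bar> powr \<beta>"
      proof (cases "s1 = s2")
        case False
        then have pos: "0 < e * \<bar>s1 - s2\<bar> powr \<beta>" using e by simp
        \<comment> \<open>The weak norm carries no factor of the distance of the leaves; m is taken
          so large, depending on s1 and s2, that the required factor is there anyway.\<close>
        obtain m where m: "m \<ge> N" "2 * weak_norm (f m) \<le> e * \<bar>s1 - s2\<bar> powr \<beta>"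
          using weak_small[OF pos] by blast
        have "0 \<le> strong_stable_norm \<alpha> (\<lambda>x. f n x - f m x)"
          unfolding strong_stable_norm_eq by (rule holder.test_norm_nonneg[OF fd])
        then have "strong_unstable_norm \<beta> (\<lambda>x. f n x - f m x) \<le> e"
          using N[OF n m(1)] by (simp add: strong_norm_def)
        then have "strong_unstable_norm \<beta> (\<lambda>x. f n x - f m x) * \<bar>s1 - s2\<bar> powr \<beta> \<le> e * \<bar>s1 - s2\<bar> powr \<beta>"
          by (intro mult_right_mono) auto
        moreover have "\<bar>leaf_integral (f m) s b\<bar> \<le> weak_norm (f m)" if "s \<in> {0..1}" for s
          unfolding weak_norm_eq using f b that by (intro lip.test_norm_upper) auto
        note this[OF s(1)] this[OF s(2)]
        moreover have "leaf_integral (\<lambda>x. f n x - f m x) s b = leaf_integral (f n) s b - leaf_integral (f m) s b"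
          if "s \<in> {0..1}" for s
          using f that lip.measurable[OF b] by (intro leaf_integral_diff_left) auto
        note this[OF s(1)] this[OF s(2)]
        ultimately show ?thesis
          using strong_unstable_norm_upper[OF fd s b \<beta>(2,1), of n m] m(2) by (simp add: algebra_simps)
      qed simp
    qed
    show "\<exists>no. \<forall>n\<ge>no. norm (strong_norm \<alpha> \<beta> (f n) - 0) < \<epsilon>"
    proof (intro exI[of _ N] allI impI)
      fix n assume n: "N \<le> n"
      have "0 \<le> strong_norm \<alpha> \<beta> (f n)"
        using weak_norm_nonneg weak_le_strong_norm[OF _ \<alpha> \<beta>] f order_trans by blast
      then show "norm (strong_norm \<alpha> \<beta> (f n) - 0) < \<epsilon>"
        using stable[OF n] unstable[OF n] \<open>0 < \<epsilon>\<close> by (simp add: strong_norm_def e_def)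
    qed
  qed
qed

lemma set_integral_sum_bounded:
  assumes "\<And>i. i \<in> A \<Longrightarrow> bounded_measurable (f i)"
  shows "(LBINT t:{0..1}. \<Sum>i\<in>A. f i t) = (\<Sum>i\<in>A. LBINT t:{0..1}. f i t)"
  unfolding set_lebesgue_integral_def scaleR_sum_right
  using assms bounded_measurable_integrable unfolding set_integrable_def
  by (intro Bochner_Integration.integral_sum) auto

lemma lipschitz_bounded_measurable:
  fixes g :: "real \<Rightarrow> real"
  assumes "K-lipschitz_on {0..1} g"
  shows "bounded_measurable g"
  by (rule bounded_measurable_continuous) (rule lipschitz_on_continuous_on[OF assms])

section \<open>The transfer operator on functions\<close>

definition leaf_mean :: "(real \<times> real \<Rightarrow> real) \<Rightarrow> real \<Rightarrow> real" where
  "leaf_mean f s = leaf_integral f s (\<lambda>_. 1)"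

lemma leaf_integral_const: "leaf_integral f s (\<lambda>_. c) = c * leaf_mean f s"
  using leaf_integral_scale_right[of f s c "\<lambda>_. 1"] by (simp add: leaf_mean_def)

lemma leaf_mean_lipschitz:
  assumes "f \<in> C1_unstable"
  shows "\<exists>K. K-lipschitz_on {0..1} (leaf_mean f)"
proof -
  obtain K where K: "0 \<le> K" "\<And>s t. s \<in> {0..1} \<Longrightarrow> t \<in> {0..1} \<Longrightarrow> \<bar>f (s, t)\<bar> \<le> K"
    "\<And>s s' t. s \<in> {0..1} \<Longrightarrow> s' \<in> {0..1} \<Longrightarrow> t \<in> {0..1} \<Longrightarrow> \<bar>f (s, t) - f (s', t)\<bar> \<le> K * \<bar>s - s'\<bar>"
    using C1_unstableE[OF assms] by blast
  have "K-lipschitz_on {0..1} (leaf_mean f)"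
    unfolding leaf_mean_def
    by (rule lipschitz_onI) (auto simp: dist_real_def K(1) intro!: leaf_integral_lipschitz[OF assms K(3)])
  then show ?thesis ..
qed

definition mollifier_width :: "nat \<Rightarrow> real" where
  "mollifier_width m = 1 / real (Suc m)"

lemma mollifier_width: "0 < mollifier_width m" "mollifier_width m \<le> 1"
  by (auto simp: mollifier_width_def)

lemma mollifier_width_tendsto:
  assumes "0 < a"
  shows "(\<lambda>m. mollifier_width m powr a) \<longlonglongrightarrow> 0"
proof -
  have "mollifier_width \<longlonglongrightarrow> 0"
    using LIMSEQ_inverse_real_of_nat by (simp add: mollifier_width_def[abs_def] inverse_eq_divide)
  then have "(\<lambda>m. mollifier_width m powr a) \<longlonglongrightarrow> 0 powr a"
    using assms by (intro tendsto_powr') (auto simp: less_imp_le[OF mollifier_width(1)])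
  then show ?thesis by simp
qed

locale baker =
  fixes \<kappa> :: nat and h :: "nat \<Rightarrow> real" and flip :: "nat \<Rightarrow> bool"
  assumes kappa: "2 \<le> \<kappa>" and height: "\<And>i. i < \<kappa> \<Longrightarrow> h i \<in> {0..1}"
begin

abbreviation "T \<equiv> singular_baker \<kappa> h flip"

text \<open>The inverse of the horizontal component of \<open>T\<close> on the \<open>i\<close>-th strip.\<close>

definition branch :: "nat \<Rightarrow> real \<Rightarrow> real" where
  "branch i u = (real i + (if flip i then 1 - u else u)) / real \<kappa>"

lemma branch_in_unit:
  assumes "i < \<kappa>" "u \<in> {0..1}"
  shows "branch i u \<in> {0..1}"
proof -
  have "real i + 1 \<le> real \<kappa>" using assms(1) by linarith
  then have "0 \<le> real i + (if flip i then 1 - u else u)" "real i + (if flip i then 1 - u else u) \<le> real \<kappa>"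
    using assms(2) by auto
  then show ?thesis using kappa by (simp add: branch_def divide_le_eq)
qed

lemma branch_diff: "\<bar>branch i u - branch i v\<bar> = \<bar>u - v\<bar> / real \<kappa>"
  using kappa by (simp add: branch_def diff_divide_distrib[symmetric] abs_divide abs_minus_commute)

text \<open>The gain 1/\<kappa> is discarded: here it matters only that one constant K serves for
  all iterates.\<close>

lemma lipschitz_branch:
  assumes "K-lipschitz_on {0..1} g" "i < \<kappa>"
  shows "K-lipschitz_on {0..1} (\<lambda>s. g (branch i s))"
proof (rule lipschitz_onI)
  fix u v :: real assume uv: "u \<in> {0..1}" "v \<in> {0..1}"
  have "dist (g (branch i u)) (g (branch i v)) \<le> K * dist (branch i u) (branch i v)"
    by (intro lipschitz_onD[OF assms(1)] branch_in_unit assms uv)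
  also have "\<dots> \<le> K * dist u v"
    using lipschitz_on_nonneg[OF assms(1)] kappa
    by (intro mult_left_mono) (auto simp: dist_real_def branch_diff divide_le_eq mult_le_cancel_left1)
  finally show "dist (g (branch i u)) (g (branch i v)) \<le> K * dist u v" .
qed (rule lipschitz_on_nonneg[OF assms(1)])

lemma average_bound:
  assumes "\<And>i. i < \<kappa> \<Longrightarrow> \<bar>c i\<bar> \<le> B"
  shows "\<bar>(\<Sum>i<\<kappa>. c i) / real \<kappa>\<bar> \<le> B"
proof -
  have "\<bar>\<Sum>i<\<kappa>. c i\<bar> \<le> (\<Sum>i<\<kappa>. B)"
    using assms by (intro order_trans[OF sum_abs] sum_mono) auto
  then show ?thesis using kappa by (simp add: divide_le_eq mult.commute)
qed

subsection \<open>Change of variables\<close>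

text \<open>Half-open strips tile the interval without overlap, which makes the induction
  exact.\<close>

lemma strip_integral:
  assumes "bounded_measurable F" "n \<le> \<kappa>"
  shows "(LBINT x:{0..<real n / \<kappa>}. F x) = (\<Sum>i<n. LBINT x:{real i / \<kappa>..<(real i + 1) / \<kappa>}. F x)"
  using assms(2)
proof (induction n)
  case (Suc n)
  have int: "set_integrable lborel A F" if "A \<subseteq> {0..1}" "A \<in> sets borel" for A
    using set_integrable_subset[OF bounded_measurable_integrable[OF assms(1)]] that by simp
  have le: "(1 + real n) / \<kappa> \<le> 1" using Suc kappa by (simp add: divide_le_eq)
  have le': "real n / \<kappa> \<le> (1 + real n) / \<kappa>" using kappa by (intro divide_right_mono) auto
  have "{0..<real (Suc n) / \<kappa>} = {0..<real n / \<kappa>} \<union> {real n / \<kappa>..<(real n + 1) / \<kappa>}"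
    using le' kappa by (auto simp: ivl_disj_un add.commute intro: order_trans[of 0 "real n / real \<kappa>"])
  then have "(LBINT x:{0..<real (Suc n) / \<kappa>}. F x)
      = (LBINT x:{0..<real n / \<kappa>}. F x) + (LBINT x:{real n / \<kappa>..<(real n + 1) / \<kappa>}. F x)"
    using le le' by (auto intro!: set_integral_Un int simp: add.commute
        intro: order_trans[of 0 "real n / real \<kappa>"])
  then show ?case using Suc by simp
qed (simp add: set_lebesgue_integral_def)

lemma strip_affine:
  assumes "i < \<kappa>"
  shows "(LBINT x:{real i / \<kappa>..<(real i + 1) / \<kappa>}. F x) = (LBINT u:{0..1}. F (branch i u)) / \<kappa>"
proof -
  have k: "real \<kappa> > 0" using kappa by simp
  \<comment> \<open>The orientation of the strip is the sign of the slope c and disappears in its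
    absolute value.\<close>
  define c where "c = (if flip i then - 1 / real \<kappa> else 1 / real \<kappa>)"
  define t where "t = (if flip i then (real i + 1) / \<kappa> else real i / \<kappa>)"
  have br: "t + c * u = branch i u" for u
    by (simp add: t_def c_def branch_def add_divide_distrib[symmetric] diff_divide_distrib[symmetric])
  have mem: "branch i u \<in> {real i / \<kappa>..(real i + 1) / \<kappa>} \<longleftrightarrow> u \<in> {0..1}" for u
    using k by (auto simp: branch_def divide_le_cancel)
  have "(LBINT x:{real i / \<kappa>..<(real i + 1) / \<kappa>}. F x) = (LBINT x:{real i / \<kappa>..(real i + 1) / \<kappa>}. F x)"
    by (rule set_integral_discrete_difference[of "{(real i + 1) / \<kappa>}"]) auto
  also have "\<dots> = \<bar>c\<bar> *\<^sub>R (\<integral>u. indicat_real {real i / \<kappa>..(real i + 1) / \<kappa>} (t + c * u) *\<^sub>R F (t + c * u) \<partial>lborel)"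
    unfolding set_lebesgue_integral_def using k by (intro lborel_integral_real_affine) (auto simp: c_def)
  also have "\<dots> = \<bar>c\<bar> *\<^sub>R (LBINT u:{0..1}. F (branch i u))"
    unfolding set_lebesgue_integral_def br indicator_def mem ..
  also have "\<bar>c\<bar> = 1 / \<kappa>" using k by (simp add: c_def)
  finally show ?thesis by simp
qed

lemma unit_integral_branches:
  assumes "bounded_measurable F"
  shows "(LBINT x:{0..1}. F x) = (\<Sum>i<\<kappa>. LBINT u:{0..1}. F (branch i u)) / \<kappa>"
proof -
  have "(LBINT x:{0..1}. F x) = (LBINT x:{0..<1}. F x)"
    by (rule set_integral_discrete_difference[of "{1}"]) auto
  also have "{0..<1} = {0..<real \<kappa> / \<kappa>}" using kappa by simp
  finally show ?thesis
    using strip_integral[OF assms order_refl] strip_affine by (simp add: sum_divide_distrib)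
qed

lemma baker_eq:
  assumes "i = min (nat \<lfloor>real \<kappa> * x\<rfloor>) (\<kappa> - 1)"
  shows "T (x, y) = (if flip i then 1 - (real \<kappa> * x - real i) else real \<kappa> * x - real i, h i)"
  by (simp add: singular_baker_def Let_def assms)

text \<open>Endpoints are excluded because there the point lies on a side of the strip, where the
  index given by the floor depends on convention.\<close>

lemma baker_branch:
  assumes "i < \<kappa>" "u \<in> {0<..<1}"
  shows "T (branch i u, y) = (u, h i)"
proof -
  define v where "v = (if flip i then 1 - u else u)"
  have v: "0 < v" "v < 1" using assms(2) by (auto simp: v_def)
  have e: "real \<kappa> * branch i u = real i + v" using kappa by (simp add: branch_def v_def)
  have "\<lfloor>real i + v\<rfloor> = int i" using v by (simp add: floor_eq_iff)
  then have "i = min (nat \<lfloor>real \<kappa> * branch i u\<rfloor>) (\<kappa> - 1)" using assms(1) unfolding e by simp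
  from baker_eq[OF this] show ?thesis by (simp only: e) (simp add: v_def)
qed

lemma baker_measurable: "T \<in> borel_measurable borel"
proof -
  define i where "i p = min (nat \<lfloor>real \<kappa> * fst p\<rfloor>) (\<kappa> - 1)" for p :: "real \<times> real"
  have i: "i \<in> measurable borel (count_space UNIV)"
    unfolding i_def[abs_def]
    by (rule measurable_compose[where g = "\<lambda>z. min (nat z) (\<kappa> - 1)" and N = "count_space UNIV"])
      (auto intro!: measurable_compose[OF _ measurable_real_floor] borel_measurable_continuous_onI continuous_intros)
  have g: "(\<lambda>p. g (i p)) \<in> borel_measurable borel" for g :: "nat \<Rightarrow> real"
    by (rule measurable_compose[OF i]) simp
  \<comment> \<open>The case distinction on \<open>flip\<close> is rewritten arithmetically, so that
    measurability follows from sums and products; the strip index takes values in a discrete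
    space.\<close>
  have "(\<lambda>p. (of_bool (flip (i p)) + (1 - 2 * of_bool (flip (i p))) * (real \<kappa> * fst p - real (i p)), h (i p)))
      \<in> borel_measurable borel"
    by (intro borel_measurable_Pair borel_measurable_add borel_measurable_times borel_measurable_diff
        borel_measurable_const g[of "\<lambda>i. of_bool (flip i)"] g[of real] g[of h]
        borel_measurable_continuous_onI continuous_intros)
  also have "(\<lambda>p. (of_bool (flip (i p)) + (1 - 2 * of_bool (flip (i p))) * (real \<kappa> * fst p - real (i p)), h (i p))) = T"
    by (rule ext) (simp add: singular_baker_def i_def Let_def split_beta)
  finally show ?thesis .
qed

lemma baker_unit_square: "p \<in> unit_square \<Longrightarrow> T p \<in> unit_square"
proof -
  assume p: "p \<in> unit_square"
  obtain x y where xy: "p = (x, y)" by fastforce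
  have x: "x \<in> {0..1}" using p by (simp add: xy unit_square_def)
  define i where "i = min (nat \<lfloor>real \<kappa> * x\<rfloor>) (\<kappa> - 1)"
  have i: "i < \<kappa>" using kappa by (simp add: i_def min_less_iff_disj)
  have kx: "0 \<le> real \<kappa> * x" "real \<kappa> * x \<le> real \<kappa>" using x by (auto simp: mult_left_le)
  have "real i \<le> real (nat \<lfloor>real \<kappa> * x\<rfloor>)" by (simp add: i_def)
  then have 1: "real i \<le> real \<kappa> * x" using kx by linarith
  \<comment> \<open>Only at x = 1 does the floor exceed \<kappa> - 1; the \<open>min\<close> then
    assigns the last strip, with remainder exactly 1.\<close>
  have 2: "real \<kappa> * x \<le> real i + 1"
  proof (cases "nat \<lfloor>real \<kappa> * x\<rfloor> \<le> \<kappa> - 1")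
    case True then show ?thesis using kx unfolding i_def by linarith
  next
    case False then show ?thesis using kx kappa by (simp add: i_def of_nat_diff)
  qed
  show ?thesis
    using 1 2 height[OF i] baker_eq[OF i_def] by (simp add: xy unit_square_def)
qed

text \<open>T collapses vertical segments, so the composition is constant along each stable leaf and
  its vertical Lipschitz constant is 0.\<close>

lemma C1_stable_baker:
  assumes "\<phi> \<in> C1_stable"
  shows "\<phi> \<circ> T \<in> C1_stable"
proof -
  obtain K where K: "0 \<le> K" "\<And>s t. s \<in> {0..1} \<Longrightarrow> t \<in> {0..1} \<Longrightarrow> \<bar>\<phi> (s, t)\<bar> \<le> K"
    "\<And>s t t'. s \<in> {0..1} \<Longrightarrow> t \<in> {0..1} \<Longrightarrow> t' \<in> {0..1} \<Longrightarrow> \<bar>\<phi> (s, t) - \<phi> (s, t')\<bar> \<le> K * \<bar>t - t'\<bar>"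
    using C1_stableE[OF assms] by blast
  have "T \<in> measurable (restrict_space borel unit_square) (restrict_space borel unit_square)"
    using baker_unit_square
    by (intro measurable_restrict_space2 measurable_restrict_space1 baker_measurable)
      (auto simp: space_restrict_space)
  then have "\<phi> \<circ> T \<in> borel_measurable (restrict_space borel unit_square)"
    using assms unfolding C1_stable_iff by (intro measurable_comp) auto
  moreover have "\<bar>(\<phi> \<circ> T) (s, t)\<bar> \<le> K" if "s \<in> {0..1}" "t \<in> {0..1}" for s t
    using baker_unit_square[of "(s, t)"] K(2)[of "fst (T (s, t))" "snd (T (s, t))"] that
    by (auto simp: unit_square_def)
  moreover have "\<bar>(\<phi> \<circ> T) (s, t) - (\<phi> \<circ> T) (s, t')\<bar> \<le> K * \<bar>t - t'\<bar>" for s t t'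
    using K(1) by (simp add: singular_baker_def)
  ultimately show ?thesis
    unfolding C1_stable_iff using K(1) by (intro conjI exI[of _ K]) auto
qed

text \<open>The operator \<open>f \<mapsto> \<L>\<^sub>0 f\<close> factors through \<open>leaf_mean f\<close>: the density of \<open>\<L>\<^sub>0 f\<close> on the leaf at
  height \<open>h i\<close> is \<open>leaf_mean f \<circ> branch i\<close> divided by \<open>\<kappa>\<close>.\<close>

lemma integral_baker:
  assumes f: "f \<in> C1_unstable" and \<phi>: "\<phi> \<in> C1_stable"
  shows "(LINT p:unit_square|lborel. f p * (\<phi> \<circ> T) p)
    = (LBINT s:{0..1}. (\<Sum>i<\<kappa>. leaf_mean f (branch i s) * \<phi> (s, h i)) / \<kappa>)"
proof -
  \<comment> \<open>Since \<phi> composed with T is constant on stable leaves, the height 0 is an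
    arbitrary choice.\<close>
  define F where "F s = leaf_mean f s * (\<phi> \<circ> T) (s, 0)" for s
  have "bounded_measurable F"
    unfolding F_def using leaf_mean_lipschitz[OF f] C1_stable_horizontal[OF C1_stable_baker[OF \<phi>], of 0]
    by (auto intro!: bounded_measurable_mult intro: lipschitz_bounded_measurable)
  have "leaf_integral f s (\<lambda>t. (\<phi> \<circ> T) (s, t)) = F s" for s
  proof -
    have "(\<lambda>t. (\<phi> \<circ> T) (s, t)) = (\<lambda>t. (\<phi> \<circ> T) (s, 0))" by (simp add: singular_baker_def)
    then show ?thesis by (simp only: leaf_integral_const F_def mult.commute)
  qed
  then have "(LINT p:unit_square|lborel. f p * (\<phi> \<circ> T) p) = (LBINT s:{0..1}. F s)"
    unfolding C1_integral(1)[OF f C1_stable_baker[OF \<phi>]] by simp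
  also have "\<dots> = (\<Sum>i<\<kappa>. LBINT u:{0..1}. F (branch i u)) / \<kappa>"
    by (rule unit_integral_branches) fact
  also have "(\<Sum>i<\<kappa>. LBINT u:{0..1}. F (branch i u))
      = (\<Sum>i<\<kappa>. LBINT u:{0..1}. leaf_mean f (branch i u) * \<phi> (u, h i))"
  proof (intro sum.cong refl)
    fix i assume "i \<in> {..<\<kappa>}"
    then have i: "i < \<kappa>" by simp
    have open_closed: "(LBINT u:{0..1}. G u) = (LBINT u:{0<..<1}. G u)" for G :: "real \<Rightarrow> real"
      by (rule set_integral_discrete_difference[of "{0, 1}"]) auto
    show "(LBINT u:{0..1}. F (branch i u)) = (LBINT u:{0..1}. leaf_mean f (branch i u) * \<phi> (u, h i))"
      unfolding open_closed F_def using i by (intro set_lebesgue_integral_cong) (auto simp: baker_branch)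
  qed
  also have "\<dots> = (LBINT u:{0..1}. \<Sum>i<\<kappa>. leaf_mean f (branch i u) * \<phi> (u, h i))"
    using leaf_mean_lipschitz[OF f]
    by (intro set_integral_sum_bounded[symmetric] bounded_measurable_mult C1_stable_horizontal[OF \<phi>] height)
      (auto intro: lipschitz_bounded_measurable dest: lipschitz_branch)
  finally show ?thesis by simp
qed

text \<open>The Perron-Frobenius operator of the interval map with inverse branches
  \<open>branch i\<close>; the weight 1/\<kappa> is the reciprocal of the slope.\<close>

definition pf :: "(real \<Rightarrow> real) \<Rightarrow> real \<Rightarrow> real" where
  "pf g s = (\<Sum>i<\<kappa>. g (branch i s)) / \<kappa>"

lemma integral_pf:
  assumes "K-lipschitz_on {0..1} g"
  shows "(LBINT s:{0..1}. pf g s) = (LBINT s:{0..1}. g s)"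
proof -
  have "(LBINT s:{0..1}. pf g s) = (LBINT s:{0..1}. \<Sum>i<\<kappa>. g (branch i s)) / \<kappa>"
    by (simp add: pf_def)
  also have "(LBINT s:{0..1}. \<Sum>i<\<kappa>. g (branch i s)) = (\<Sum>i<\<kappa>. LBINT s:{0..1}. g (branch i s))"
    by (intro set_integral_sum_bounded lipschitz_bounded_measurable[OF lipschitz_branch[OF assms]]) auto
  finally show ?thesis
    by (simp add: unit_integral_branches[OF lipschitz_bounded_measurable[OF assms]])
qed

text \<open>Every branch shrinks distances by exactly \<kappa>, and averaging over the branches
  loses nothing. This is the source of the contraction rate.\<close>

lemma pf_holder:
  assumes "\<And>x y. x \<in> {0..1} \<Longrightarrow> y \<in> {0..1} \<Longrightarrow> \<bar>g x - g y\<bar> \<le> H * \<bar>x - y\<bar> powr b"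
    and x: "x \<in> {0..1}" "y \<in> {0..1}"
  shows "\<bar>pf g x - pf g y\<bar> \<le> real \<kappa> powr (- b) * H * \<bar>x - y\<bar> powr b"
proof -
  have "\<bar>g (branch i x) - g (branch i y)\<bar> \<le> real \<kappa> powr (- b) * H * \<bar>x - y\<bar> powr b" if "i < \<kappa>" for i
    using assms(1)[OF branch_in_unit[OF that x(1)] branch_in_unit[OF that x(2)]] kappa
    by (simp add: branch_diff powr_divide powr_minus_divide mult.commute)
  from average_bound[OF this] show ?thesis
    by (simp add: pf_def sum_subtractf diff_divide_distrib)
qed

lemma pf_lipschitz:
  assumes "K-lipschitz_on {0..1} g"
  shows "K-lipschitz_on {0..1} (pf g)"
proof (rule lipschitz_onI)
  fix x y :: real assume x: "x \<in> {0..1}" "y \<in> {0..1}"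
  have "\<bar>g (branch i x) - g (branch i y)\<bar> \<le> K * dist x y" if "i < \<kappa>" for i
    using lipschitz_onD[OF lipschitz_branch[OF assms that] x] by (simp add: dist_real_def)
  from average_bound[OF this] show "dist (pf g x) (pf g y) \<le> K * dist x y"
    by (simp add: pf_def dist_real_def sum_subtractf diff_divide_distrib)
qed (rule lipschitz_on_nonneg[OF assms])

lemma pf_one: "pf (\<lambda>_. 1) s = 1"
  using kappa by (simp add: pf_def)

subsection \<open>Mollified images\<close>

text \<open>A function standing for the measure with density g o \<open>branch i\<close> / \<kappa>
  on the leaf at height \<open>h i\<close>. Only the vertical direction is smeared out, so the
  horizontal Lipschitz regularity of g survives.\<close>

definition approx :: "nat \<Rightarrow> (real \<Rightarrow> real) \<Rightarrow> real \<times> real \<Rightarrow> real" where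
  "approx m g p = (\<Sum>i<\<kappa>. g (branch i (fst p)) * mollifier (h i) (mollifier_width m) (snd p)) / \<kappa>"

text \<open>The substitute for the point value b (h i) when the leaf is thickened.\<close>

definition average_at :: "nat \<Rightarrow> nat \<Rightarrow> (real \<Rightarrow> real) \<Rightarrow> real" where
  "average_at m i b = (LBINT t:{0..1}. mollifier (h i) (mollifier_width m) t * b t)"

lemma average_at_bound:
  assumes "i < \<kappa>" "bounded_measurable b" "\<And>t. t \<in> {0..1} \<Longrightarrow> \<bar>b t\<bar> \<le> B"
  shows "\<bar>average_at m i b\<bar> \<le> B"
  using mollifier_integral_close[OF height[OF assms(1)] mollifier_width[of m] assms(2), of 0 B] assms(3)
  by (simp add: average_at_def)

lemma average_at_close:
  assumes "i < \<kappa>" "0 < a"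
    and b: "\<And>t t'. t \<in> {0..1} \<Longrightarrow> t' \<in> {0..1} \<Longrightarrow> \<bar>b t - b t'\<bar> \<le> H * \<bar>t - t'\<bar> powr a"
  shows "\<bar>average_at m i b - b (h i)\<bar> \<le> H * mollifier_width m powr a"
  unfolding average_at_def
proof (rule mollifier_integral_close[OF height[OF assms(1)] mollifier_width])
  show "bounded_measurable b"
    by (rule bounded_measurable_continuous) (rule holder_continuous_on[OF assms(2) b])
  have "\<bar>b 0 - b 1\<bar> \<le> H" using b[of 0 1] by simp
  then have H: "0 \<le> H" by linarith
  fix t :: real assume t: "t \<in> {0..1}" "\<bar>t - h i\<bar> \<le> mollifier_width m"
  have "\<bar>b t - b (h i)\<bar> \<le> H * \<bar>t - h i\<bar> powr a" using t(1) height[OF assms(1)] by (rule b)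
  also have "\<dots> \<le> H * mollifier_width m powr a"
    using t(2) H assms(2) by (intro mult_left_mono powr_mono2) auto
  finally show "\<bar>b t - b (h i)\<bar> \<le> H * mollifier_width m powr a" .
qed

text \<open>The variables separate: s enters only through g, while the test and m enter only through
  \<open>average_at\<close>. The norm estimates for \<open>approx\<close> all rest on this product
  form.\<close>

lemma leaf_integral_approx:
  assumes "bounded_measurable b"
  shows "leaf_integral (approx m g) s b = (\<Sum>i<\<kappa>. g (branch i s) * average_at m i b) / \<kappa>"
proof -
  have "leaf_integral (approx m g) s b
    = (LBINT t:{0..1}. \<Sum>i<\<kappa>. g (branch i s) / \<kappa> * (mollifier (h i) (mollifier_width m) t * b t))"
    unfolding leaf_integral_def approx_def sum_divide_distrib sum_distrib_right by (simp add: mult.assoc)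
  also have "\<dots> = (\<Sum>i<\<kappa>. LBINT t:{0..1}. g (branch i s) / \<kappa> * (mollifier (h i) (mollifier_width m) t * b t))"
    using assms by (intro set_integral_sum_bounded bounded_measurable_mult bounded_measurable_const
        bounded_measurable_mollifier height mollifier_width) auto
  also have "\<dots> = (\<Sum>i<\<kappa>. g (branch i s) * average_at m i b) / \<kappa>"
    by (simp only: set_integral_mult_right average_at_def sum_divide_distrib) (simp add: mult_ac)
  finally show ?thesis .
qed

text \<open>Exact for every m, not just in the limit, because the mollifiers stay inside the unit
  interval and have mass 1.\<close>

lemma leaf_mean_approx: "leaf_mean (approx m g) s = pf g s"
proof -
  have "average_at m i (\<lambda>_. 1) = 1" if "i < \<kappa>" for i
    using average_at_close[OF that, of 1 "\<lambda>_. 1" 0 m] by simp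
  then show ?thesis by (simp add: leaf_mean_def leaf_integral_approx pf_def)
qed

text \<open>The constants blow up like 1/\<delta> as the thickening shrinks; only membership
  matters. Uniform bounds are those of \<open>approx_bound\<close> and
  \<open>approx_holder\<close>.\<close>

lemma approx_C1_unstable:
  assumes "K-lipschitz_on {0..1} g"
  shows "approx m g \<in> C1_unstable"
proof -
  define \<delta> where "\<delta> = mollifier_width m"
  have \<delta>: "0 < \<delta>" "\<delta> \<le> 1" unfolding \<delta>_def by (rule mollifier_width)+
  have K: "0 \<le> K" by (rule lipschitz_on_nonneg[OF assms])
  obtain G where G: "\<forall>t\<in>{0..1}. \<bar>g t\<bar> \<le> G"
    using lipschitz_bounded_measurable[OF assms] unfolding bounded_measurable_def by blast
  have meas: "approx m g \<in> borel_measurable (restrict_space borel unit_square)"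
    unfolding approx_def[abs_def]
  proof (intro borel_measurable_divide borel_measurable_const borel_measurable_sum borel_measurable_times)
    fix i assume "i \<in> {..<\<kappa>}"
    then have i: "i < \<kappa>" by simp
    have "continuous_on unit_square (\<lambda>p. g (branch i (fst p)))"
      by (rule continuous_on_compose2[OF lipschitz_on_continuous_on[OF lipschitz_branch[OF assms i]]])
        (auto simp: unit_square_def intro!: continuous_intros)
    then show "(\<lambda>p. g (branch i (fst p))) \<in> borel_measurable (restrict_space borel unit_square)"
      by (rule borel_measurable_continuous_on_restrict)
    show "(\<lambda>p. mollifier (h i) (mollifier_width m) (snd p)) \<in> borel_measurable (restrict_space borel unit_square)"
      by (intro measurable_restrict_space1 measurable_compose[OF _ mollifier_measurable[OF height[OF i] mollifier_width]]
        borel_measurable_continuous_onI continuous_intros)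
  qed
  have b1: "\<bar>approx m g (s, t)\<bar> \<le> \<bar>G\<bar> * (1 / \<delta>)" if "s \<in> {0..1}" for s t
    unfolding approx_def fst_conv snd_conv
  proof (rule average_bound)
    fix i assume i: "i < \<kappa>"
    have "\<bar>g (branch i s)\<bar> \<le> \<bar>G\<bar>" using G branch_in_unit[OF i that] by fastforce
    then show "\<bar>g (branch i s) * mollifier (h i) (mollifier_width m) t\<bar> \<le> \<bar>G\<bar> * (1 / \<delta>)"
      unfolding abs_mult using mollifier_bound[OF height[OF i] \<delta>]
      by (intro mult_mono) (auto simp: \<delta>_def)
  qed
  have b2: "\<bar>approx m g (s, t) - approx m g (s', t)\<bar> \<le> K * (1 / \<delta>) * \<bar>s - s'\<bar>"
    if "s \<in> {0..1}" "s' \<in> {0..1}" for s s' t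
  proof -
    have "\<bar>(g (branch i s) - g (branch i s')) * mollifier (h i) (mollifier_width m) t\<bar> \<le> K * \<bar>s - s'\<bar> * (1 / \<delta>)"
      if i: "i < \<kappa>" for i
      unfolding abs_mult using mollifier_bound[OF height[OF i] \<delta>]
        lipschitz_onD[OF lipschitz_branch[OF assms i] \<open>s \<in> {0..1}\<close> \<open>s' \<in> {0..1}\<close>] K
      by (intro mult_mono) (auto simp: \<delta>_def dist_real_def)
    from average_bound[where c = "\<lambda>i. (g (branch i s) - g (branch i s')) * mollifier (h i) (mollifier_width m) t", OF this]
    show ?thesis
      by (simp only: approx_def fst_conv snd_conv left_diff_distrib sum_subtractf diff_divide_distrib)
        (simp only: mult_ac)
  qed
  define M where "M = (\<bar>G\<bar> + K) * (1 / \<delta>)"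
  have M: "0 \<le> M" "\<bar>G\<bar> * (1 / \<delta>) \<le> M" "K * (1 / \<delta>) \<le> M"
    unfolding M_def using \<delta> K by (auto intro!: divide_right_mono)
  show ?thesis
    unfolding C1_unstable_iff
  proof (intro conjI exI[of _ M] ballI meas M(1))
    fix s s' t :: real assume s: "s \<in> {0..1}"
    show "\<bar>approx m g (s, t)\<bar> \<le> M" using b1[OF s] M(2) by (rule order_trans)
    assume s': "s' \<in> {0..1}"
    have "K * (1 / \<delta>) * \<bar>s - s'\<bar> \<le> M * \<bar>s - s'\<bar>" by (intro mult_right_mono M) auto
    then show "\<bar>approx m g (s, t) - approx m g (s', t)\<bar> \<le> M * \<bar>s - s'\<bar>"
      using b2[OF s s', of t] by linarith
  qed
qed

text \<open>Averages of a test against a mass-1 mollifier do not exceed its supremum, so the bound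
  is uniform in m.\<close>

lemma approx_bound:
  assumes G: "\<And>x. x \<in> {0..1} \<Longrightarrow> \<bar>g x\<bar> \<le> G" and s: "s \<in> {0..1}"
    and b: "bounded_measurable b" "\<And>t. t \<in> {0..1} \<Longrightarrow> \<bar>b t\<bar> \<le> 1"
  shows "\<bar>leaf_integral (approx m g) s b\<bar> \<le> G"
  unfolding leaf_integral_approx[OF b(1)]
proof (rule average_bound)
  fix i assume i: "i < \<kappa>"
  have "\<bar>g (branch i s) * average_at m i b\<bar> \<le> G * 1"
    unfolding abs_mult using G[OF branch_in_unit[OF i s]] average_at_bound[OF i b]
    by (intro mult_mono) auto
  then show "\<bar>g (branch i s) * average_at m i b\<bar> \<le> G" by simp
qed

lemma approx_holder:
  assumes g: "\<And>x y. x \<in> {0..1} \<Longrightarrow> y \<in> {0..1} \<Longrightarrow> \<bar>g x - g y\<bar> \<le> H * \<bar>x - y\<bar> powr \<beta>"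
    and s: "s1 \<in> {0..1}" "s2 \<in> {0..1}"
    and b: "bounded_measurable b" "\<And>t. t \<in> {0..1} \<Longrightarrow> \<bar>b t\<bar> \<le> 1"
  shows "\<bar>leaf_integral (approx m g) s1 b - leaf_integral (approx m g) s2 b\<bar>
    \<le> real \<kappa> powr (- \<beta>) * H * \<bar>s1 - s2\<bar> powr \<beta>"
proof -
  have "\<bar>(g (branch i s1) - g (branch i s2)) * average_at m i b\<bar> \<le> real \<kappa> powr (- \<beta>) * H * \<bar>s1 - s2\<bar> powr \<beta>"
    if i: "i < \<kappa>" for i
  proof -
    have "\<bar>g (branch i s1) - g (branch i s2)\<bar> \<le> H * \<bar>branch i s1 - branch i s2\<bar> powr \<beta>"
      using i s by (intro g branch_in_unit)
    moreover from this have "0 \<le> H * \<bar>branch i s1 - branch i s2\<bar> powr \<beta>" by linarith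
    ultimately have "\<bar>(g (branch i s1) - g (branch i s2)) * average_at m i b\<bar>
        \<le> H * \<bar>branch i s1 - branch i s2\<bar> powr \<beta> * 1"
      unfolding abs_mult using average_at_bound[OF i b] by (intro mult_mono) auto
    also have "\<dots> = real \<kappa> powr (- \<beta>) * H * \<bar>s1 - s2\<bar> powr \<beta>"
      by (simp add: branch_diff powr_divide powr_minus_divide)
    finally show ?thesis .
  qed
  from average_bound[where c = "\<lambda>i. (g (branch i s1) - g (branch i s2)) * average_at m i b", OF this]
  show ?thesis
    by (simp only: leaf_integral_approx[OF b(1)] left_diff_distrib sum_subtractf diff_divide_distrib)
qed

text \<open>A Hoelder test varies by at most width powr a over the support of the mollifier; a > 0
  makes this tend to 0.\<close>

lemma approx_diff_bound:
  assumes G: "\<And>x. x \<in> {0..1} \<Longrightarrow> \<bar>g x\<bar> \<le> G" and s: "s \<in> {0..1}" and a: "0 < a"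
    and b: "\<And>t t'. t \<in> {0..1} \<Longrightarrow> t' \<in> {0..1} \<Longrightarrow> \<bar>b t - b t'\<bar> \<le> \<bar>t - t'\<bar> powr a"
  shows "\<bar>leaf_integral (approx m g) s b - leaf_integral (approx n g) s b\<bar>
    \<le> G * (mollifier_width m powr a + mollifier_width n powr a)"
proof -
  have bm: "bounded_measurable b"
    by (rule bounded_measurable_continuous, rule holder_continuous_on[OF a, of _ _ 1]) (use b in auto)
  have "\<bar>g (branch i s) * (average_at m i b - average_at n i b)\<bar>
      \<le> G * (mollifier_width m powr a + mollifier_width n powr a)" if i: "i < \<kappa>" for i
  proof -
    have "\<bar>average_at k i b - b (h i)\<bar> \<le> 1 * mollifier_width k powr a" for k
      by (rule average_at_close[OF i a]) (use b in auto)
    from this[of m] this[of n]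
    have "\<bar>average_at m i b - average_at n i b\<bar> \<le> mollifier_width m powr a + mollifier_width n powr a"
      by linarith
    then show ?thesis
      unfolding abs_mult using G[OF branch_in_unit[OF i s]] by (intro mult_mono) auto
  qed
  from average_bound[where c = "\<lambda>i. g (branch i s) * (average_at m i b - average_at n i b)", OF this]
  show ?thesis
    by (simp only: leaf_integral_approx[OF bm] right_diff_distrib sum_subtractf diff_divide_distrib)
qed

text \<open>In the product form the factor |s1 - s2| comes from g and the small factor from the
  averages, so the two gains multiply. This makes \<open>approx\<close> Cauchy in the unstable norm
  too.\<close>

lemma approx_diff_lipschitz:
  assumes g: "K-lipschitz_on {0..1} g" and s: "s1 \<in> {0..1}" "s2 \<in> {0..1}" and b: "b \<in> lip_tests"
  shows "\<bar>(leaf_integral (approx m g) s1 b - leaf_integral (approx n g) s1 b)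
      - (leaf_integral (approx m g) s2 b - leaf_integral (approx n g) s2 b)\<bar>
    \<le> K * \<bar>s1 - s2\<bar> * (mollifier_width m + mollifier_width n)"
proof -
  have b': "unit_holder_norm 1 b \<le> 1" using b by (simp add: lip_tests_def)
  have "\<bar>(g (branch i s1) - g (branch i s2)) * (average_at m i b - average_at n i b)\<bar>
      \<le> K * \<bar>s1 - s2\<bar> * (mollifier_width m + mollifier_width n)" if i: "i < \<kappa>" for i
  proof -
    have "\<bar>average_at k i b - b (h i)\<bar> \<le> 1 * mollifier_width k powr 1" for k
      by (rule average_at_close[OF i]) (use holder_tests_bound(2)[OF b'] in auto)
    from this[of m] this[of n] mollifier_width(1)[of m] mollifier_width(1)[of n]
    have "\<bar>average_at m i b - average_at n i b\<bar> \<le> mollifier_width m + mollifier_width n" by simp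
    moreover have "\<bar>g (branch i s1) - g (branch i s2)\<bar> \<le> K * \<bar>s1 - s2\<bar>"
      using lipschitz_onD[OF lipschitz_branch[OF g i] s] by (simp add: dist_real_def)
    ultimately show ?thesis
      unfolding abs_mult using lipschitz_on_nonneg[OF g] by (intro mult_mono) auto
  qed
  from average_bound[where c = "\<lambda>i. (g (branch i s1) - g (branch i s2)) * (average_at m i b - average_at n i b)", OF this]
  have *: "\<bar>(\<Sum>i<\<kappa>. (g (branch i s1) - g (branch i s2)) * (average_at m i b - average_at n i b)) / \<kappa>\<bar>
      \<le> K * \<bar>s1 - s2\<bar> * (mollifier_width m + mollifier_width n)" .
  have "(\<Sum>i<\<kappa>. (g (branch i s1) - g (branch i s2)) * (average_at m i b - average_at n i b)) / \<kappa>
      = (leaf_integral (approx m g) s1 b - leaf_integral (approx n g) s1 b)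
      - (leaf_integral (approx m g) s2 b - leaf_integral (approx n g) s2 b)"
    unfolding leaf_integral_approx[OF lip.measurable[OF b]]
    by (simp add: left_diff_distrib right_diff_distrib sum_subtractf diff_divide_distrib)
  with * show ?thesis by simp
qed

lemma weak_norm_approx:
  assumes "\<And>x. x \<in> {0..1} \<Longrightarrow> \<bar>g x\<bar> \<le> G"
  shows "weak_norm (approx m g) \<le> G"
  unfolding weak_norm_eq using lip.measurable lip.bounded
  by (intro lip.test_norm_least approx_bound assms) auto

lemma strong_norm_approx:
  assumes "\<And>x. x \<in> {0..1} \<Longrightarrow> \<bar>g x\<bar> \<le> G"
    and "\<And>x y. x \<in> {0..1} \<Longrightarrow> y \<in> {0..1} \<Longrightarrow> \<bar>g x - g y\<bar> \<le> H * \<bar>x - y\<bar> powr \<beta>"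
    and \<alpha>: "0 < \<alpha>"
  shows "strong_norm \<alpha> \<beta> (approx m g) \<le> G + real \<kappa> powr (- \<beta>) * H"
proof -
  interpret holder: test_class "holder_tests \<alpha>" using \<alpha> by (rule test_class_holder_tests)
  have "strong_stable_norm \<alpha> (approx m g) \<le> G"
    unfolding strong_stable_norm_eq using holder.measurable holder.bounded
    by (intro holder.test_norm_least approx_bound assms) auto
  moreover have "strong_unstable_norm \<beta> (approx m g) \<le> real \<kappa> powr (- \<beta>) * H"
    using lip.measurable lip.bounded
    by (intro strong_unstable_norm_least approx_holder assms) auto
  ultimately show ?thesis by (simp add: strong_norm_def)
qed

lemma strong_norm_approx_diff:
  assumes g: "K-lipschitz_on {0..1} g" and G: "\<And>x. x \<in> {0..1} \<Longrightarrow> \<bar>g x\<bar> \<le> G"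
    and \<alpha>: "0 < \<alpha>" and \<beta>: "\<beta> \<le> 1"
  shows "strong_norm \<alpha> \<beta> (\<lambda>p. approx m g p - approx n g p)
    \<le> G * (mollifier_width m powr \<alpha> + mollifier_width n powr \<alpha>) + K * (mollifier_width m + mollifier_width n)"
proof -
  interpret holder: test_class "holder_tests \<alpha>" using \<alpha> by (rule test_class_holder_tests)
  note V = approx_C1_unstable[OF g]
  have "strong_stable_norm \<alpha> (\<lambda>p. approx m g p - approx n g p)
      \<le> G * (mollifier_width m powr \<alpha> + mollifier_width n powr \<alpha>)"
    unfolding strong_stable_norm_eq
  proof (rule holder.test_norm_least)
    fix s :: real and b assume s: "s \<in> {0..1}" and b: "b \<in> holder_tests \<alpha>"
    have "unit_holder_norm \<alpha> b \<le> 1" using b by (simp add: holder_tests_def)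
    from approx_diff_bound[OF G s \<alpha> holder_tests_bound(2)[OF this]]
    show "\<bar>leaf_integral (\<lambda>p. approx m g p - approx n g p) s b\<bar>
        \<le> G * (mollifier_width m powr \<alpha> + mollifier_width n powr \<alpha>)"
      by (simp add: leaf_integral_diff_left[OF V V s holder.measurable[OF b]])
  qed
  moreover have "strong_unstable_norm \<beta> (\<lambda>p. approx m g p - approx n g p) \<le> K * (mollifier_width m + mollifier_width n)"
  proof (rule strong_unstable_norm_least)
    fix s1 s2 :: real and b assume s: "s1 \<in> {0..1}" "s2 \<in> {0..1}" and b: "b \<in> lip_tests"
    have "\<bar>leaf_integral (\<lambda>p. approx m g p - approx n g p) s1 b - leaf_integral (\<lambda>p. approx m g p - approx n g p) s2 b\<bar>
      \<le> K * \<bar>s1 - s2\<bar> * (mollifier_width m + mollifier_width n)"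
      using approx_diff_lipschitz[OF g s b]
      by (simp add: leaf_integral_diff_left[OF V V s(1) lip.measurable[OF b]]
          leaf_integral_diff_left[OF V V s(2) lip.measurable[OF b]])
    also have "\<dots> = K * (mollifier_width m + mollifier_width n) * \<bar>s1 - s2\<bar> powr 1" by simp
    also have "\<dots> \<le> K * (mollifier_width m + mollifier_width n) * \<bar>s1 - s2\<bar> powr \<beta>"
      using lipschitz_on_nonneg[OF g] mollifier_width(1) s \<beta>
      by (intro mult_left_mono powr_mono' mult_nonneg_nonneg add_nonneg_nonneg less_imp_le[OF mollifier_width(1)]) auto
    finally show "\<bar>leaf_integral (\<lambda>p. approx m g p - approx n g p) s1 b - leaf_integral (\<lambda>p. approx m g p - approx n g p) s2 b\<bar>
      \<le> K * (mollifier_width m + mollifier_width n) * \<bar>s1 - s2\<bar> powr \<beta>" .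
  qed
  ultimately show ?thesis by (simp add: strong_norm_def)
qed

lemma strong_norm_approx_cauchy:
  assumes g: "K-lipschitz_on {0..1} g" and \<alpha>: "0 < \<alpha>" and \<beta>: "\<beta> \<le> 1" and \<epsilon>: "0 < \<epsilon>"
  shows "\<exists>N. \<forall>m\<ge>N. \<forall>n\<ge>N. strong_norm \<alpha> \<beta> (\<lambda>p. approx m g p - approx n g p) < \<epsilon>"
proof -
  obtain G where G: "\<And>t. t \<in> {0..1} \<Longrightarrow> \<bar>g t\<bar> \<le> G"
    using lipschitz_bounded_measurable[OF g] unfolding bounded_measurable_def by blast
  define e where "e m = G * mollifier_width m powr \<alpha> + K * mollifier_width m powr 1" for m
  have "(\<lambda>m. G * mollifier_width m powr \<alpha> + K * mollifier_width m powr 1) \<longlonglongrightarrow> G * 0 + K * 0"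
    using \<alpha> by (intro tendsto_intros mollifier_width_tendsto) auto
  then have "e \<longlonglongrightarrow> 0" by (simp add: e_def[abs_def])
  from LIMSEQ_D[OF this, of "\<epsilon> / 2"] \<epsilon> obtain N where N: "\<And>m. m \<ge> N \<Longrightarrow> \<bar>e m\<bar> < \<epsilon> / 2" by auto
  have "strong_norm \<alpha> \<beta> (\<lambda>p. approx m g p - approx n g p) < \<epsilon>" if "m \<ge> N" "n \<ge> N" for m n
  proof -
    have "strong_norm \<alpha> \<beta> (\<lambda>p. approx m g p - approx n g p) \<le> e m + e n"
      using strong_norm_approx_diff[OF g G \<alpha> \<beta>, of m n] mollifier_width(1)[of m] mollifier_width(1)[of n]
      by (simp add: e_def algebra_simps)
    then show ?thesis using N[OF that(1)] N[OF that(2)] by linarith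
  qed
  then show ?thesis by blast
qed

text \<open>The vertical Lipschitz bound of \<phi> makes the error at each s at most a constant
  times the width. The limit is the expression found in \<open>integral_baker\<close>, which
  identifies the limit of the thickened functions with the image under the operator.\<close>

lemma integral_approx_tendsto:
  assumes g: "K-lipschitz_on {0..1} g" and \<phi>: "\<phi> \<in> C1_stable"
  shows "(\<lambda>m. LINT p:unit_square|lborel. approx m g p * \<phi> p)
    \<longlonglongrightarrow> (LBINT s:{0..1}. (\<Sum>i<\<kappa>. g (branch i s) * \<phi> (s, h i)) / \<kappa>)"
proof -
  obtain G where G: "\<And>t. t \<in> {0..1} \<Longrightarrow> \<bar>g t\<bar> \<le> G"
    using lipschitz_bounded_measurable[OF g] unfolding bounded_measurable_def by blast
  obtain L where L: "0 \<le> L" "\<And>s t. s \<in> {0..1} \<Longrightarrow> t \<in> {0..1} \<Longrightarrow> \<bar>\<phi> (s, t)\<bar> \<le> L"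
    "\<And>s t t'. s \<in> {0..1} \<Longrightarrow> t \<in> {0..1} \<Longrightarrow> t' \<in> {0..1} \<Longrightarrow> \<bar>\<phi> (s, t) - \<phi> (s, t')\<bar> \<le> L * \<bar>t - t'\<bar>"
    using C1_stableE[OF \<phi>] by blast
  define I where "I = (LBINT s:{0..1}. (\<Sum>i<\<kappa>. g (branch i s) * \<phi> (s, h i)) / \<kappa>)"
  have "bounded_measurable (\<lambda>s. \<Sum>i<\<kappa>. g (branch i s) * \<phi> (s, h i))"
    by (intro bounded_measurable_sum bounded_measurable_mult C1_stable_horizontal[OF \<phi>]
        lipschitz_bounded_measurable[OF lipschitz_branch[OF g]] height) auto
  then have int: "set_integrable lborel {0..1} (\<lambda>s. (\<Sum>i<\<kappa>. g (branch i s) * \<phi> (s, h i)) / \<kappa>)"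
    by (intro set_integrable_divide bounded_measurable_integrable)
  have bound: "\<bar>(LINT p:unit_square|lborel. approx m g p * \<phi> p) - I\<bar> \<le> G * L * mollifier_width m powr 1" for m
  proof -
    note V = approx_C1_unstable[OF g, of m]
    have "(LINT p:unit_square|lborel. approx m g p * \<phi> p) - I
      = (LBINT s:{0..1}. leaf_integral (approx m g) s (\<lambda>t. \<phi> (s, t)) - (\<Sum>i<\<kappa>. g (branch i s) * \<phi> (s, h i)) / \<kappa>)"
      unfolding I_def C1_integral(1)[OF V \<phi>] by (intro set_integral_diff(2)[symmetric] C1_integral(2)[OF V \<phi>] int)
    also have "\<bar>\<dots>\<bar> \<le> G * L * mollifier_width m powr 1"
    proof (rule unit_set_integral_bound)
      fix s :: real assume s: "s \<in> {0..1}"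
      have "\<bar>g (branch i s) * (average_at m i (\<lambda>t. \<phi> (s, t)) - \<phi> (s, h i))\<bar> \<le> G * (L * mollifier_width m powr 1)"
        if i: "i < \<kappa>" for i
      proof -
        have "\<bar>average_at m i (\<lambda>t. \<phi> (s, t)) - \<phi> (s, h i)\<bar> \<le> L * mollifier_width m powr 1"
          by (rule average_at_close[OF i, of 1 "\<lambda>t. \<phi> (s, t)"]) (use L(3)[OF s] in auto)
        then show ?thesis
          unfolding abs_mult using G[OF branch_in_unit[OF i s]] by (intro mult_mono) auto
      qed
      from average_bound[where c = "\<lambda>i. g (branch i s) * (average_at m i (\<lambda>t. \<phi> (s, t)) - \<phi> (s, h i))", OF this]
      show "\<bar>leaf_integral (approx m g) s (\<lambda>t. \<phi> (s, t)) - (\<Sum>i<\<kappa>. g (branch i s) * \<phi> (s, h i)) / \<kappa>\<bar>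
          \<le> G * L * mollifier_width m powr 1"
        by (simp only: leaf_integral_approx[OF C1_stable_vertical[OF \<phi> s]] right_diff_distrib sum_subtractf
            diff_divide_distrib mult.assoc)
    qed
    finally show ?thesis .
  qed
  have "(\<lambda>m. G * L * mollifier_width m powr 1) \<longlonglongrightarrow> G * L * 0"
    by (intro tendsto_intros mollifier_width_tendsto) auto
  then have lim: "(\<lambda>m. G * L * mollifier_width m powr 1) \<longlonglongrightarrow> 0" by (simp only: mult_zero_right)
  have "(\<lambda>m. (LINT p:unit_square|lborel. approx m g p * \<phi> p) - I) \<longlonglongrightarrow> 0"
    by (rule Lim_null_comparison[OF always_eventually lim]) (use bound in \<open>simp only: real_norm_def simp_thms\<close>)
  then show ?thesis unfolding I_def[symmetric] by (rule LIM_zero_cancel)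
qed

end

section \<open>The transfer operator on a completion\<close>

text \<open>Treats the weak and the strong completion at once: these are the only properties of the
  norm \<open>p\<close> needed to construct the operator. \<open>C\<close> becomes a bound for its
  norm, and both instances take \<open>C = 1\<close>.\<close>

locale baker_completion = baker \<kappa> h flip
  for \<kappa> :: nat and h :: "nat \<Rightarrow> real" and flip :: "nat \<Rightarrow> bool" +
  fixes p :: "(real \<times> real \<Rightarrow> real) \<Rightarrow> real" and E :: "(real \<times> real \<Rightarrow> real) \<Rightarrow> 'b::banach" and C :: real
  assumes completion: "is_completion C1_unstable p E"
    and weak_le: "\<And>f. f \<in> C1_unstable \<Longrightarrow> weak_norm f \<le> p f"
    and closable: "closable p"
    and approx_cauchy: "\<And>K g \<epsilon>. K-lipschitz_on {0..1} g \<Longrightarrow> 0 < \<epsilon> \<Longrightarrow>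
      \<exists>N. \<forall>m\<ge>N. \<forall>n\<ge>N. p (\<lambda>q. approx m g q - approx n g q) < \<epsilon>"
    and approx_norm: "\<And>f m. f \<in> C1_unstable \<Longrightarrow> p (approx m (leaf_mean f)) \<le> C * p f"
begin

section \<open>The pairing on the completion\<close>

lemma E_add: "f \<in> C1_unstable \<Longrightarrow> g \<in> C1_unstable \<Longrightarrow> E (\<lambda>x. f x + g x) = E f + E g"
  using completion unfolding is_completion_def by blast

lemma E_scale: "f \<in> C1_unstable \<Longrightarrow> E (\<lambda>x. c * f x) = c *\<^sub>R E f"
  using completion unfolding is_completion_def by blast

lemma norm_E: "f \<in> C1_unstable \<Longrightarrow> norm (E f) = p f"
  using completion unfolding is_completion_def by blast

lemma E_diff:
  assumes "f \<in> C1_unstable" "g \<in> C1_unstable"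
  shows "E (\<lambda>x. f x - g x) = E f - E g"
  using E_add[OF assms(1) C1_unstable_scale[OF assms(2), of "-1"]] E_scale[OF assms(2), of "-1"] by simp

lemma approximating_sequence:
  obtains f :: "nat \<Rightarrow> real \<times> real \<Rightarrow> real" where "\<And>n. f n \<in> C1_unstable" "(\<lambda>n. E (f n)) \<longlonglongrightarrow> x"
proof -
  have "x \<in> closure (E ` C1_unstable)" using completion unfolding is_completion_def by simp
  then obtain y where y: "\<forall>n. y n \<in> E ` C1_unstable" "y \<longlonglongrightarrow> x" unfolding closure_sequential by blast
  then have "\<forall>n. \<exists>f. f \<in> C1_unstable \<and> y n = E f" by blast
  then obtain f where f: "\<And>n. f n \<in> C1_unstable" "\<And>n. y n = E (f n)" by metis
  from y(2) have "(\<lambda>n. E (f n)) \<longlonglongrightarrow> x" by (simp add: f(2)[symmetric])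
  with f(1) show thesis by (rule that)
qed

lemma integral_le_norm:
  assumes "\<phi> \<in> C1_stable"
  obtains K where "0 \<le> K" "\<And>f. f \<in> C1_unstable \<Longrightarrow> \<bar>LINT q:unit_square|lborel. f q * \<phi> q\<bar> \<le> K * norm (E f)"
proof -
  obtain K where K: "0 \<le> K" "\<forall>f\<in>C1_unstable. \<bar>LINT q:unit_square|lborel. f q * \<phi> q\<bar> \<le> K * weak_norm f"
    using C1_integral_le_weak_norm[OF assms] by blast
  have "\<bar>LINT q:unit_square|lborel. f q * \<phi> q\<bar> \<le> K * norm (E f)" if f: "f \<in> C1_unstable" for f
  proof -
    have "K * weak_norm f \<le> K * norm (E f)" using weak_le[OF f] K(1) by (simp add: norm_E f mult_left_mono)
    then show ?thesis using K(2) f by fastforce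
  qed
  with K(1) show thesis by (rule that)
qed

text \<open>This justifies the \<open>THE\<close> in \<open>pairing\<close>: integrals are
  controlled by the norm, hence Cauchy along any approximating sequence, with a limit that does not
  depend on the sequence.\<close>

lemma pairing_tendsto:
  assumes \<phi>: "\<phi> \<in> C1_stable" and f: "\<And>n. f n \<in> C1_unstable" and lim: "(\<lambda>n. E (f n)) \<longlonglongrightarrow> x"
  shows "(\<lambda>n. LINT q:unit_square|lborel. f n q * \<phi> q) \<longlonglongrightarrow> pairing E x \<phi>"
proof -
  let ?I = "\<lambda>f. LINT q:unit_square|lborel. f q * \<phi> q"
  obtain K where K: "0 \<le> K" "\<And>f. f \<in> C1_unstable \<Longrightarrow> \<bar>?I f\<bar> \<le> K * norm (E f)"
    using integral_le_norm[OF \<phi>] by blast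
  have diff: "\<bar>?I f - ?I g\<bar> \<le> K * norm (E f - E g)" if "f \<in> C1_unstable" "g \<in> C1_unstable" for f g
    using K(2)[OF C1_unstable_diff[OF that]] by (simp only: C1_integral_diff[OF that \<phi>] E_diff[OF that])
  have "Cauchy (\<lambda>n. ?I (f n))"
  proof (rule CauchyI)
    fix e :: real assume e: "0 < e"
    have "Cauchy (\<lambda>n. E (f n))" using lim by (intro convergent_Cauchy convergentI)
    from CauchyD[OF this, of "e / (K + 1)"] K(1) e obtain M
      where M: "\<And>m n. m \<ge> M \<Longrightarrow> n \<ge> M \<Longrightarrow> norm (E (f m) - E (f n)) < e / (K + 1)" by auto
    have "norm (?I (f m) - ?I (f n)) < e" if "m \<ge> M" "n \<ge> M" for m n
    proof -
      have "norm (?I (f m) - ?I (f n)) \<le> (K + 1) * norm (E (f m) - E (f n))"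
        using diff[OF f f, of m n] by (simp add: distrib_right add_increasing2)
      also have "\<dots> < (K + 1) * (e / (K + 1))"
        using M[OF that] K(1) by (intro mult_strict_left_mono) auto
      finally show ?thesis using K(1) by simp
    qed
    then show "\<exists>M. \<forall>m\<ge>M. \<forall>n\<ge>M. norm (?I (f m) - ?I (f n)) < e" by blast
  qed
  then obtain c where c: "(\<lambda>n. ?I (f n)) \<longlonglongrightarrow> c" using Cauchy_convergent convergent_def by blast
  have c': "(\<lambda>n. ?I (g n)) \<longlonglongrightarrow> c" if g: "\<And>n. g n \<in> C1_unstable" and "(\<lambda>n. E (g n)) \<longlonglongrightarrow> x" for g
  proof -
    have "(\<lambda>n. K * norm (E (g n) - E (f n))) \<longlonglongrightarrow> K * norm (x - x)"
      by (intro tendsto_intros that lim)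
    then have z: "(\<lambda>n. K * norm (E (g n) - E (f n))) \<longlonglongrightarrow> 0" by simp
    have "(\<lambda>n. ?I (g n) - ?I (f n)) \<longlonglongrightarrow> 0"
      by (rule Lim_null_comparison[OF always_eventually z]) (simp only: real_norm_def diff[OF g f] simp_thms)
    from tendsto_add[OF this c] show ?thesis by simp
  qed
  have "pairing E x \<phi> = c"
    unfolding pairing_def
  proof (rule the_equality)
    show "\<forall>g. (\<forall>n. g n \<in> C1_unstable) \<and> (\<lambda>n. E (g n)) \<longlonglongrightarrow> x \<longrightarrow> (\<lambda>n. ?I (g n)) \<longlonglongrightarrow> c"
      using c' by simp
    fix d assume "\<forall>g. (\<forall>n. g n \<in> C1_unstable) \<and> (\<lambda>n. E (g n)) \<longlonglongrightarrow> x \<longrightarrow> (\<lambda>n. ?I (g n)) \<longlonglongrightarrow> d"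
    then have "(\<lambda>n. ?I (f n)) \<longlonglongrightarrow> d" using f lim by simp
    then show "d = c" using c by (rule LIMSEQ_unique)
  qed
  with c show ?thesis by simp
qed

lemma pairing_E:
  assumes "\<phi> \<in> C1_stable" "f \<in> C1_unstable"
  shows "pairing E (E f) \<phi> = (LINT q:unit_square|lborel. f q * \<phi> q)"
  using pairing_tendsto[OF assms(1), of "\<lambda>_. f" "E f"] assms(2) by (simp add: LIMSEQ_const_iff)

lemma bounded_linear_pairing:
  assumes \<phi>: "\<phi> \<in> C1_stable"
  shows "bounded_linear (\<lambda>x. pairing E x \<phi>)"
proof -
  obtain K where K: "0 \<le> K" "\<And>f. f \<in> C1_unstable \<Longrightarrow> \<bar>LINT q:unit_square|lborel. f q * \<phi> q\<bar> \<le> K * norm (E f)"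
    using integral_le_norm[OF \<phi>] by blast
  show ?thesis
  proof (rule bounded_linear_intro[where K = K])
    fix x y :: 'b and r :: real
    obtain f where f: "\<And>n. f n \<in> C1_unstable" "(\<lambda>n. E (f n)) \<longlonglongrightarrow> x" using approximating_sequence by blast
    obtain g where g: "\<And>n. g n \<in> C1_unstable" "(\<lambda>n. E (g n)) \<longlonglongrightarrow> y" using approximating_sequence by blast
    note pf = pairing_tendsto[OF \<phi> f] and pg = pairing_tendsto[OF \<phi> g]
    have "(\<lambda>n. E (\<lambda>q. f n q + g n q)) \<longlonglongrightarrow> x + y"
      using tendsto_add[OF f(2) g(2)] by (simp add: E_add f g)
    from pairing_tendsto[OF \<phi> C1_unstable_add[OF f(1) g(1)] this]
    have "(\<lambda>n. (LINT q:unit_square|lborel. f n q * \<phi> q) + (LINT q:unit_square|lborel. g n q * \<phi> q))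
        \<longlonglongrightarrow> pairing E (x + y) \<phi>" by (simp only: C1_integral_add[OF f(1) g(1) \<phi>])
    then show "pairing E (x + y) \<phi> = pairing E x \<phi> + pairing E y \<phi>"
      using tendsto_add[OF pf pg] by (rule LIMSEQ_unique)
    have "(\<lambda>n. E (\<lambda>q. r * f n q)) \<longlonglongrightarrow> r *\<^sub>R x"
      using tendsto_scaleR[OF tendsto_const f(2)] by (simp add: E_scale f)
    from pairing_tendsto[OF \<phi> C1_unstable_scale[OF f(1)] this]
    have "(\<lambda>n. r * (LINT q:unit_square|lborel. f n q * \<phi> q)) \<longlonglongrightarrow> pairing E (r *\<^sub>R x) \<phi>"
      by (simp only: mult.assoc set_integral_mult_right)
    then show "pairing E (r *\<^sub>R x) \<phi> = r *\<^sub>R pairing E x \<phi>"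
      using tendsto_mult[OF tendsto_const pf] unfolding real_scaleR_def by (rule LIMSEQ_unique)
    have "norm (pairing E x \<phi>) \<le> K * norm x"
    proof (rule LIMSEQ_le)
      show "(\<lambda>n. norm (LINT q:unit_square|lborel. f n q * \<phi> q)) \<longlonglongrightarrow> norm (pairing E x \<phi>)"
        by (rule tendsto_norm[OF pf])
      show "(\<lambda>n. K * norm (E (f n))) \<longlonglongrightarrow> K * norm x"
        by (intro tendsto_intros f)
      show "\<exists>N. \<forall>n\<ge>N. norm (LINT q:unit_square|lborel. f n q * \<phi> q) \<le> K * norm (E (f n))"
        using K(2)[OF f(1)] by simp
    qed
    then show "norm (pairing E x \<phi>) \<le> norm x * K" by (simp add: mult.commute)
  qed
qed

lemma pairing_diff: "\<phi> \<in> C1_stable \<Longrightarrow> pairing E (x - y) \<phi> = pairing E x \<phi> - pairing E y \<phi>"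
  using linear_diff[OF bounded_linear.linear[OF bounded_linear_pairing]] by blast

text \<open>Functions approximating x - y are Cauchy in norm and tend weakly to 0, so closability
  forces their norms to 0.\<close>

lemma pairing_injective:
  assumes "\<And>\<phi>. \<phi> \<in> C1_stable \<Longrightarrow> pairing E x \<phi> = pairing E y \<phi>"
  shows "x = y"
proof -
  obtain f where f: "\<And>n. f n \<in> C1_unstable" "(\<lambda>n. E (f n)) \<longlonglongrightarrow> x - y" using approximating_sequence by blast
  have "(\<lambda>n. p (f n)) \<longlonglongrightarrow> 0"
  proof (rule closableD[OF closable f(1)])
    show "\<forall>\<epsilon>>0. \<exists>N. \<forall>m\<ge>N. \<forall>n\<ge>N. p (\<lambda>x. f m x - f n x) < \<epsilon>"
    proof (intro allI impI)
      fix e :: real assume e: "0 < e"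
      have "Cauchy (\<lambda>n. E (f n))" using f(2) by (intro convergent_Cauchy convergentI)
      from CauchyD[OF this e] show "\<exists>N. \<forall>m\<ge>N. \<forall>n\<ge>N. p (\<lambda>x. f m x - f n x) < e"
        by (simp add: E_diff[OF f(1) f(1), symmetric] norm_E C1_unstable_diff f(1))
    qed
    show "(\<lambda>n. LINT q:unit_square|lborel. f n q * \<phi> q) \<longlonglongrightarrow> 0" if \<phi>: "\<phi> \<in> C1_stable" for \<phi>
      using pairing_tendsto[OF \<phi> f] by (simp add: pairing_diff[OF \<phi>] assms[OF \<phi>])
  qed
  then have "(\<lambda>n. norm (E (f n))) \<longlonglongrightarrow> 0" by (simp add: norm_E f(1))
  then have "norm (x - y) = 0" using tendsto_norm[OF f(2)] LIMSEQ_unique by blast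
  then show ?thesis by simp
qed

text \<open>\<open>leafwise g\<close> is the measure \<open>\<kappa>\<^sup>-\<^sup>1 \<Sum>\<^sub>i (g \<circ> branch i) \<delta>\<^bsub>U\<^sub>i\<^esub>\<close> as an element of the completion.\<close>

definition leafwise :: "(real \<Rightarrow> real) \<Rightarrow> 'b" where
  "leafwise g = lim (\<lambda>m. E (approx m g))"

lemma leafwise_tendsto:
  assumes g: "K-lipschitz_on {0..1} g"
  shows "(\<lambda>m. E (approx m g)) \<longlonglongrightarrow> leafwise g"
proof -
  have "Cauchy (\<lambda>m. E (approx m g))"
  proof (rule CauchyI)
    fix e :: real assume "0 < e"
    from approx_cauchy[OF g this] show "\<exists>M. \<forall>m\<ge>M. \<forall>n\<ge>M. norm (E (approx m g) - E (approx n g)) < e"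
      using approx_C1_unstable[OF g] by (simp add: E_diff[symmetric] norm_E C1_unstable_diff)
  qed
  then show ?thesis unfolding leafwise_def by (simp add: Cauchy_convergent convergent_LIMSEQ_iff[symmetric])
qed

lemma pairing_leafwise:
  assumes "K-lipschitz_on {0..1} g" "\<phi> \<in> C1_stable"
  shows "pairing E (leafwise g) \<phi> = (LBINT s:{0..1}. (\<Sum>i<\<kappa>. g (branch i s) * \<phi> (s, h i)) / \<kappa>)"
  using pairing_tendsto[OF assms(2) approx_C1_unstable[OF assms(1)] leafwise_tendsto[OF assms(1)]]
    integral_approx_tendsto[OF assms] by (rule LIMSEQ_unique)

lemma norm_leafwise_le:
  assumes "K-lipschitz_on {0..1} g" "\<And>m. p (approx m g) \<le> B"
  shows "norm (leafwise g) \<le> B"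
proof (rule LIMSEQ_le_const2[OF tendsto_norm[OF leafwise_tendsto[OF assms(1)]]])
  show "\<exists>N. \<forall>n\<ge>N. norm (E (approx n g)) \<le> B"
    using assms(2) by (simp add: norm_E approx_C1_unstable[OF assms(1)])
qed

lemma transfer_image_unique:
  assumes "transfer_image E T x y" "transfer_image E T x z"
  shows "y = z"
  using assms unfolding transfer_image_def by (intro pairing_injective) simp

lemma transfer_image_add:
  assumes "transfer_image E T x y" "transfer_image E T x' y'"
  shows "transfer_image E T (x + x') (y + y')"
  using assms C1_stable_baker unfolding transfer_image_def
  by (simp add: linear_add[OF bounded_linear.linear[OF bounded_linear_pairing]])

lemma transfer_image_scale:
  assumes "transfer_image E T x y"
  shows "transfer_image E T (r *\<^sub>R x) (r *\<^sub>R y)"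
  using assms C1_stable_baker unfolding transfer_image_def
  by (simp add: linear_scale[OF bounded_linear.linear[OF bounded_linear_pairing]])

lemma transfer_image_diff:
  assumes "transfer_image E T x y" "transfer_image E T x' y'"
  shows "transfer_image E T (x - x') (y - y')"
  using assms C1_stable_baker unfolding transfer_image_def by (simp add: pairing_diff)

text \<open>Both pairings are the same integral over the leaves at heights \<open>h i\<close>,
  computed on one side by thickening and on the other by the change of variables.\<close>

lemma transfer_image_E:
  assumes f: "f \<in> C1_unstable"
  shows "transfer_image E T (E f) (leafwise (leaf_mean f))"
  unfolding transfer_image_def
proof
  fix \<phi> assume \<phi>: "\<phi> \<in> C1_stable"
  obtain K where "K-lipschitz_on {0..1} (leaf_mean f)" using leaf_mean_lipschitz[OF f] by blast
  from pairing_leafwise[OF this \<phi>]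
  show "pairing E (leafwise (leaf_mean f)) \<phi> = pairing E (E f) (\<phi> \<circ> T)"
    unfolding pairing_E[OF C1_stable_baker[OF \<phi>] f] integral_baker[OF f \<phi>] .
qed

lemma norm_leafwise_leaf_mean:
  assumes "f \<in> C1_unstable"
  shows "norm (leafwise (leaf_mean f)) \<le> C * norm (E f)"
proof -
  obtain K where "K-lipschitz_on {0..1} (leaf_mean f)" using leaf_mean_lipschitz[OF assms] by blast
  then show ?thesis using approx_norm[OF assms] by (intro norm_leafwise_le) (simp_all add: norm_E[OF assms])
qed

text \<open>Extension by density from functions, using the bound on the thickened images and the
  continuity of both pairings.\<close>

lemma transfer_image_exists: "\<exists>y. transfer_image E T x y \<and> norm y \<le> C * norm x"
proof -
  obtain f where f: "\<And>n. f n \<in> C1_unstable" "(\<lambda>n. E (f n)) \<longlonglongrightarrow> x" using approximating_sequence by blast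
  define y where "y n = leafwise (leaf_mean (f n))" for n
  \<comment> \<open>Additivity of f \<mapsto> \<open>leafwise (leaf_mean f)\<close> is not computed
    from the limit: both sides are transfer images of the same element, hence equal.\<close>
  have dy: "norm (y m - y n) \<le> \<bar>C\<bar> * norm (E (f m) - E (f n))" for m n
  proof -
    have "transfer_image E T (E (f m) - E (f n)) (y m - y n)"
      unfolding y_def by (intro transfer_image_diff transfer_image_E f)
    moreover have "transfer_image E T (E (f m) - E (f n)) (leafwise (leaf_mean (\<lambda>q. f m q - f n q)))"
      using transfer_image_E[OF C1_unstable_diff[OF f(1) f(1)], of m n] by (simp add: E_diff f(1))
    ultimately have "y m - y n = leafwise (leaf_mean (\<lambda>q. f m q - f n q))" by (rule transfer_image_unique)
    then have "norm (y m - y n) \<le> C * norm (E (f m) - E (f n))"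
      using norm_leafwise_leaf_mean[OF C1_unstable_diff[OF f(1) f(1)], of m n] by (simp add: E_diff f(1))
    also have "\<dots> \<le> \<bar>C\<bar> * norm (E (f m) - E (f n))" by (intro mult_right_mono) auto
    finally show ?thesis .
  qed
  have "Cauchy y"
  proof (rule CauchyI)
    fix e :: real assume e: "0 < e"
    have "Cauchy (\<lambda>n. E (f n))" using f(2) by (intro convergent_Cauchy convergentI)
    from CauchyD[OF this, of "e / (\<bar>C\<bar> + 1)"] e obtain M
      where M: "\<And>m n. m \<ge> M \<Longrightarrow> n \<ge> M \<Longrightarrow> norm (E (f m) - E (f n)) < e / (\<bar>C\<bar> + 1)"
      by (auto simp: add_pos_nonneg)
    have "norm (y m - y n) < e" if "m \<ge> M" "n \<ge> M" for m n
    proof -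
      have "norm (y m - y n) \<le> (\<bar>C\<bar> + 1) * norm (E (f m) - E (f n))"
        using dy[of m n] by (simp add: distrib_right add_increasing2)
      also have "\<dots> < (\<bar>C\<bar> + 1) * (e / (\<bar>C\<bar> + 1))"
        using M[OF that] by (intro mult_strict_left_mono) auto
      finally show ?thesis by simp
    qed
    then show "\<exists>M. \<forall>m\<ge>M. \<forall>n\<ge>M. norm (y m - y n) < e" by blast
  qed
  then obtain z where z: "y \<longlonglongrightarrow> z" using Cauchy_convergent convergent_def by blast
  have "pairing E z \<phi> = pairing E x (\<phi> \<circ> T)" if \<phi>: "\<phi> \<in> C1_stable" for \<phi>
  proof -
    have "(\<lambda>n. pairing E (y n) \<phi>) \<longlonglongrightarrow> pairing E z \<phi>"
      by (rule bounded_linear.tendsto[OF bounded_linear_pairing[OF \<phi>] z])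
    moreover have "pairing E (y n) \<phi> = pairing E (E (f n)) (\<phi> \<circ> T)" for n
      using transfer_image_E[OF f(1)[of n]] \<phi> unfolding transfer_image_def y_def by blast
    ultimately have "(\<lambda>n. pairing E (E (f n)) (\<phi> \<circ> T)) \<longlonglongrightarrow> pairing E z \<phi>" by simp
    moreover have "(\<lambda>n. pairing E (E (f n)) (\<phi> \<circ> T)) \<longlonglongrightarrow> pairing E x (\<phi> \<circ> T)"
      by (rule bounded_linear.tendsto[OF bounded_linear_pairing[OF C1_stable_baker[OF \<phi>]] f(2)])
    ultimately show ?thesis by (rule LIMSEQ_unique)
  qed
  then have "transfer_image E T x z" unfolding transfer_image_def by blast
  moreover have "norm z \<le> C * norm x"
  proof (rule LIMSEQ_le[OF tendsto_norm[OF z]])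
    show "(\<lambda>n. C * norm (E (f n))) \<longlonglongrightarrow> C * norm x" by (intro tendsto_intros f)
    show "\<exists>N. \<forall>n\<ge>N. norm (y n) \<le> C * norm (E (f n))"
      using norm_leafwise_leaf_mean f(1) by (simp add: y_def)
  qed
  ultimately show ?thesis by blast
qed

lemma transfer_image_ex1: "\<exists>!y. transfer_image E T x y"
  using transfer_image_exists transfer_image_unique by blast

section \<open>The transfer operator, its iterates and its invariant measure\<close>

definition L :: "'b \<Rightarrow> 'b" where
  "L = transfer_operator E T"

lemma transfer_image_L: "transfer_image E T x (L x)"
  unfolding L_def transfer_operator_def using transfer_image_ex1 by (rule theI')

lemma L_eqI: "transfer_image E T x y \<Longrightarrow> L x = y"
  using transfer_image_L transfer_image_unique by blast

lemma bounded_linear_L: "bounded_linear L"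
proof (rule bounded_linear_intro[where K = C])
  show "L (x + y) = L x + L y" for x y by (intro L_eqI transfer_image_add transfer_image_L)
  show "L (r *\<^sub>R x) = r *\<^sub>R L x" for r x by (intro L_eqI transfer_image_scale transfer_image_L)
  show "norm (L x) \<le> norm x * C" for x
    using transfer_image_exists[of x] L_eqI[of x] by (auto simp: mult.commute)
qed

lemma L_E: "f \<in> C1_unstable \<Longrightarrow> L (E f) = leafwise (leaf_mean f)"
  by (intro L_eqI transfer_image_E)

text \<open>By exactness of \<open>leaf_mean_approx\<close>, L takes the same value on all the
  approximants, so the limit is immediate.\<close>

lemma L_leafwise:
  assumes "K-lipschitz_on {0..1} g"
  shows "L (leafwise g) = leafwise (pf g)"
proof -
  have "(\<lambda>m. L (E (approx m g))) \<longlonglongrightarrow> L (leafwise g)"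
    by (rule bounded_linear.tendsto[OF bounded_linear_L leafwise_tendsto[OF assms]])
  moreover have "leaf_mean (approx m g) = pf g" for m by (rule ext) (rule leaf_mean_approx)
  ultimately show ?thesis by (simp add: L_E[OF approx_C1_unstable[OF assms]] LIMSEQ_const_iff)
qed

lemma pf_pow_lipschitz: "K-lipschitz_on {0..1} g \<Longrightarrow> K-lipschitz_on {0..1} ((pf ^^ n) g)"
  by (induction n) (auto intro: pf_lipschitz)

text \<open>The exponents differ by one: the first application replaces f by its leaf mean, and only
  the others act through \<open>pf\<close>.\<close>

lemma L_pow_E:
  assumes "f \<in> C1_unstable"
  shows "(L ^^ Suc n) (E f) = leafwise ((pf ^^ n) (leaf_mean f))"
proof -
  obtain K where K: "K-lipschitz_on {0..1} (leaf_mean f)" using leaf_mean_lipschitz[OF assms] by blast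
  show ?thesis
    by (induction n) (simp_all add: L_E assms L_leafwise[OF pf_pow_lipschitz[OF K]])
qed

abbreviation mass :: "'b \<Rightarrow> real" where
  "mass x \<equiv> pairing E x (\<lambda>_. 1)"

lemma mass_L: "mass (L x) = mass x"
  using transfer_image_L[of x] unfolding transfer_image_def by (simp add: o_def)

lemma mass_E: "f \<in> C1_unstable \<Longrightarrow> mass (E f) = (LBINT s:{0..1}. leaf_mean f s)"
  unfolding pairing_E[OF C1_stable_const] by (subst C1_integral(1)) (simp_all add: leaf_mean_def[abs_def])

text \<open>The constant density 1 is fixed by \<open>pf\<close>, so it yields the invariant
  measure.\<close>

definition \<mu> :: 'b where
  "\<mu> = leafwise (\<lambda>_. 1)"

lemma const_lipschitz: "0-lipschitz_on {0..1} (\<lambda>_::real. c::real)"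
  by (auto intro: lipschitz_onI)

lemma L_mu: "L \<mu> = \<mu>"
  unfolding \<mu>_def L_leafwise[OF const_lipschitz] by (rule arg_cong[where f = leafwise]) (auto simp: pf_one)

lemma pairing_mu:
  assumes "\<phi> \<in> C1_stable"
  shows "pairing E \<mu> \<phi> = (\<Sum>i<\<kappa>. unstable_integral (h i) \<phi>) / real \<kappa>"
proof -
  have "(LBINT s:{0..1}. \<Sum>i<\<kappa>. \<phi> (s, h i)) = (\<Sum>i<\<kappa>. unstable_integral (h i) \<phi>)"
    unfolding unstable_integral_def
    by (intro set_integral_sum_bounded C1_stable_horizontal[OF assms] height) auto
  then show ?thesis unfolding \<mu>_def pairing_leafwise[OF const_lipschitz assms] by simp
qed

lemma mass_mu: "mass \<mu> = 1"
  using kappa by (simp add: pairing_mu unstable_integral_def set_lebesgue_integral_def)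

text \<open>\<open>\<mu>\<close> is the image of Lebesgue measure on the square under \<open>T\<close>.\<close>

lemma is_probability_measure_mu: "is_probability_measure E \<mu>"
proof -
  let ?M = "restrict_space lborel unit_square" and ?N = "restrict_space borel unit_square"
  have square: "unit_square = cbox (0, 0) (1, 1)" by (auto simp: unit_square_def cbox_Pair_eq)
  have "emeasure lborel unit_square = 1"
    unfolding square emeasure_lborel_cbox_eq by (simp add: Basis_prod_def)
  then interpret M: prob_space ?M
    by (intro prob_spaceI) (simp add: space_restrict_space emeasure_restrict_space)
  have T: "T \<in> measurable ?M ?N"
    using baker_unit_square
    by (intro measurable_restrict_space2 measurable_restrict_space1)
      (auto simp: space_restrict_space baker_measurable)
  have "pairing E \<mu> \<phi> = (LINT q|distr ?M ?N T. \<phi> q)" if \<phi>: "\<phi> \<in> C1_stable" for \<phi>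
  proof -
    have "(LINT q|distr ?M ?N T. \<phi> q) = (LINT q:unit_square|lborel. 1 * (\<phi> \<circ> T) q)"
      using \<phi> by (subst integral_distr[OF T])
        (auto simp: C1_stable_iff integral_restrict_space set_lebesgue_integral_def)
    also have "\<dots> = (LBINT s:{0..1}. (\<Sum>i<\<kappa>. leaf_mean (\<lambda>_. 1) (branch i s) * \<phi> (s, h i)) / \<kappa>)"
      by (rule integral_baker[OF C1_unstable_const \<phi>])
    also have "leaf_mean (\<lambda>_. 1) = (\<lambda>_. 1)"
      by (rule ext) (simp add: leaf_mean_def leaf_integral_def set_lebesgue_integral_def)
    finally show ?thesis unfolding \<mu>_def pairing_leafwise[OF const_lipschitz \<phi>] by simp
  qed
  then show ?thesis
    unfolding is_probability_measure_def using M.prob_space_distr[OF T] by (intro exI[of _ "distr ?M ?N T"]) auto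
qed

lemma mass_probability_measure: "is_probability_measure E \<nu> \<Longrightarrow> mass \<nu> = 1"
  unfolding is_probability_measure_def by (auto simp: prob_space.prob_space)

end

section \<open>From the norms to leaf means, and decay on elements of mass zero\<close>

lemma leaf_mean_le_weak_norm:
  assumes "f \<in> C1_unstable" "s \<in> {0..1}"
  shows "\<bar>leaf_mean f s\<bar> \<le> weak_norm f"
  unfolding leaf_mean_def weak_norm_eq by (intro lip.test_norm_upper assms lip_tests_one)

lemma leaf_mean_le_strong_stable_norm:
  assumes "f \<in> C1_unstable" "s \<in> {0..1}" "0 < \<alpha>"
  shows "\<bar>leaf_mean f s\<bar> \<le> strong_stable_norm \<alpha> f"
proof -
  interpret holder: test_class "holder_tests \<alpha>" using assms(3) by (rule test_class_holder_tests)
  show ?thesis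
    unfolding leaf_mean_def strong_stable_norm_eq by (intro holder.test_norm_upper assms holder.one)
qed

lemma leaf_mean_holder:
  assumes "f \<in> C1_unstable" "0 < \<beta>" "\<beta> < 1" "x \<in> {0..1}" "y \<in> {0..1}"
  shows "\<bar>leaf_mean f x - leaf_mean f y\<bar> \<le> strong_unstable_norm \<beta> f * \<bar>x - y\<bar> powr \<beta>"
  unfolding leaf_mean_def by (intro strong_unstable_norm_upper assms lip_tests_one)

text \<open>With zero mean, g s is the integral of g s - g u over u.\<close>

lemma mean_zero_bound:
  fixes g :: "real \<Rightarrow> real"
  assumes int: "set_integrable lborel {0..1} g" and zero: "(LBINT u:{0..1}. g u) = 0"
    and osc: "\<And>u. u \<in> {0..1} \<Longrightarrow> \<bar>g s - g u\<bar> \<le> B"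
  shows "\<bar>g s\<bar> \<le> B"
proof -
  have c: "(LBINT u:{0..1::real}. g s) = g s" by (simp add: set_lebesgue_integral_def)
  have "set_integrable lborel {0..1::real} (\<lambda>_. g s)" by (rule bounded_measurable_integrable) simp
  then have "(LBINT u:{0..1}. g s - g u) = (LBINT u:{0..1::real}. g s) - (LBINT u:{0..1}. g u)"
    using int by (rule set_integral_diff)
  then have "g s = (LBINT u:{0..1}. g s - g u)" using c zero by simp
  also have "\<bar>\<dots>\<bar> \<le> B" using osc by (rule unit_set_integral_bound)
  finally show ?thesis .
qed

context baker
begin

lemma baker_completion_weak:
  assumes "is_completion C1_unstable weak_norm E"
  shows "baker_completion \<kappa> h flip weak_norm E 1"
proof
  show "is_completion C1_unstable weak_norm E" by fact
  show "closable weak_norm" by (rule closable_weak_norm)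
  fix K and g :: "real \<Rightarrow> real" and \<epsilon> :: real assume g: "K-lipschitz_on {0..1} g" and \<epsilon>: "0 < \<epsilon>"
  \<comment> \<open>Any strong norm dominates the weak one, so the Cauchy property is borrowed with
    the arbitrary exponents 1/2.\<close>
  obtain N where N: "\<forall>m\<ge>N. \<forall>n\<ge>N. strong_norm (1/2) (1/2) (\<lambda>q. approx m g q - approx n g q) < \<epsilon>"
    using strong_norm_approx_cauchy[OF g _ _ \<epsilon>, of "1/2" "1/2"] by auto
  have "weak_norm (\<lambda>q. approx m g q - approx n g q) < \<epsilon>" if "m \<ge> N" "n \<ge> N" for m n
    using weak_le_strong_norm[OF C1_unstable_diff[OF approx_C1_unstable[OF g] approx_C1_unstable[OF g]],
        of "1/2" "1/2" m n] N that by fastforce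
  then show "\<exists>N. \<forall>m\<ge>N. \<forall>n\<ge>N. weak_norm (\<lambda>q. approx m g q - approx n g q) < \<epsilon>" by blast
next
  fix f m assume "f \<in> C1_unstable"
  then show "weak_norm (approx m (leaf_mean f)) \<le> 1 * weak_norm f"
    using weak_norm_approx[of "leaf_mean f" "weak_norm f"] leaf_mean_le_weak_norm by simp
qed simp

lemma strong_norm_approx_leaf_mean:
  assumes f: "f \<in> C1_unstable" and \<alpha>: "0 < \<alpha>" and \<beta>: "0 < \<beta>" "\<beta> < 1"
  shows "strong_norm \<alpha> \<beta> (approx m (leaf_mean f)) \<le> strong_norm \<alpha> \<beta> f"
proof -
  have "strong_norm \<alpha> \<beta> (approx m (leaf_mean f))
      \<le> strong_stable_norm \<alpha> f + real \<kappa> powr (- \<beta>) * strong_unstable_norm \<beta> f"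
    using leaf_mean_le_strong_stable_norm[OF f _ \<alpha>] leaf_mean_holder[OF f \<beta>]
    by (rule strong_norm_approx[OF _ _ \<alpha>])
  moreover have "real \<kappa> powr (- \<beta>) \<le> 1"
    using kappa \<beta> by (simp add: powr_minus_divide ge_one_powr_ge_zero)
  then have "real \<kappa> powr (- \<beta>) * strong_unstable_norm \<beta> f \<le> 1 * strong_unstable_norm \<beta> f"
    by (intro mult_right_mono strong_unstable_norm_nonneg[OF f \<beta>(2,1)])
  ultimately show ?thesis by (simp add: strong_norm_def)
qed

lemma baker_completion_strong:
  assumes "is_completion C1_unstable (strong_norm \<alpha> \<beta>) E" "0 < \<alpha>" "\<alpha> \<le> 1" "0 < \<beta>" "\<beta> < 1"
  shows "baker_completion \<kappa> h flip (strong_norm \<alpha> \<beta>) E 1"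
  using assms
  by unfold_locales
    (auto simp: weak_le_strong_norm closable_strong_norm strong_norm_approx_cauchy strong_norm_approx_leaf_mean)

end

text \<open>On mean zero functions the stable norm of the iterates is controlled by the oscillation of the
  leaf means, which the unstable norm measures and which each iterate contracts by \<open>\<kappa>\<^sup>-\<^sup>\<beta>\<close>.\<close>

lemma (in baker_completion) L_pow_E_decay:
  assumes p: "p = strong_norm \<alpha> \<beta>" and \<alpha>: "0 < \<alpha>" and \<beta>: "0 < \<beta>" "\<beta> < 1"
    and f: "f \<in> C1_unstable" and mass: "mass (E f) = 0"
  shows "norm ((L ^^ Suc n) (E f)) \<le> 2 * (real \<kappa> powr (- \<beta>)) ^ n * norm (E f)"
proof -
  define \<sigma> where "\<sigma> = real \<kappa> powr (- \<beta>)"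
  define H where "H = strong_unstable_norm \<beta> f"
  define g where "g k = (pf ^^ k) (leaf_mean f)" for k
  obtain K where K: "K-lipschitz_on {0..1} (leaf_mean f)" using leaf_mean_lipschitz[OF f] by blast
  have lip: "K-lipschitz_on {0..1} (g k)" for k unfolding g_def by (rule pf_pow_lipschitz[OF K])
  have \<sigma>: "0 \<le> \<sigma>" "\<sigma> \<le> 1"
    using kappa \<beta> by (simp_all add: \<sigma>_def powr_minus_divide ge_one_powr_ge_zero)
  have H: "0 \<le> H" unfolding H_def by (rule strong_unstable_norm_nonneg[OF f \<beta>(2,1)])
  have hol: "\<bar>g k x - g k y\<bar> \<le> \<sigma> ^ k * H * \<bar>x - y\<bar> powr \<beta>" if "x \<in> {0..1}" "y \<in> {0..1}" for k x y
    using that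
  proof (induction k arbitrary: x y)
    case 0
    then show ?case using leaf_mean_holder[OF f \<beta>] by (simp add: g_def H_def)
  next
    case (Suc k)
    show ?case
      using pf_holder[OF Suc.IH Suc.prems] by (simp add: g_def \<sigma>_def mult.assoc)
  qed
  have zero: "(LBINT s:{0..1}. g k s) = 0" for k
  proof (induction k)
    case 0
    then show ?case using mass mass_E[OF f] by (simp add: g_def)
  next
    case (Suc k)
    then show ?case using integral_pf[OF lip[of k]] by (simp add: g_def)
  qed
  have sup: "\<bar>g k s\<bar> \<le> \<sigma> ^ k * H" if s: "s \<in> {0..1}" for k s
  proof (rule mean_zero_bound[OF _ zero])
    show "set_integrable lborel {0..1} (g k)"
      by (intro bounded_measurable_integrable lipschitz_bounded_measurable[OF lip])
    fix u :: real assume u: "u \<in> {0..1}"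
    have "\<bar>s - u\<bar> powr \<beta> \<le> 1 powr \<beta>" using s u \<beta> by (intro powr_mono2) auto
    then have "\<sigma> ^ k * H * \<bar>s - u\<bar> powr \<beta> \<le> \<sigma> ^ k * H * 1"
      using \<sigma> H by (intro mult_left_mono) auto
    then show "\<bar>g k s - g k u\<bar> \<le> \<sigma> ^ k * H" using hol[OF s u, of k] by simp
  qed
  have "strong_norm \<alpha> \<beta> (approx m (g n)) \<le> 2 * \<sigma> ^ n * norm (E f)" for m
  proof -
    \<comment> \<open>The supremum of g n bounds the stable part, its Hoelder constant the unstable
      part; both are at most \<sigma> ^ n * H. The further factor
      \<open>\<kappa> powr (- \<beta>)\<close> is estimated by 1, whence the 2.\<close>
    have "strong_norm \<alpha> \<beta> (approx m (g n)) \<le> \<sigma> ^ n * H + real \<kappa> powr (- \<beta>) * (\<sigma> ^ n * H)"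
      using sup hol by (rule strong_norm_approx[OF _ _ \<alpha>])
    also have "\<dots> \<le> \<sigma> ^ n * H + 1 * (\<sigma> ^ n * H)"
      using \<sigma> H unfolding \<sigma>_def[symmetric] by (intro add_left_mono mult_right_mono) auto
    also have "\<dots> = 2 * \<sigma> ^ n * H" by simp
    also have "H \<le> norm (E f)"
      using leaf_mean_le_strong_stable_norm[OF f _ \<alpha>, of 0]
      by (simp add: norm_E[OF f] p strong_norm_def H_def)
    then have "2 * \<sigma> ^ n * H \<le> 2 * \<sigma> ^ n * norm (E f)" using \<sigma> by (intro mult_left_mono) auto
    finally show ?thesis .
  qed
  then have "norm (leafwise (g n)) \<le> 2 * \<sigma> ^ n * norm (E f)"
    by (intro norm_leafwise_le[OF lip]) (simp add: p)
  then show ?thesis by (simp only: L_pow_E[OF f] g_def \<sigma>_def)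
qed

text \<open>For functions the exponent lags by one, so a factor \<open>\<kappa> powr \<beta>\<close>
  restores the form \<sigma> ^ n; being at least 1, it also covers n = 0.\<close>

lemma (in baker_completion) rank_one_plus_contraction:
  assumes p: "p = strong_norm \<alpha> \<beta>" and \<alpha>: "0 < \<alpha>" and \<beta>: "0 < \<beta>" "\<beta> < 1"
  shows "rank_one_plus_contraction L mass \<mu> (2 * real \<kappa> powr \<beta>) (real \<kappa> powr (- \<beta>))"
proof (rule rank_one_plus_contraction.intro)
  have \<kappa>: "1 < real \<kappa>" using kappa by simp
  show "0 \<le> 2 * real \<kappa> powr \<beta>" "0 \<le> real \<kappa> powr (- \<beta>)" by simp_all
  show "real \<kappa> powr (- \<beta>) < 1" using powr_less_mono[of "- \<beta>" 0 "real \<kappa>"] \<beta> \<kappa> by simp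
  fix x n assume x: "mass x = 0"
  note mass_linear = bounded_linear_pairing[OF C1_stable_const, of 1]
  show "norm ((L ^^ n) x) \<le> 2 * real \<kappa> powr \<beta> * (real \<kappa> powr (- \<beta>)) ^ n * norm x"
  proof (cases n)
    case 0
    have "1 \<le> real \<kappa> powr \<beta>" using \<beta> \<kappa> by (simp add: ge_one_powr_ge_zero)
    then have "1 * norm x \<le> 2 * real \<kappa> powr \<beta> * norm x" by (intro mult_right_mono) auto
    then show ?thesis by (simp add: 0)
  next
    case (Suc k)
    obtain f where f: "\<And>n. f n \<in> C1_unstable" "(\<lambda>n. E (f n)) \<longlonglongrightarrow> x" using approximating_sequence by blast
    \<comment> \<open>Functions approximating x need not have mass 0, as the decay estimate demands.
      Subtracting their mass times the constant function 1 repairs this, and the correction vanishes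
      in the limit.\<close>
    define c where "c n = mass (E (f n))" for n
    define f' where "f' n = (\<lambda>q. f n q - c n * 1)" for n
    have f': "f' n \<in> C1_unstable" for n
      unfolding f'_def by (intro C1_unstable_diff C1_unstable_const f)
    have E_f': "E (f' n) = E (f n) - c n *\<^sub>R E (\<lambda>_. 1)" for n
      unfolding f'_def using E_diff[OF f(1) C1_unstable_const, of n "c n * 1"] E_scale[OF C1_unstable_const, of "c n" 1]
      by simp
    have "mass (E (\<lambda>_. 1)) = 1"
      by (simp add: mass_E leaf_mean_def leaf_integral_def set_lebesgue_integral_def)
    then have mass: "mass (E (f' n)) = 0" for n
      unfolding E_f' linear_diff[OF bounded_linear.linear[OF mass_linear]]
        linear_scale[OF bounded_linear.linear[OF mass_linear]] by (simp add: c_def)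
    have "c \<longlonglongrightarrow> 0"
      using bounded_linear.tendsto[OF mass_linear f(2)] by (simp add: c_def[abs_def] x)
    then have "(\<lambda>n. E (f n) - c n *\<^sub>R E (\<lambda>_. 1)) \<longlonglongrightarrow> x - 0 *\<^sub>R E (\<lambda>_. 1)"
      by (intro tendsto_intros f)
    then have lim: "(\<lambda>n. E (f' n)) \<longlonglongrightarrow> x" by (simp add: E_f')
    have cont: "(\<lambda>m. (L ^^ j) (E (f' m))) \<longlonglongrightarrow> (L ^^ j) x" for j
      by (induction j) (auto intro: bounded_linear.tendsto[OF bounded_linear_L] lim)
    have "norm ((L ^^ Suc k) x) \<le> 2 * (real \<kappa> powr (- \<beta>)) ^ k * norm x"
    proof (rule LIMSEQ_le[OF tendsto_norm[OF cont]])
      show "(\<lambda>m. 2 * (real \<kappa> powr (- \<beta>)) ^ k * norm (E (f' m))) \<longlonglongrightarrow> 2 * (real \<kappa> powr (- \<beta>)) ^ k * norm x"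
        by (intro tendsto_intros lim)
      show "\<exists>N. \<forall>m\<ge>N. norm ((L ^^ Suc k) (E (f' m))) \<le> 2 * (real \<kappa> powr (- \<beta>)) ^ k * norm (E (f' m))"
        using L_pow_E_decay[OF p \<alpha> \<beta> f' mass] by blast
    qed
    moreover have "real \<kappa> powr \<beta> * real \<kappa> powr (- \<beta>) = 1"
      using \<kappa> by (simp flip: powr_add)
    then have "2 * real \<kappa> powr \<beta> * (real \<kappa> powr (- \<beta>)) ^ Suc k = 2 * (real \<kappa> powr (- \<beta>)) ^ k" by simp
    ultimately show ?thesis by (simp only: Suc)
  qed
qed (auto simp: bounded_linear_L bounded_linear_pairing L_mu mass_mu mass_L)

theorem theorem2p10:
  fixes \<kappa> :: nat and h :: "nat \<Rightarrow> real" and flip :: "nat \<Rightarrow> bool"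
    and \<alpha> \<beta> :: real
    and T :: "real \<times> real \<Rightarrow> real \<times> real"
    and E :: "(real \<times> real \<Rightarrow> real) \<Rightarrow> 'b::banach"
    and Ew :: "(real \<times> real \<Rightarrow> real) \<Rightarrow> 'w::banach"
    and L :: "'b \<Rightarrow> 'b" and Lw :: "'w \<Rightarrow> 'w"
  assumes "\<kappa> \<ge> 2"
    and "\<And>i. i < \<kappa> \<Longrightarrow> h i \<in> {0..1}" and "inj_on h {..<\<kappa>}"
    and "0 < \<alpha>" "\<alpha> < 1" "0 < \<beta>" "\<beta> < 1" "\<beta> \<le> 1 - \<alpha>"
    and "T = singular_baker \<kappa> h flip"
    and "is_completion C1_unstable (strong_norm \<alpha> \<beta>) E"
    and "is_completion C1_unstable weak_norm Ew"
    and "L = transfer_operator E T"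
    and "Lw = transfer_operator Ew T"
  shows "(\<forall>x. \<exists>!y. transfer_image E T x y) \<and> bounded_linear L \<and>
    (\<forall>x. \<exists>!y. transfer_image Ew T x y) \<and> bounded_linear Lw \<and>
    quasi_compact L \<and> spectral_radius L = 1 \<and>
    essential_spectral_radius L \<le> real \<kappa> powr (- \<beta>) \<and>
    spectral_gap L \<and>
    (\<exists>\<mu>0.
      (\<forall>\<phi> \<in> C1_stable. pairing E \<mu>0 \<phi> = (\<Sum>i<\<kappa>. unstable_integral (h i) \<phi>) / real \<kappa>) \<and>
      (\<forall>\<nu>. is_probability_measure E \<nu> \<and> L \<nu> = \<nu> \<longleftrightarrow> \<nu> = \<mu>0) \<and>
      (\<exists>C \<sigma>. 0 < C \<and> 0 < \<sigma> \<and> \<sigma> < 1 \<and>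
        (\<forall>f. pairing E f (\<lambda>_. 1) = 1 \<longrightarrow>
          (\<forall>n. norm ((L ^^ n) f - \<mu>0) \<le> C * \<sigma> ^ n * norm f))))"
proof -
  interpret baker \<kappa> h flip by standard (use assms in auto)
  interpret strong: baker_completion \<kappa> h flip "strong_norm \<alpha> \<beta>" E 1
    using assms by (intro baker_completion_strong) auto
  interpret weak: baker_completion \<kappa> h flip weak_norm Ew 1
    using assms by (intro baker_completion_weak) auto
  have L: "L = strong.L" and Lw: "Lw = weak.L"
    using assms by (simp_all add: strong.L_def weak.L_def)
  interpret gap: rank_one_plus_contraction L strong.mass strong.\<mu> "2 * real \<kappa> powr \<beta>" "real \<kappa> powr (- \<beta>)"
    unfolding L using assms by (intro strong.rank_one_plus_contraction) auto
  \<comment> \<open>Of a probability measure, uniqueness uses only that its mass is 1.\<close>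
  have invariant: "is_probability_measure E \<nu> \<and> L \<nu> = \<nu> \<longleftrightarrow> \<nu> = strong.\<mu>" for \<nu>
    using strong.is_probability_measure_mu gap.L_mu gap.fixed_point_unique[of \<nu>]
      strong.mass_probability_measure[of \<nu>] by blast
  obtain C where C: "C > 0" "\<forall>f. strong.mass f = 1 \<longrightarrow>
      (\<forall>n. norm ((L ^^ n) f - strong.\<mu>) \<le> C * (real \<kappa> powr (- \<beta>)) ^ n * norm f)"
    using gap.convergence_to_mu by blast
  have "0 < real \<kappa> powr (- \<beta>)" using assms(1) by simp
  with C gap.sigma(2) have decay: "\<exists>C \<sigma>. 0 < C \<and> 0 < \<sigma> \<and> \<sigma> < 1 \<and> (\<forall>f. strong.mass f = 1 \<longrightarrow>
      (\<forall>n. norm ((L ^^ n) f - strong.\<mu>) \<le> C * \<sigma> ^ n * norm f))"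
    by blast
  show ?thesis
    unfolding assms(9) Lw
    by (intro conjI exI[of _ strong.\<mu>] allI ballI invariant decay strong.pairing_mu gap.L
        strong.transfer_image_ex1 weak.transfer_image_ex1 weak.bounded_linear_L gap.quasi_compact
        gap.spectral_radius_eq gap.essential_spectral_radius_le gap.spectral_gap)
qed

end
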